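(* Let $\mathcal{H}$ be a Hilbert space, $K_0$ a positive self-adjoint operator on $\mathcal{H}$, $(\mathcal{H}^s)_{s\in\mathbb{R}}$ the associated scale of Hilbert spaces, and let $r>0$. Assume: (A) $K_0$ has purely discrete spectrum and $\mathrm{spec}(K_0)\subseteq \{n+\lambda : n\in\mathbb{N}_0\}$ for some $\lambda\ge 0$. (B) There exist a self-adjoint operator $A\in\mathcal{L}(\mathcal{H}^r)$, an initial datum $\psi_0\in\mathcal{H}^r$ and a real $\mu>0$ such that the equation $i\dot\psi = A\psi$, $\psi(0)=\psi_0$, has a solution $\psi(t)\in\mathcal{H}^r$ for which there are constants $C_r>0$ and $T>0$ with $$\|\psi(t)\|_r\ \ge\ C_r\, t^{\mu r}\qquad\text{for all } t\ge T .$$ (C) For the operator $A$ in (B), the map $t\mapsto e^{-itK_0}\,A\,e^{itK_0}$ belongs to $C^\infty(\mathbb{R};\mathcal{L}(\mathcal{H}^r))$. Then there exists a family of self-adjoint operators $V_A(t)$, with $V_A\in C^\infty(\mathbb{T};\mathcal{L}(\mathcal{H}^r))$, such that $K_0+V_A(t)$ generates unbounded orbits. More precisely, there exists a smooth solution $\psi(t)$ of $$ i\partial_t\psi = K_0\psi + V_A(t)\psi ,$$ with $\psi(t)\in\mathcal{H}^r$ for all $t$, and there are constants $C_r>0$, $T>0$ such that $\|\psi(t)\|_r\ge C_r\,t^{\mu r}$ for all $t\ge T$ (with $\mu$ as in (B)).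
   Context: $\mathbb{N}_0=\{0,1,2,\dots\}$ and $\mathbb{T}=\mathbb{R}/2\pi\mathbb{Z}$; $C^\infty(\mathbb{T};\mathcal{L}(\mathcal{H}^r))$ is the space of smooth $2\pi$-periodic maps $\mathbb{R}\to\mathcal{L}(\mathcal{H}^r)$. $(\mathcal{H},\langle\cdot,\cdot\rangle)$ is a Hilbert space with norm $\|\cdot\|_0$. $K_0$ is self-adjoint and positive in the sense that there is $c_{K_0}>0$ with $\langle\psi,K_0\psi\rangle\ge c_{K_0}\|\psi\|_0^2$ for all $\psi\in\mathrm{Dom}(K_0^{1/2})$. For $s\ge0$, $\mathcal{H}^s=\mathrm{Dom}(K_0^s)$, and for $s<0$, $\mathcal{H}^s$ is the dual of $\mathcal{H}^{-s}$; the norm is $\|\psi\|_s=\|K_0^s\psi\|_0$. $\mathcal{L}(\mathcal{X})$ denotes the bounded operators on a Banach space $\mathcal{X}$. An operator in $\mathcal{L}(\mathcal{H}^r)$ is called self-adjoint if it is the restriction to $\mathcal{H}^r$ of a bounded self-adjoint operator on $\mathcal{H}$. A solution is smooth if it is smooth in time with values in the scale, i.e. $\psi\in C^k(\mathbb{R};\mathcal{H}^{r-k})$ for every $k\in\mathbb{N}_0$. *)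

theory Defs
  imports "HOL-Analysis.Analysis" "HOL-Library.Function_Algebras"
begin

text \<open>The inner product is antilinear in the first and linear in the second argument. The norm,
  the topology and completeness are those of the underlying real Hilbert space.\<close>

class complex_hilbert = real_inner + complete_space +
  fixes cscale :: "complex \<Rightarrow> 'a \<Rightarrow> 'a" (infixr "*\<^sub>C" 75)
    and cinner :: "'a \<Rightarrow> 'a \<Rightarrow> complex"
  assumes cscale_add_right: "a *\<^sub>C (x + y) = a *\<^sub>C x + a *\<^sub>C y"
    and cscale_add_left: "(a + b) *\<^sub>C x = a *\<^sub>C x + b *\<^sub>C x"
    and cscale_cscale: "a *\<^sub>C b *\<^sub>C x = (a * b) *\<^sub>C x"
    and scaleR_eq_cscale: "scaleR c x = complex_of_real c *\<^sub>C x"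
    and cinner_commute: "cinner x y = cnj (cinner y x)"
    and cinner_add_right: "cinner x (y + z) = cinner x y + cinner x z"
    and cinner_cscale_right: "cinner x (a *\<^sub>C y) = a * cinner x y"
    and inner_eq_Re_cinner: "inner x y = Re (cinner x y)"

definition csubspace :: "'a::complex_hilbert set \<Rightarrow> bool" where
  "csubspace S \<longleftrightarrow> 0 \<in> S \<and> (\<forall>x\<in>S. \<forall>y\<in>S. x + y \<in> S) \<and> (\<forall>a. \<forall>x\<in>S. a *\<^sub>C x \<in> S)"

definition clinear_on :: "'a::complex_hilbert set \<Rightarrow> ('a \<Rightarrow> 'a) \<Rightarrow> bool" where
  "clinear_on S f \<longleftrightarrow> (\<forall>x\<in>S. \<forall>y\<in>S. f (x + y) = f x + f y) \<and> (\<forall>a. \<forall>x\<in>S. f (a *\<^sub>C x) = a *\<^sub>C f x)"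

definition bounded_self_adjoint :: "('a::complex_hilbert \<Rightarrow> 'a) \<Rightarrow> bool" where
  "bounded_self_adjoint B \<longleftrightarrow> bounded_linear B \<and> clinear_on UNIV B \<and>
     (\<forall>x y. cinner x (B y) = cinner (B x) y)"

text \<open>An unbounded operator is a partial map whose domain is \<^const>\<open>dom\<close>.\<close>

abbreviation op_app :: "('a \<rightharpoonup> 'a) \<Rightarrow> 'a \<Rightarrow> 'a" (infixl "\<cdot>\<^sub>o" 90) where
  "K \<cdot>\<^sub>o x \<equiv> the (K x)"

definition linear_op :: "('a::complex_hilbert \<rightharpoonup> 'a) \<Rightarrow> bool" where
  "linear_op K \<longleftrightarrow> csubspace (dom K) \<and> clinear_on (dom K) (\<lambda>x. K \<cdot>\<^sub>o x)"

definition op_adjoint :: "('a::complex_hilbert \<rightharpoonup> 'a) \<Rightarrow> ('a \<rightharpoonup> 'a)" where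
  "op_adjoint K = (\<lambda>\<phi>.
     if \<exists>\<eta>. \<forall>\<psi>\<in>dom K. cinner \<phi> (K \<cdot>\<^sub>o \<psi>) = cinner \<eta> \<psi>
     then Some (THE \<eta>. \<forall>\<psi>\<in>dom K. cinner \<phi> (K \<cdot>\<^sub>o \<psi>) = cinner \<eta> \<psi>)
     else None)"

definition self_adjoint_op :: "('a::complex_hilbert \<rightharpoonup> 'a) \<Rightarrow> bool" where
  "self_adjoint_op K \<longleftrightarrow> linear_op K \<and> closure (dom K) = UNIV \<and> op_adjoint K = K"

definition resolvent_set :: "('a::complex_hilbert \<rightharpoonup> 'a) \<Rightarrow> complex set" where
  "resolvent_set K = {z. bij_betw (\<lambda>\<psi>. K \<cdot>\<^sub>o \<psi> - z *\<^sub>C \<psi>) (dom K) UNIV \<and>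
     (\<exists>C. \<forall>\<psi>\<in>dom K. norm \<psi> \<le> C * norm (K \<cdot>\<^sub>o \<psi> - z *\<^sub>C \<psi>))}"

definition spec :: "('a::complex_hilbert \<rightharpoonup> 'a) \<Rightarrow> complex set" where
  "spec K = - resolvent_set K"

definition eigenspace :: "('a::complex_hilbert \<rightharpoonup> 'a) \<Rightarrow> complex \<Rightarrow> 'a set" where
  "eigenspace K z = {\<psi>\<in>dom K. K \<cdot>\<^sub>o \<psi> = z *\<^sub>C \<psi>}"

text \<open>Every spectral point is an isolated eigenvalue of finite multiplicity. Finite dimension over
  the reals (\<^const>\<open>span\<close> is the real span) is the same as finite dimension over the complex numbers.\<close>

definition purely_discrete_spectrum :: "('a::complex_hilbert \<rightharpoonup> 'a) \<Rightarrow> bool" where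
  "purely_discrete_spectrum K \<longleftrightarrow> (\<forall>z\<in>spec K. z isolated_in spec K \<and>
     eigenspace K z \<noteq> {0} \<and> (\<exists>B. finite B \<and> eigenspace K z \<subseteq> span B))"

definition orthogonal_projection :: "('a::complex_hilbert \<Rightarrow> 'a) \<Rightarrow> bool" where
  "orthogonal_projection P \<longleftrightarrow> clinear_on UNIV P \<and> (\<forall>x. P (P x) = P x) \<and>
     (\<forall>x y. cinner x (P y) = cinner (P x) y)"

definition projection_valued_measure :: "(real set \<Rightarrow> 'a::complex_hilbert \<Rightarrow> 'a) \<Rightarrow> bool" where
  "projection_valued_measure E \<longleftrightarrow>
     (\<forall>S\<in>sets borel. orthogonal_projection (E S)) \<and> E UNIV = (\<lambda>x. x) \<and>
     (\<forall>S. range S \<subseteq> sets borel \<and> disjoint_family S \<longrightarrow>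
        (\<forall>\<psi>. (\<lambda>n::nat. E (S n) \<psi>) sums E (\<Union>n. S n) \<psi>))"

text \<open>The scalar measure \<open>S \<mapsto> \<langle>\<psi>, E(S)\<psi>\<rangle>\<close>.\<close>

definition scalar_measure :: "(real set \<Rightarrow> 'a::complex_hilbert \<Rightarrow> 'a) \<Rightarrow> 'a \<Rightarrow> real measure" where
  "scalar_measure E \<psi> = measure_of UNIV (sets borel) (\<lambda>S. ennreal ((norm (E S \<psi>))\<^sup>2))"

text \<open>\<open>G = \<integral> f dE\<close> for a Borel function \<open>f\<close>. By polarization the domain and the quadratic form
  already determine \<open>G\<close>; the norm identity then holds automatically.\<close>

definition is_spectral_integral ::
  "(real set \<Rightarrow> 'a::complex_hilbert \<Rightarrow> 'a) \<Rightarrow> (real \<Rightarrow> complex) \<Rightarrow> ('a \<rightharpoonup> 'a) \<Rightarrow> bool" where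
  "is_spectral_integral E f G \<longleftrightarrow> linear_op G \<and>
     dom G = {\<psi>. integrable (scalar_measure E \<psi>) (\<lambda>x. (cmod (f x))\<^sup>2)} \<and>
     (\<forall>\<psi>\<in>dom G. cinner \<psi> (G \<cdot>\<^sub>o \<psi>) = (\<integral>x. f x \<partial>scalar_measure E \<psi>) \<and>
        (norm (G \<cdot>\<^sub>o \<psi>))\<^sup>2 = (\<integral>x. (cmod (f x))\<^sup>2 \<partial>scalar_measure E \<psi>))"

text \<open>For self-adjoint \<open>K\<close> the spectral theorem provides existence and uniqueness (on Borel sets)
  of the spectral measure.\<close>

definition spectral_measure :: "('a::complex_hilbert \<rightharpoonup> 'a) \<Rightarrow> real set \<Rightarrow> 'a \<Rightarrow> 'a" where
  "spectral_measure K =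
     (SOME E. projection_valued_measure E \<and> is_spectral_integral E complex_of_real K)"

definition fun_calc :: "('a::complex_hilbert \<rightharpoonup> 'a) \<Rightarrow> (real \<Rightarrow> complex) \<Rightarrow> ('a \<rightharpoonup> 'a)" where
  "fun_calc K f = (THE G. is_spectral_integral (spectral_measure K) f G)"

text \<open>The absolute value is immaterial for positive \<open>K\<close>. It makes the domain of the power \<open>1/2\<close>
  the form domain of an arbitrary self-adjoint \<open>K\<close>, so that positivity can be phrased on it.\<close>

definition op_pow :: "('a::complex_hilbert \<rightharpoonup> 'a) \<Rightarrow> real \<Rightarrow> ('a \<rightharpoonup> 'a)" where
  "op_pow K s = fun_calc K (\<lambda>x. complex_of_real (\<bar>x\<bar> powr s))"

text \<open>On the form domain, \<open>\<langle>\<psi>, K\<psi>\<rangle>\<close> denotes the closed quadratic form of \<open>K\<close>.\<close>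

definition quad_form :: "('a::complex_hilbert \<rightharpoonup> 'a) \<Rightarrow> 'a \<Rightarrow> real" where
  "quad_form K \<psi> = (\<integral>x. x \<partial>scalar_measure (spectral_measure K) \<psi>)"

definition positive_op :: "('a::complex_hilbert \<rightharpoonup> 'a) \<Rightarrow> bool" where
  "positive_op K \<longleftrightarrow> (\<exists>c>0. \<forall>\<psi>\<in>dom (op_pow K (1/2)). quad_form K \<psi> \<ge> c * (norm \<psi>)\<^sup>2)"

text \<open>The unitary group \<open>e\<^sup>i\<^sup>t\<^sup>K\<close>.\<close>

definition op_exp :: "('a::complex_hilbert \<rightharpoonup> 'a) \<Rightarrow> real \<Rightarrow> 'a \<Rightarrow> 'a" where
  "op_exp K t \<psi> = fun_calc K (\<lambda>x. exp (\<i> * complex_of_real (t * x))) \<cdot>\<^sub>o \<psi>"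

text \<open>For \<open>s \<ge> 0\<close> the space of order \<open>s\<close> is a subspace of the Hilbert space.\<close>

definition scale_space :: "('a::complex_hilbert \<rightharpoonup> 'a) \<Rightarrow> real \<Rightarrow> 'a set" where
  "scale_space K s = dom (op_pow K s)"

definition scale_norm :: "('a::complex_hilbert \<rightharpoonup> 'a) \<Rightarrow> real \<Rightarrow> 'a \<Rightarrow> real" where
  "scale_norm K s \<psi> = norm (op_pow K s \<cdot>\<^sub>o \<psi>)"

text \<open>For \<open>s < 0\<close> the space of order \<open>s\<close> is the (anti)dual of the space of order \<open>-s\<close>, with the
  dual norm; on vectors this norm is \<open>\<parallel>K\<^sup>s \<psi>\<parallel>\<close>. Vectors \<open>\<psi>\<close> are embedded as the functionals
  \<open>\<xi> \<mapsto> \<langle>\<xi>, \<psi>\<rangle>\<close>. Values of a functional outside the space of order \<open>-s\<close> are irrelevant.\<close>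

definition dual_scale_space :: "('a::complex_hilbert \<rightharpoonup> 'a) \<Rightarrow> real \<Rightarrow> ('a \<Rightarrow> complex) set" where
  "dual_scale_space K s = {F.
     (\<forall>x\<in>scale_space K (-s). \<forall>y\<in>scale_space K (-s). F (x + y) = F x + F y) \<and>
     (\<forall>a. \<forall>x\<in>scale_space K (-s). F (a *\<^sub>C x) = cnj a * F x) \<and>
     (\<exists>C. \<forall>x\<in>scale_space K (-s). cmod (F x) \<le> C * scale_norm K (-s) x)}"

definition dual_scale_norm :: "('a::complex_hilbert \<rightharpoonup> 'a) \<Rightarrow> real \<Rightarrow> ('a \<Rightarrow> complex) \<Rightarrow> real" where
  "dual_scale_norm K s F = (SUP \<xi>\<in>{\<xi>\<in>scale_space K (-s). scale_norm K (-s) \<xi> \<le> 1}. cmod (F \<xi>))"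

definition embed_dual :: "'a::complex_hilbert \<Rightarrow> 'a \<Rightarrow> complex" where
  "embed_dual \<psi> = (\<lambda>\<xi>. cinner \<xi> \<psi>)"

text \<open>For \<open>0 < r < 1\<close>, the extension of \<open>K\<close> to a map from the space of order \<open>r\<close> to the space of
  order \<open>r - 1 < 0\<close>, that is, to functionals on the space of order \<open>1 - r\<close>.\<close>

definition op_ext :: "('a::complex_hilbert \<rightharpoonup> 'a) \<Rightarrow> real \<Rightarrow> 'a \<Rightarrow> 'a \<Rightarrow> complex" where
  "op_ext K r \<psi> = (\<lambda>\<xi>. cinner (op_pow K (1 - r) \<cdot>\<^sub>o \<xi>) (op_pow K r \<cdot>\<^sub>o \<psi>))"

text \<open>Bounded operators on the space of order \<open>r \<ge> 0\<close>; values outside that space are irrelevant.\<close>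

definition bounded_on_scale :: "('a::complex_hilbert \<rightharpoonup> 'a) \<Rightarrow> real \<Rightarrow> ('a \<Rightarrow> 'a) set" where
  "bounded_on_scale K r = {B. B ` scale_space K r \<subseteq> scale_space K r \<and>
     clinear_on (scale_space K r) B \<and>
     (\<exists>C. \<forall>\<psi>\<in>scale_space K r. scale_norm K r (B \<psi>) \<le> C * scale_norm K r \<psi>)}"

definition op_norm_on_scale :: "('a::complex_hilbert \<rightharpoonup> 'a) \<Rightarrow> real \<Rightarrow> ('a \<Rightarrow> 'a) \<Rightarrow> real" where
  "op_norm_on_scale K r B = (SUP \<psi>\<in>{\<psi>\<in>scale_space K r. scale_norm K r \<psi> \<le> 1}. scale_norm K r (B \<psi>))"

definition self_adjoint_on_scale :: "('a::complex_hilbert \<rightharpoonup> 'a) \<Rightarrow> real \<Rightarrow> ('a \<Rightarrow> 'a) \<Rightarrow> bool" where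
  "self_adjoint_on_scale K r A \<longleftrightarrow> A \<in> bounded_on_scale K r \<and>
     (\<exists>B. bounded_self_adjoint B \<and> (\<forall>\<psi>\<in>scale_space K r. A \<psi> = B \<psi>))"

instantiation "fun" :: (type, real_vector) real_vector
begin

definition scaleR_fun :: "real \<Rightarrow> ('a \<Rightarrow> 'b) \<Rightarrow> 'a \<Rightarrow> 'b" where
  "scaleR_fun c f = (\<lambda>x. c *\<^sub>R f x)"

instance
  by standard (simp_all add: scaleR_fun_def fun_eq_iff scaleR_add_right scaleR_add_left)

end

definition has_deriv_wrt ::
  "('b::real_vector \<Rightarrow> real) \<Rightarrow> (real \<Rightarrow> 'b) \<Rightarrow> 'b \<Rightarrow> real \<Rightarrow> bool" where
  "has_deriv_wrt N f D t \<longleftrightarrow> ((\<lambda>h. N ((f (t + h) - f t) /\<^sub>R h - D)) \<longlongrightarrow> 0) (at 0)"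

definition continuous_wrt :: "('b::real_vector \<Rightarrow> real) \<Rightarrow> (real \<Rightarrow> 'b) \<Rightarrow> bool" where
  "continuous_wrt N f \<longleftrightarrow> (\<forall>t. ((\<lambda>h. N (f (t + h) - f t)) \<longlongrightarrow> 0) (at 0))"

text \<open>\<open>C\<^sup>k(\<real>; X)\<close> for a linear space \<open>X\<close> with norm \<open>N\<close>; \<open>D j\<close> is the \<open>j\<close>-th derivative.\<close>

definition Ck_wrt ::
  "'b::real_vector set \<Rightarrow> ('b \<Rightarrow> real) \<Rightarrow> nat \<Rightarrow> (real \<Rightarrow> 'b) \<Rightarrow> bool" where
  "Ck_wrt X N k f \<longleftrightarrow> (\<exists>D. D 0 = f \<and> (\<forall>j\<le>k. \<forall>t. D j t \<in> X) \<and>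
     (\<forall>j<k. \<forall>t. has_deriv_wrt N (D j) (D (Suc j) t) t) \<and> continuous_wrt N (D k))"

definition smooth_op_family ::
  "('a::complex_hilbert \<rightharpoonup> 'a) \<Rightarrow> real \<Rightarrow> (real \<Rightarrow> 'a \<Rightarrow> 'a) \<Rightarrow> bool" where
  "smooth_op_family K r V \<longleftrightarrow> (\<forall>k. Ck_wrt (bounded_on_scale K r) (op_norm_on_scale K r) k V)"

definition periodic_smooth_op_family ::
  "('a::complex_hilbert \<rightharpoonup> 'a) \<Rightarrow> real \<Rightarrow> (real \<Rightarrow> 'a \<Rightarrow> 'a) \<Rightarrow> bool" where
  "periodic_smooth_op_family K r V \<longleftrightarrow> smooth_op_family K r V \<and>
     (\<forall>t. \<forall>\<psi>\<in>scale_space K r. V (t + 2 * pi) \<psi> = V t \<psi>)"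

definition Ck_scale ::
  "('a::complex_hilbert \<rightharpoonup> 'a) \<Rightarrow> nat \<Rightarrow> real \<Rightarrow> (real \<Rightarrow> 'a) \<Rightarrow> bool" where
  "Ck_scale K k s \<psi> \<longleftrightarrow>
     (if s \<ge> 0 then Ck_wrt (scale_space K s) (scale_norm K s) k \<psi>
      else Ck_wrt (dual_scale_space K s) (dual_scale_norm K s) k (\<lambda>t. embed_dual (\<psi> t)))"

text \<open>\<open>i \<psi>' = A \<psi>\<close> for \<open>A\<close> bounded on the space of order \<open>r\<close>.\<close>

definition solves_bounded_eq ::
  "('a::complex_hilbert \<rightharpoonup> 'a) \<Rightarrow> real \<Rightarrow> ('a \<Rightarrow> 'a) \<Rightarrow> (real \<Rightarrow> 'a) \<Rightarrow> bool" where
  "solves_bounded_eq K r A \<psi> \<longleftrightarrow>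
     (\<forall>t. \<psi> t \<in> scale_space K r \<and>
        has_deriv_wrt (scale_norm K r) \<psi> ((- \<i>) *\<^sub>C A (\<psi> t)) t)"

text \<open>\<open>i \<psi>' = K \<psi> + V(t) \<psi>\<close> for \<open>\<psi>\<close> with values in the space of order \<open>r > 0\<close>. As \<open>K \<psi>\<close> has order
  \<open>r - 1\<close>, the equation holds in that space, which consists of functionals if \<open>r < 1\<close>.\<close>

definition solves_perturbed_eq ::
  "('a::complex_hilbert \<rightharpoonup> 'a) \<Rightarrow> real \<Rightarrow> (real \<Rightarrow> 'a \<Rightarrow> 'a) \<Rightarrow> (real \<Rightarrow> 'a) \<Rightarrow> bool" where
  "solves_perturbed_eq K r V \<psi> \<longleftrightarrow>
     (\<forall>t. \<psi> t \<in> scale_space K r \<and>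
        (if r \<ge> 1
         then has_deriv_wrt (scale_norm K (r - 1)) \<psi> ((- \<i>) *\<^sub>C (K \<cdot>\<^sub>o \<psi> t + V t (\<psi> t))) t
         else has_deriv_wrt (dual_scale_norm K (r - 1)) (\<lambda>t. embed_dual (\<psi> t))
                (\<lambda>\<xi>. - \<i> * (op_ext K r (\<psi> t) \<xi> + embed_dual (V t (\<psi> t)) \<xi>)) t))"

definition smooth_in_scale :: "('a::complex_hilbert \<rightharpoonup> 'a) \<Rightarrow> real \<Rightarrow> (real \<Rightarrow> 'a) \<Rightarrow> bool" where
  "smooth_in_scale K r \<psi> \<longleftrightarrow> (\<forall>k. Ck_scale K k (r - real k) \<psi>)"

definition grows_at_rate ::
  "('a::complex_hilbert \<rightharpoonup> 'a) \<Rightarrow> real \<Rightarrow> real \<Rightarrow> (real \<Rightarrow> 'a) \<Rightarrow> bool" where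
  "grows_at_rate K r \<mu> \<psi> \<longleftrightarrow>
     (\<exists>C>0. \<exists>T>0. \<forall>t\<ge>T. scale_norm K r (\<psi> t) \<ge> C * t powr (\<mu> * r))"

end

theory Submission
  imports Defs
begin

text \<open>
  The perturbation is \<open>A\<close> seen from the frame that rotates with \<open>K\<close>: with \<open>V(t) = e\<^sup>-\<^sup>i\<^sup>t\<^sup>K A e\<^sup>i\<^sup>t\<^sup>K\<close>
  and \<open>\<psi>(t) = e\<^sup>-\<^sup>i\<^sup>t\<^sup>K \<phi>(t)\<close>, the equation \<open>i\<phi>' = A\<phi>\<close> turns into \<open>i\<psi>' = K\<psi> + V(t)\<psi>\<close>. The group is
  unitary and commutes with all powers of \<open>K\<close>, so \<open>V(t)\<close> stays self-adjoint and \<open>\<psi>\<close> has the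
  norms of \<open>\<phi>\<close>, hence its growth. The eigenvalues of \<open>K\<close> differ by integers, so \<open>e\<^sup>2\<^sup>\<pi>\<^sup>i\<^sup>K\<close> is a
  scalar and \<open>V\<close> is \<open>2\<pi>\<close>-periodic.

  To compute with the functional calculus of \<open>K\<close>, its spectral measure has to be known
  explicitly, and this rests on \<open>eigenvectors_total\<close>: the eigenvectors of \<open>K\<close> span a dense subspace.
  The distance of a real point to the spectrum bounds \<open>\<parallel>(K - w)\<psi>\<parallel>\<close> from below
  (\<open>norm_ge_distance_to_spectrum\<close>), so the quadratic forms of \<open>K\<close> and of \<open>T = (K - lam + 1)\<^sup>-\<^sup>1\<close>
  know the gaps in the spectrum. On the complement of the eigenvectors the top of the numerical
  range of \<open>T\<close> can never sit at one of the points \<open>1, 1/2, 1/3, \<dots>\<close> nor in a gap between them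
  (\<open>symmetric_numerical_range_gap\<close>), so \<open>T\<close> vanishes there and the complement is trivial. The
  projections onto the eigenspaces then diagonalize \<open>K\<close>, and every spectral measure of \<open>K\<close> agrees
  with theirs because the variance of \<open>K\<close> in an eigenvector is zero. So every function of \<open>K\<close>
  multiplies the components of a vector by numbers (\<open>fun_calc_eq_diag\<close>).

  Smoothness in the scale is reduced to differentiation in the Hilbert space. A derivative of the
  group costs one power of \<open>K\<close>, so the \<open>k\<close>-th derivative of \<open>\<psi>\<close> has order \<open>r - k\<close>, and applying
  \<open>K\<^sup>r\<^sup>-\<^sup>k\<close> to it gives a function \<open>G\<^sub>k\<close> with values in the Hilbert space. These satisfy
  \<open>(K\<^sup>-\<^sup>1 G\<^sub>k)' = G\<^sub>k\<^sub>+\<^sub>1\<close> in the ordinary sense (\<open>rotating_deriv_has_vector_derivative\<close>). The isometry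
  \<open>K\<^sup>-\<^sup>s\<close> from the Hilbert space onto the space of order \<open>s\<close> carries such chains of derivatives to any
  order, whether that space consists of vectors or of functionals (\<open>Ck_scale_if_chain\<close>). The
  equation for \<open>\<psi>\<close> is the case \<open>k = 0\<close>.
\<close>

section \<open>Complex Hilbert spaces\<close>

instance complex_hilbert \<subseteq> banach ..

lemma cinner_add_left: "cinner (x + y) z = cinner x z + cinner y z"
  for x y z :: "'a::complex_hilbert"
  by (metis cinner_add_right cinner_commute complex_cnj_add)

lemma cinner_cscale_left: "cinner (a *\<^sub>C x) y = cnj a * cinner x y"
  for x y :: "'a::complex_hilbert"
  by (metis cinner_commute cinner_cscale_right complex_cnj_mult)

lemma cscale_one [simp]: "1 *\<^sub>C x = x" for x :: "'a::complex_hilbert"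
  by (metis of_real_1 scaleR_eq_cscale scaleR_one)

lemma cscale_zero_left [simp]: "0 *\<^sub>C x = 0" for x :: "'a::complex_hilbert"
  by (metis of_real_0 scaleR_eq_cscale scaleR_zero_left)

lemma cscale_zero_right [simp]: "a *\<^sub>C (0::'a::complex_hilbert) = 0"
  by (metis add_cancel_right_right cscale_add_right)

lemma cscale_minus_right: "a *\<^sub>C (- x) = - (a *\<^sub>C x)" for x :: "'a::complex_hilbert"
  by (metis cscale_add_right cscale_zero_right neg_eq_iff_add_eq_0)

lemma cscale_minus_left: "(- a) *\<^sub>C x = - (a *\<^sub>C x)" for x :: "'a::complex_hilbert"
  by (metis cscale_add_left cscale_zero_left neg_eq_iff_add_eq_0 add.right_inverse)

lemma cscale_diff_right: "a *\<^sub>C (x - y) = a *\<^sub>C x - a *\<^sub>C y" for x y :: "'a::complex_hilbert"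
  by (metis cscale_add_right cscale_minus_right diff_conv_add_uminus)

lemma cscale_diff_left: "(a - b) *\<^sub>C x = a *\<^sub>C x - b *\<^sub>C x" for x :: "'a::complex_hilbert"
  by (metis cscale_add_left cscale_minus_left diff_conv_add_uminus)

lemma cscale_scaleR: "a *\<^sub>C (c *\<^sub>R x) = c *\<^sub>R (a *\<^sub>C x)" for x :: "'a::complex_hilbert"
  by (simp add: scaleR_eq_cscale cscale_cscale mult.commute)

lemma cinner_zero_right [simp]: "cinner x (0::'a::complex_hilbert) = 0"
  by (metis add_cancel_right_right cinner_add_right)

lemma cinner_zero_left [simp]: "cinner (0::'a::complex_hilbert) x = 0"
  by (metis add_cancel_right_right cinner_add_left)

lemma cinner_minus_right: "cinner x (- y) = - cinner x y" for x y :: "'a::complex_hilbert"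
  by (metis cinner_add_right cinner_zero_right neg_eq_iff_add_eq_0 add.right_inverse)

lemma cinner_diff_right: "cinner x (y - z) = cinner x y - cinner x z" for x y z :: "'a::complex_hilbert"
  by (metis cinner_add_right cinner_minus_right diff_conv_add_uminus)

lemma cinner_diff_left: "cinner (x - y) z = cinner x z - cinner y z" for x y z :: "'a::complex_hilbert"
  by (metis cinner_diff_right cinner_commute complex_cnj_diff)

lemma cinner_self: "cinner x x = complex_of_real ((norm x)\<^sup>2)" for x :: "'a::complex_hilbert"
proof -
  have "Im (cinner x x) = 0"
    using arg_cong [OF cinner_commute [of x x], of Im] by simp
  moreover have "Re (cinner x x) = (norm x)\<^sup>2"
    by (metis inner_eq_Re_cinner power2_norm_eq_inner)
  ultimately show ?thesis by (simp add: complex_eq_iff)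
qed

lemma norm_cscale [simp]: "norm (a *\<^sub>C x) = cmod a * norm x" for x :: "'a::complex_hilbert"
proof -
  have "complex_of_real ((norm (a *\<^sub>C x))\<^sup>2) = cnj a * (a * complex_of_real ((norm x)\<^sup>2))"
    by (simp only: cinner_self [symmetric] cinner_cscale_left cinner_cscale_right mult.left_commute)
  also have "\<dots> = complex_of_real ((cmod a * norm x)\<^sup>2)"
    using complex_norm_square [of a] by (simp add: power_mult_distrib mult_ac)
  finally have "(norm (a *\<^sub>C x))\<^sup>2 = (cmod a * norm x)\<^sup>2" using of_real_eq_iff by blast
  then show ?thesis by (simp add: power2_eq_iff_nonneg)
qed

text \<open>The imaginary part of the inner product is itself a real inner product, against a rotated
  vector; this carries facts on real inner products over to the complex one.\<close>

lemma cinner_eq_Complex_inner: "cinner x y = Complex (inner x y) (inner x ((- \<i>) *\<^sub>C y))"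
  for x y :: "'a::complex_hilbert"
  by (simp add: inner_eq_Re_cinner cinner_cscale_right complex_eq_iff)

lemma cinner_cauchy_schwarz: "cmod (cinner x y) \<le> norm x * norm y" for x y :: "'a::complex_hilbert"
proof (cases "cinner x y = 0")
  case False
  define a where "a = cnj (sgn (cinner x y))"
  have a: "cmod a = 1" using False by (simp add: a_def norm_sgn)
  have "cinner x (a *\<^sub>C y) = complex_of_real (cmod (cinner x y))"
    using False
    by (simp add: cinner_cscale_right a_def sgn_eq field_simps complex_norm_square [symmetric] power2_eq_square)
  then have "inner x (a *\<^sub>C y) = cmod (cinner x y)" by (simp add: inner_eq_Re_cinner)
  then show ?thesis using norm_cauchy_schwarz [of x "a *\<^sub>C y"] a by simp
qed simp

lemma bounded_linear_cscale: "bounded_linear (\<lambda>x::'a::complex_hilbert. a *\<^sub>C x)"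
  by (rule bounded_linear_intro [where K = "cmod a"])
     (auto simp: cscale_add_right cscale_scaleR mult.commute)

lemma bounded_linear_cinner_right: "bounded_linear (\<lambda>y::'a::complex_hilbert. cinner x y)"
  by (rule bounded_linear_intro [where K = "norm x"])
     (auto simp: cinner_add_right scaleR_eq_cscale cinner_cscale_right scaleR_conv_of_real
        mult.commute [of _ "norm x"] intro: cinner_cauchy_schwarz)

text \<open>Multiplication by \<open>-\<i>\<close> preserves a complex subspace and exchanges real and imaginary part of the
  inner product, so real orthogonality to it is complex orthogonality.\<close>

lemma cinner_eq_0_if_inner_eq_0:
  assumes "csubspace S" "\<And>m. m \<in> S \<Longrightarrow> inner x m = 0" "m \<in> S"
  shows "cinner x m = 0"
proof -
  have "(- \<i>) *\<^sub>C m \<in> S" using assms by (auto simp: csubspace_def)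
  then show ?thesis using assms by (simp add: cinner_eq_Complex_inner complex_eq_iff)
qed

lemma clinear_on_UNIV_D:
  assumes "clinear_on UNIV f"
  shows "f (x + y) = f x + f y" "f (a *\<^sub>C x) = a *\<^sub>C f x" "f 0 = 0" "f (- x) = - f x"
    "f (x - y) = f x - f y" "f (c *\<^sub>R x) = c *\<^sub>R f x"
proof -
  show add: "f (x + y) = f x + f y" for x y using assms by (simp add: clinear_on_def)
  show scale: "f (a *\<^sub>C x) = a *\<^sub>C f x" for a x using assms by (simp add: clinear_on_def)
  show "f 0 = 0" using scale [of 0 0] by simp
  show neg: "f (- x) = - f x" for x using scale [of "-1" x] by (simp add: cscale_minus_left)
  show "f (x - y) = f x - f y" using add [of x "- y"] neg by simp
  show "f (c *\<^sub>R x) = c *\<^sub>R f x" by (simp add: scaleR_eq_cscale scale)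
qed

lemma csubspace_diff: "csubspace S \<Longrightarrow> x \<in> S \<Longrightarrow> y \<in> S \<Longrightarrow> x - y \<in> S"
  unfolding csubspace_def by (metis cscale_minus_left cscale_one diff_conv_add_uminus)

lemma csubspace_imp_subspace: "csubspace S \<Longrightarrow> subspace S"
  unfolding subspace_def csubspace_def by (metis scaleR_eq_cscale)

lemma clinear_on_diff:
  assumes "csubspace S" "clinear_on S f" "x \<in> S" "y \<in> S"
  shows "f (x - y) = f x - f y"
proof -
  have "f ((-1) *\<^sub>C y) = (-1) *\<^sub>C f y" and "(-1) *\<^sub>C y \<in> S"
    using assms by (auto simp: clinear_on_def csubspace_def)
  moreover have "f (x + (-1) *\<^sub>C y) = f x + f ((-1) *\<^sub>C y)"
    using assms calculation by (auto simp: clinear_on_def)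
  ultimately show ?thesis by (simp add: cscale_minus_left)
qed

section \<open>Orthogonal projections\<close>

text \<open>A minimizing sequence for the distance to a closed subspace is Cauchy by the parallelogram
  law, and the first variation vanishes at its limit.\<close>

lemma orthogonal_projection_exists:
  fixes S :: "'a::{real_inner,complete_space} set"
  assumes "closed S" "subspace S"
  shows "\<exists>p\<in>S. \<forall>m\<in>S. inner (x - p) m = 0"
proof -
  define d where "d = infdist x S"
  have ne: "S \<noteq> {}" using assms(2) subspace_0 by auto
  have d0: "d \<ge> 0" by (simp add: d_def infdist_nonneg)
  have "\<exists>y\<in>S. dist x y < d + inverse (real (Suc n))" for n
  proof -
    have "Inf ((dist x) ` S) < d + inverse (real (Suc n))"
      using ne by (simp add: d_def infdist_notempty del: of_nat_Suc)
    then show ?thesis using ne by (subst (asm) cInf_less_iff) (auto intro!: bdd_belowI [of _ 0])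
  qed
  then obtain y where y: "y n \<in> S" "dist x (y n) < d + inverse (real (Suc n))" for n by metis
  have low: "norm (x - s) \<ge> d" if "s \<in> S" for s
    using infdist_le [OF that, of x] by (simp add: d_def dist_norm)
  have par: "(norm (u - v))\<^sup>2 \<le> 2 * ((norm (x - u))\<^sup>2 - d\<^sup>2) + 2 * ((norm (x - v))\<^sup>2 - d\<^sup>2)"
    if "u \<in> S" "v \<in> S" for u v
  proof -
    have "(1/2) *\<^sub>R (u + v) \<in> S" using assms(2) that by (auto intro: subspace_scale subspace_add)
    then have "norm (x - (1/2) *\<^sub>R (u + v)) \<ge> d" by (rule low)
    then have "d\<^sup>2 \<le> (norm (x - (1/2) *\<^sub>R (u + v)))\<^sup>2" using d0 by (intro power_mono)
    moreover have "(norm (u - v))\<^sup>2 + 4 * (norm (x - (1/2) *\<^sub>R (u + v)))\<^sup>2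
        = 2 * (norm (x - u))\<^sup>2 + 2 * (norm (x - v))\<^sup>2"
      by (simp add: power2_norm_eq_inner inner_diff_left inner_diff_right inner_add_left
          inner_add_right inner_commute algebra_simps)
    moreover have "w \<le> 2 * (a - d\<^sup>2) + 2 * (b - d\<^sup>2)"
      if "d\<^sup>2 \<le> m" "w + 4 * m = 2 * a + 2 * b" for w m a b :: real
      using that by (simp add: algebra_simps)
    ultimately show ?thesis by blast
  qed
  have lim: "(\<lambda>n. norm (x - y n)) \<longlonglongrightarrow> d"
  proof (rule real_tendsto_sandwich)
    show "\<forall>\<^sub>F n in sequentially. d \<le> norm (x - y n)" using low y by simp
    show "\<forall>\<^sub>F n in sequentially. norm (x - y n) \<le> d + inverse (real (Suc n))"
      using y(2) by (intro always_eventually allI) (simp add: dist_norm less_imp_le)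
    show "(\<lambda>n. d + inverse (real (Suc n))) \<longlonglongrightarrow> d"
      using tendsto_add [OF tendsto_const LIMSEQ_inverse_real_of_nat, of d] by simp
  qed simp
  have lim2: "(\<lambda>n. (norm (x - y n))\<^sup>2 - d\<^sup>2) \<longlonglongrightarrow> 0"
    using tendsto_diff [OF tendsto_power [OF lim, of 2] tendsto_const [of "d\<^sup>2"]] by simp
  have "Cauchy y"
  proof (rule CauchyI)
    fix e :: real assume e: "e > 0"
    then have "e\<^sup>2 / 4 > 0" by simp
    then obtain N where N: "\<And>n. n \<ge> N \<Longrightarrow> (norm (x - y n))\<^sup>2 - d\<^sup>2 < e\<^sup>2 / 4"
      using order_tendstoD(2) [OF lim2] unfolding eventually_sequentially by blast
    have "norm (y m - y n) < e" if "m \<ge> N" "n \<ge> N" for m n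
    proof -
      have "(norm (y m - y n))\<^sup>2 < e\<^sup>2"
        using par [OF y(1) y(1), of m n] N [OF that(1)] N [OF that(2)] by argo
      then show ?thesis using e by (simp add: power2_less_imp_less)
    qed
    then show "\<exists>M. \<forall>m\<ge>M. \<forall>n\<ge>M. norm (y m - y n) < e" by blast
  qed
  then obtain p where p: "y \<longlonglongrightarrow> p" using Cauchy_convergent convergentD by blast
  have pS: "p \<in> S" using closed_sequentially [OF assms(1) _ p] y(1) by blast
  have "(\<lambda>n. norm (x - y n)) \<longlonglongrightarrow> norm (x - p)" using p by (intro tendsto_intros)
  then have pd: "norm (x - p) = d" using lim LIMSEQ_unique by blast
  have "inner (x - p) m = 0" if m: "m \<in> S" for m
  proof (cases "m = 0")
    case False
    define s where "s = inner (x - p) m / inner m m"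
    have mm: "inner m m > 0" using False by simp
    have "p + s *\<^sub>R m \<in> S" using assms(2) m pS by (auto intro: subspace_scale subspace_add)
    then have "d \<le> norm (x - (p + s *\<^sub>R m))" by (rule low)
    then have "d\<^sup>2 \<le> (norm (x - p - s *\<^sub>R m))\<^sup>2" using d0 by (simp add: power_mono diff_diff_eq)
    also have "\<dots> = (norm (x - p))\<^sup>2 - 2 * s * inner (x - p) m + s\<^sup>2 * inner m m"
      unfolding power2_norm_eq_inner
      by (simp add: inner_diff_left inner_diff_right inner_commute algebra_simps power2_eq_square)
    also have "\<dots> = d\<^sup>2 - (inner (x - p) m)\<^sup>2 / inner m m"
      using mm by (simp add: pd s_def field_simps power2_eq_square)
    finally have "(inner (x - p) m)\<^sup>2 / inner m m \<le> 0" by simp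
    then show ?thesis using mm by (simp add: divide_le_0_iff)
  qed simp
  then show ?thesis using pS by blast
qed

definition proj_on :: "'a::complex_hilbert set \<Rightarrow> 'a \<Rightarrow> 'a" where
  "proj_on S x = (SOME p. p \<in> S \<and> (\<forall>m\<in>S. inner (x - p) m = 0))"

lemma proj_on:
  assumes "closed S" "csubspace S"
  shows proj_on_in: "proj_on S x \<in> S" and proj_on_orth: "m \<in> S \<Longrightarrow> cinner (x - proj_on S x) m = 0"
proof -
  have *: "proj_on S x \<in> S \<and> (\<forall>m\<in>S. inner (x - proj_on S x) m = 0)"
    unfolding proj_on_def
    using someI_ex [of "\<lambda>p. p \<in> S \<and> (\<forall>m\<in>S. inner (x - p) m = 0)"]
      orthogonal_projection_exists [OF assms(1) csubspace_imp_subspace [OF assms(2)], of x] by blast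
  then show "proj_on S x \<in> S" by blast
  show "m \<in> S \<Longrightarrow> cinner (x - proj_on S x) m = 0"
    using * cinner_eq_0_if_inner_eq_0 [OF assms(2), of "x - proj_on S x" m] by blast
qed

lemma proj_on_eqI:
  assumes "closed S" "csubspace S" "p \<in> S" "\<And>m. m \<in> S \<Longrightarrow> cinner (x - p) m = 0"
  shows "proj_on S x = p"
proof -
  let ?q = "proj_on S x"
  have "p - ?q \<in> S" using assms proj_on_in csubspace_diff by blast
  then have "cinner (x - ?q) (p - ?q) = 0" "cinner (x - p) (p - ?q) = 0"
    using assms proj_on_orth by blast+
  then have "cinner (p - ?q) (p - ?q) = 0" by (simp add: cinner_diff_left)
  then show ?thesis by (simp add: cinner_self)
qed

lemma orthogonal_projection_proj_on:
  assumes "closed S" "csubspace S"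
  shows "orthogonal_projection (proj_on S)"
proof -
  note pr = proj_on [OF assms]
  have add: "proj_on S (x + y) = proj_on S x + proj_on S y" for x y
  proof (rule proj_on_eqI [OF assms])
    show "proj_on S x + proj_on S y \<in> S" using pr assms(2) by (auto simp: csubspace_def)
    show "cinner (x + y - (proj_on S x + proj_on S y)) m = 0" if "m \<in> S" for m
      using pr(2) [OF that, of x] pr(2) [OF that, of y]
      by (simp add: cinner_diff_left cinner_add_left)
  qed
  have scale: "proj_on S (a *\<^sub>C x) = a *\<^sub>C proj_on S x" for a x
  proof (rule proj_on_eqI [OF assms])
    show "a *\<^sub>C proj_on S x \<in> S" using pr assms(2) by (auto simp: csubspace_def)
    show "cinner (a *\<^sub>C x - a *\<^sub>C proj_on S x) m = 0" if "m \<in> S" for m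
      using pr(2) [OF that, of x] by (simp add: cscale_diff_right [symmetric] cinner_cscale_left)
  qed
  have idem: "proj_on S (proj_on S x) = proj_on S x" for x
    by (rule proj_on_eqI [OF assms]) (auto intro: pr)
  have 1: "cinner (proj_on S y) (proj_on S x) = cinner y (proj_on S x)" for x y
    using pr(2) [OF pr(1) [of x], of y] by (simp add: cinner_diff_left)
  have "cinner x (proj_on S y) = cinner (proj_on S x) y" for x y
    by (metis 1 cinner_commute)
  then show ?thesis using add scale idem
    by (simp add: orthogonal_projection_def clinear_on_def)
qed

lemma orthogonal_projectionD:
  assumes "orthogonal_projection P"
  shows "clinear_on UNIV P" "P (P x) = P x" "cinner x (P y) = cinner (P x) y"
    "cinner x (P x) = complex_of_real ((norm (P x))\<^sup>2)" "inner x (P x) = (norm (P x))\<^sup>2"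
    "norm (P x) \<le> norm x" "bounded_linear P"
proof -
  show lin: "clinear_on UNIV P" using assms by (auto simp: orthogonal_projection_def)
  show idem: "P (P x) = P x" for x using assms by (auto simp: orthogonal_projection_def)
  show sym: "cinner x (P y) = cinner (P x) y" for x y
    using assms by (auto simp: orthogonal_projection_def)
  show *: "cinner x (P x) = complex_of_real ((norm (P x))\<^sup>2)" for x
    by (metis cinner_self idem sym)
  show i: "inner x (P x) = (norm (P x))\<^sup>2" for x by (simp add: inner_eq_Re_cinner *)
  show le: "norm (P x) \<le> norm x" for x
  proof (cases "P x = 0")
    case False
    have "norm (P x) * norm (P x) \<le> norm x * norm (P x)"
      using norm_cauchy_schwarz [of x "P x"] i [of x] by (simp add: power2_eq_square)
    then show ?thesis using False by simp
  qed simp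
  show "bounded_linear P"
    by (rule bounded_linear_intro [where K = 1]) (auto simp: clinear_on_UNIV_D [OF lin] le)
qed

section \<open>Symmetric operators on real Hilbert spaces\<close>

text \<open>On a unit vector that nearly attains the norm \<open>c\<close> of a symmetric \<open>R\<close>, the vector \<open>R\<^sup>2x - c\<^sup>2x\<close> is
  nearly zero, because \<open>\<parallel>R\<^sup>2x - c\<^sup>2x\<parallel>\<^sup>2 \<le> c\<^sup>2(c\<^sup>2 - \<parallel>Rx\<parallel>\<^sup>2)\<close>. So \<open>c\<close> or \<open>-c\<close> is an approximate
  eigenvalue.\<close>

lemma onorm_approximate_eigenvalue:
  fixes R :: "'a::real_inner \<Rightarrow> 'a"
  assumes lin: "bounded_linear R" and sym: "\<And>x y. inner (R x) y = inner x (R y)"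
    and pos: "onorm R > 0" and "\<delta> > 0"
  shows "\<exists>x. norm (R (R x) - (onorm R)\<^sup>2 *\<^sub>R x) < \<delta> * norm x"
proof (rule ccontr)
  assume "\<not> ?thesis"
  then have bb: "\<delta> * norm x \<le> norm (R (R x) - (onorm R)\<^sup>2 *\<^sub>R x)" for x by (auto simp: not_less)
  define c where "c = onorm R"
  have c: "norm (R x) \<le> c * norm x" for x unfolding c_def by (rule onorm [OF lin])
  have c0: "c > 0" using pos c_def by simp
  have est: "(norm (R x))\<^sup>2 \<le> (c\<^sup>2 - \<delta>\<^sup>2 / c\<^sup>2) * (norm x)\<^sup>2" for x
  proof -
    have "(norm (R (R x) - c\<^sup>2 *\<^sub>R x))\<^sup>2 = (norm (R (R x)))\<^sup>2 - 2 * c\<^sup>2 * inner (R (R x)) x + c\<^sup>2 * c\<^sup>2 * (norm x)\<^sup>2"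
      by (simp add: power2_norm_eq_inner inner_diff_left inner_diff_right inner_commute algebra_simps)
    also have "inner (R (R x)) x = (norm (R x))\<^sup>2" by (simp add: sym power2_norm_eq_inner)
    also have "(norm (R (R x)))\<^sup>2 \<le> c\<^sup>2 * (norm (R x))\<^sup>2"
      using power_mono [OF c [of "R x"], of 2] by (simp add: power_mult_distrib)
    finally have "(norm (R (R x) - c\<^sup>2 *\<^sub>R x))\<^sup>2 \<le> c\<^sup>2 * (c\<^sup>2 * (norm x)\<^sup>2 - (norm (R x))\<^sup>2)"
      by (simp add: algebra_simps)
    moreover have "\<delta>\<^sup>2 * (norm x)\<^sup>2 \<le> (norm (R (R x) - c\<^sup>2 *\<^sub>R x))\<^sup>2"
      using power_mono [OF bb [of x], of 2] \<open>\<delta> > 0\<close> by (simp add: power_mult_distrib c_def)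
    ultimately have "\<delta>\<^sup>2 * (norm x)\<^sup>2 \<le> c\<^sup>2 * (c\<^sup>2 * (norm x)\<^sup>2 - (norm (R x))\<^sup>2)" by linarith
    then have "\<delta>\<^sup>2 * (norm x)\<^sup>2 / c\<^sup>2 \<le> c\<^sup>2 * (norm x)\<^sup>2 - (norm (R x))\<^sup>2"
      using c0 by (simp add: divide_le_eq mult.commute)
    then show ?thesis by (simp add: algebra_simps)
  qed
  define c' where "c' = sqrt (max 0 (c\<^sup>2 - \<delta>\<^sup>2 / c\<^sup>2))"
  have "norm (R x) \<le> c' * norm x" for x
  proof (rule power2_le_imp_le)
    have "(norm (R x))\<^sup>2 \<le> max 0 (c\<^sup>2 - \<delta>\<^sup>2 / c\<^sup>2) * (norm x)\<^sup>2"
      by (rule order_trans [OF est mult_right_mono]) auto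
    then show "(norm (R x))\<^sup>2 \<le> (c' * norm x)\<^sup>2" by (simp add: c'_def power_mult_distrib)
  qed (simp add: c'_def)
  then have "c \<le> c'" unfolding c_def by (intro onorm_bound) (simp add: c'_def)
  then have "c\<^sup>2 \<le> c'\<^sup>2" using c0 by (intro power_mono) auto
  also have "c'\<^sup>2 = max 0 (c\<^sup>2 - \<delta>\<^sup>2 / c\<^sup>2)" by (simp add: c'_def)
  also have "\<dots> < c\<^sup>2" using c0 \<open>\<delta> > 0\<close> by simp
  finally show False by simp
qed

text \<open>If the spectrum of \<open>S\<close> lies in \<open>[0,q]\<close> together with the point \<open>1\<close>, then \<open>S\<^sup>k x\<close> converges
  geometrically to the projection of \<open>x\<close> onto the fixed vectors of \<open>S\<close>. Where there are none, the
  differences of \<open>\<langle>x, S\<^sup>k x\<rangle>\<close> form a geometrically bounded series with sum \<open>\<parallel>x\<parallel>\<^sup>2\<close>, which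
  bounds \<open>1 - S\<close> from below.\<close>

lemma symmetric_gap_below_one:
  fixes S :: "'a::{real_inner,banach} \<Rightarrow> 'a"
  assumes lin: "bounded_linear S" and sym: "\<And>x y. inner (S x) y = inner x (S y)"
    and M: "closed M" "subspace M" "\<And>x. x \<in> M \<Longrightarrow> S x \<in> M"
    and nonneg: "\<And>x. x \<in> M \<Longrightarrow> 0 \<le> inner x (S x)"
    and le1: "\<And>x. x \<in> M \<Longrightarrow> inner x (S x) \<le> (norm x)\<^sup>2"
    and q: "0 \<le> q" "q < 1"
    and gap: "\<And>x. x \<in> M \<Longrightarrow> 0 \<le> inner (S x - x) (S x - q *\<^sub>R x)"
    and fix0: "\<And>x. x \<in> M \<Longrightarrow> S x = x \<Longrightarrow> x = 0"
    and x: "x \<in> M"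
  shows "(1 - q) / (1 + q) * (norm x)\<^sup>2 \<le> (norm x)\<^sup>2 - inner x (S x)"
proof -
  define a where "a k = inner x ((S ^^ k) x)" for k
  define d where "d k = a k - a (Suc k)" for k
  have inM: "(S ^^ k) x \<in> M" for k by (induction k) (auto simp: x M)
  have sym_k: "inner ((S ^^ j) u) v = inner u ((S ^^ j) v)" for j u v
    by (induction j arbitrary: u v) (auto simp: sym funpow_swap1)
  have a_add: "inner ((S ^^ j) x) ((S ^^ k) x) = a (j + k)" for j k
    by (simp add: sym_k a_def funpow_add)
  have a2: "a (k + k) = (norm ((S ^^ k) x))\<^sup>2" for k by (simp add: a_add [symmetric] power2_norm_eq_inner)
  have S_diff: "S (u - v) = S u - S v" for u v using lin by (simp add: bounded_linear.linear linear_diff)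
  have S_funpow: "S ((S ^^ k) x) = (S ^^ Suc k) x" for k by simp
  have d_even: "0 \<le> d (k + k)" for k
  proof -
    have "inner ((S ^^ k) x) ((S ^^ Suc k) x) \<le> inner ((S ^^ k) x) ((S ^^ k) x)"
      using le1 [OF inM [of k]] by (simp add: power2_norm_eq_inner)
    then show ?thesis unfolding a_add d_def by simp
  qed
  have d_odd: "d (Suc (k + k)) \<le> d (k + k)" for k
  proof -
    have "0 \<le> inner ((S ^^ k) x - (S ^^ Suc k) x) ((S ^^ k) x - (S ^^ Suc k) x)" by simp
    then show ?thesis unfolding inner_diff_left inner_diff_right a_add d_def by simp
  qed
  have d_mid: "d (Suc (Suc (k + k))) \<le> d (Suc (k + k))" for k
  proof -
    have "(S ^^ k) x - (S ^^ Suc k) x \<in> M" using inM M by (simp only: subspace_diff)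
    from nonneg [OF this] show ?thesis
      unfolding S_diff S_funpow inner_diff_left inner_diff_right a_add d_def by simp
  qed
  \<comment> \<open>The gap condition at \<open>S\<^sup>k x\<close> contracts only from even to odd indices; the step from odd to even
    indices is merely monotone. This accounts for the factor \<open>1 + q\<close> in the bound.\<close>
  have d_gap: "d (Suc (k + k)) \<le> q * d (k + k)" for k
  proof -
    have "0 \<le> inner ((S ^^ Suc k) x - (S ^^ k) x) ((S ^^ Suc k) x - q *\<^sub>R (S ^^ k) x)"
      using gap [OF inM [of k]] by simp
    then show ?thesis
      unfolding inner_diff_left inner_diff_right inner_scaleR_right a_add d_def
      by (simp add: algebra_simps)
  qed
  have d_le: "d (k + k) \<le> q ^ k * d 0" for k
  proof (induction k)
    case (Suc k)
    have "d (Suc k + Suc k) \<le> q * d (k + k)" using d_mid [of k] d_gap [of k] by simp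
    also have "\<dots> \<le> q * (q ^ k * d 0)" using Suc q by (intro mult_left_mono)
    finally show ?case by simp
  qed simp
  have step: "(norm ((S ^^ k) x - (S ^^ Suc k) x))\<^sup>2 = d (k + k) - d (Suc (k + k))" for k
    unfolding power2_norm_eq_inner inner_diff_left inner_diff_right a_add d_def by simp
  have d_odd0: "0 \<le> d (Suc (k + k))" for k
    using d_even [of "Suc k"] d_mid [of k] by simp
  have norm_step: "norm ((S ^^ k) x - (S ^^ Suc k) x) \<le> sqrt (d 0) * sqrt q ^ k" for k
  proof (rule power2_le_imp_le)
    have "(norm ((S ^^ k) x - (S ^^ Suc k) x))\<^sup>2 \<le> q ^ k * d 0"
      using step [of k] d_odd0 [of k] d_le [of k] by linarith
    also have "\<dots> = (sqrt (d 0) * sqrt q ^ k)\<^sup>2"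
      using d_even [of 0] q by (simp add: power_mult_distrib real_sqrt_power [symmetric])
    finally show "(norm ((S ^^ k) x - (S ^^ Suc k) x))\<^sup>2 \<le> (sqrt (d 0) * sqrt q ^ k)\<^sup>2" .
  qed (use d_even [of 0] q in auto)
  have "summable (\<lambda>k. (S ^^ k) x - (S ^^ Suc k) x)"
  proof (rule summable_comparison_test' [where N = 0])
    show "summable (\<lambda>k. sqrt (d 0) * sqrt q ^ k)"
      using q by (intro summable_mult summable_geometric) auto
  qed (use norm_step in blast)
  then have "summable (\<lambda>k. (S ^^ Suc k) x - (S ^^ k) x)"
    using summable_minus by fastforce
  then have "(\<lambda>n. \<Sum>k<n. (S ^^ Suc k) x - (S ^^ k) x) \<longlonglongrightarrow> (\<Sum>k. (S ^^ Suc k) x - (S ^^ k) x)"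
    by (rule summable_LIMSEQ)
  then obtain l where "(\<lambda>n. (S ^^ n) x - x) \<longlonglongrightarrow> l"
    by (simp only: sum_lessThan_telescope [of "\<lambda>k. (S ^^ k) x"]) simp
  from tendsto_add [OF this tendsto_const [of x]]
  have p: "(\<lambda>n. (S ^^ n) x) \<longlonglongrightarrow> l + x" by simp
  have "l + x \<in> M" using closed_sequentially [OF M(1) _ p] inM by blast
  moreover have "S (l + x) = l + x"
  proof (rule LIMSEQ_unique)
    show "(\<lambda>n. S ((S ^^ n) x)) \<longlonglongrightarrow> S (l + x)" by (rule bounded_linear.tendsto [OF lin p])
    show "(\<lambda>n. S ((S ^^ n) x)) \<longlonglongrightarrow> l + x" using LIMSEQ_Suc [OF p] by simp
  qed
  ultimately have "l + x = 0" by (rule fix0)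
  then have "(\<lambda>n. inner x ((S ^^ n) x)) \<longlonglongrightarrow> 0" using tendsto_inner [OF tendsto_const p, of x] by simp
  then have a_lim: "a \<longlonglongrightarrow> 0" by (simp add: a_def [abs_def])
  have partial: "a 0 - a (n + n) \<le> (1 + q) * d 0 / (1 - q)" for n
  proof -
    have "a 0 - a (n + n) \<le> (1 + q) * d 0 * (\<Sum>k<n. q ^ k)"
    proof (induction n)
      case (Suc n)
      have "a (n + n) - a (Suc n + Suc n) = d (n + n) + d (Suc (n + n))" by (simp add: d_def)
      also have "\<dots> \<le> (1 + q) * d (n + n)" using d_gap [of n] by (simp add: algebra_simps)
      also have "\<dots> \<le> (1 + q) * (q ^ n * d 0)" using q d_le by (intro mult_left_mono) auto
      finally show ?case using Suc by (simp add: algebra_simps)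
    qed simp
    also have "\<dots> \<le> (1 + q) * d 0 * (1 / (1 - q))"
    proof (rule mult_left_mono)
      have "(\<Sum>k<n. q ^ k) = (1 - q ^ n) / (1 - q)" using q by (simp add: sum_gp_strict)
      also have "\<dots> \<le> 1 / (1 - q)" using q by (intro divide_right_mono) auto
      finally show "(\<Sum>k<n. q ^ k) \<le> 1 / (1 - q)" .
    qed (use q d_even [of 0] in auto)
    finally show ?thesis by simp
  qed
  have "(\<lambda>n. a (n + n)) \<longlonglongrightarrow> 0"
    using LIMSEQ_subseq_LIMSEQ [OF a_lim, of "\<lambda>n. n + n"] by (simp add: strict_mono_def o_def)
  from tendsto_diff [OF tendsto_const [of "a 0"] this]
  have "(\<lambda>n. a 0 - a (n + n)) \<longlonglongrightarrow> a 0" by simp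
  then have "a 0 \<le> (1 + q) * d 0 / (1 - q)"
    by (rule LIMSEQ_le_const2) (use partial in blast)
  then have "(1 - q) * a 0 \<le> (1 + q) * d 0" using q by (simp add: field_simps)
  then have "(1 - q) / (1 + q) * a 0 \<le> d 0" using q by (simp add: field_simps)
  then show ?thesis by (simp add: a_def d_def power2_norm_eq_inner)
qed

text \<open>If a symmetric \<open>T\<close> has its numerical range in \<open>[0,a]\<close>, no spectrum in the gap \<open>(b,a)\<close> and no
  eigenvector for \<open>a\<close>, then \<open>T \<le> b\<close>: the supremum \<open>c\<close> of its numerical range is less than \<open>a\<close> by
  the previous lemma, and \<open>c\<close> lies in the spectrum, so it cannot lie in the gap.\<close>

lemma symmetric_numerical_range_gap:
  fixes T :: "'a::{real_inner,banach} \<Rightarrow> 'a"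
  assumes lin: "bounded_linear T" and sym: "\<And>x y. inner (T x) y = inner x (T y)"
    and M: "closed M" "subspace M" "\<And>x. x \<in> M \<Longrightarrow> T x \<in> M"
    and ab: "0 < b" "b < a"
    and nonneg: "\<And>x. x \<in> M \<Longrightarrow> 0 \<le> inner x (T x)"
    and le: "\<And>x. x \<in> M \<Longrightarrow> inner x (T x) \<le> a * (norm x)\<^sup>2"
    and gap: "\<And>x. x \<in> M \<Longrightarrow> 0 \<le> inner (T x - a *\<^sub>R x) (T x - b *\<^sub>R x)"
    and no_eig: "\<And>x. x \<in> M \<Longrightarrow> T x = a *\<^sub>R x \<Longrightarrow> x = 0"
    and x: "x \<in> M"
  shows "inner x (T x) \<le> b * (norm x)\<^sup>2"
proof (cases "x = 0")
  case False
  let ?N = "{x \<in> M. norm x = 1}"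
  define c where "c = (SUP x\<in>?N. inner x (T x))"
  interpret T: bounded_linear T by (rule lin)
  have unit: "(1 / norm y) *\<^sub>R y \<in> ?N" if "y \<in> M" "y \<noteq> 0" for y
    using that M by (auto intro: subspace_scale)
  have ne: "?N \<noteq> {}" using unit [OF x False] by blast
  have bdd: "bdd_above ((\<lambda>x. inner x (T x)) ` ?N)" using le by (intro bdd_aboveI [of _ a]) force
  have c_unit: "inner y (T y) \<le> c" if "y \<in> ?N" for y
    unfolding c_def by (rule cSUP_upper [OF that bdd])
  have c: "inner y (T y) \<le> c * (norm y)\<^sup>2" if "y \<in> M" for y
  proof (cases "y = 0")
    case False
    have "inner ((1 / norm y) *\<^sub>R y) (T ((1 / norm y) *\<^sub>R y)) \<le> c" by (rule c_unit [OF unit [OF that False]])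
    then show ?thesis using False by (simp add: T.scaleR power2_eq_square field_simps)
  qed (simp add: T.zero)
  have c0: "0 \<le> c" using c_unit [OF unit [OF x False]] nonneg [of "(1 / norm x) *\<^sub>R x"] unit [OF x False]
    by force
  have sq: "(norm (T y))\<^sup>2 \<le> c * inner y (T y)" if y: "y \<in> M" for y
  proof -
    \<comment> \<open>Cauchy-Schwarz for the nonnegative form \<open>\<langle>u, Tv\<rangle>\<close>, in the form of a discriminant.\<close>
    have quad: "0 \<le> inner y (T y) - 2 * s * (norm (T y))\<^sup>2 + s\<^sup>2 * c * (norm (T y))\<^sup>2" for s
    proof -
      have "y - s *\<^sub>R T y \<in> M" using y M by (intro subspace_diff subspace_scale)
      from nonneg [OF this] have "0 \<le> inner (y - s *\<^sub>R T y) (T y - s *\<^sub>R T (T y))"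
        by (simp add: T.diff T.scaleR)
      also have "\<dots> = inner y (T y) - 2 * s * (norm (T y))\<^sup>2 + s\<^sup>2 * inner (T y) (T (T y))"
        using sym [of y "T y"] unfolding power2_norm_eq_inner
        by (simp add: inner_diff_left inner_diff_right inner_commute algebra_simps power2_eq_square)
      also have "\<dots> \<le> inner y (T y) - 2 * s * (norm (T y))\<^sup>2 + s\<^sup>2 * (c * (norm (T y))\<^sup>2)"
        using c [OF M(3) [OF y]] by (intro add_left_mono mult_left_mono) auto
      finally show ?thesis by (simp add: mult.assoc)
    qed
    show ?thesis
    proof (cases "c = 0")
      case True
      then have y0: "inner y (T y) = 0" using c [OF y] nonneg [OF y] by simp
      show ?thesis using quad [of 1] True y0 by simp
    next
      case False
      then have "0 < c" using c0 by simp
      have "0 \<le> inner y (T y) - (norm (T y))\<^sup>2 / c"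
        using quad [of "1 / c"] \<open>0 < c\<close> by (simp add: power2_eq_square field_simps)
      then show ?thesis using \<open>0 < c\<close> by (simp add: field_simps)
    qed
  qed
  have "c < a"
  proof -
    define S where "S x = (1 / a) *\<^sub>R T x" for x
    define q where "q = b / a"
    have a: "a > 0" using ab by simp
    have q: "0 \<le> q" "q < 1" using ab by (auto simp: q_def)
    define \<delta> where "\<delta> = (1 - q) / (1 + q)"
    have \<delta>: "\<delta> > 0" using q by (simp add: \<delta>_def)
    have "\<delta> * (norm y)\<^sup>2 \<le> (norm y)\<^sup>2 - inner y (S y)" if "y \<in> M" for y
      unfolding \<delta>_def
    proof (rule symmetric_gap_below_one [where M = M, OF _ _ M(1,2) _ _ _ q _ _ that])
      show "bounded_linear S" unfolding S_def by (rule bounded_linear_const_scaleR [OF lin])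
      show "inner (S u) v = inner u (S v)" for u v by (simp add: S_def sym)
      show "S u \<in> M" if "u \<in> M" for u using that M by (auto simp: S_def intro: subspace_scale)
      show "0 \<le> inner u (S u)" if "u \<in> M" for u using nonneg [OF that] a by (simp add: S_def)
      show "inner u (S u) \<le> (norm u)\<^sup>2" if "u \<in> M" for u
        using le [OF that] a by (simp add: S_def field_simps)
      show "0 \<le> inner (S u - u) (S u - q *\<^sub>R u)" if "u \<in> M" for u
      proof -
        have "S u - u = (1 / a) *\<^sub>R (T u - a *\<^sub>R u)" "S u - q *\<^sub>R u = (1 / a) *\<^sub>R (T u - b *\<^sub>R u)"
          using a by (auto simp: S_def q_def algebra_simps)
        then show ?thesis using gap [OF that] a by simp
      qed
      show "u = 0" if "u \<in> M" "S u = u" for u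
      proof (rule no_eig [OF that(1)])
        have "T u = a *\<^sub>R S u" using a by (simp add: S_def)
        then show "T u = a *\<^sub>R u" using that by simp
      qed
    qed
    then have "inner y (T y) \<le> a * (1 - \<delta>)" if "y \<in> ?N" for y
      using that a by (force simp: S_def field_simps)
    then have "c \<le> a * (1 - \<delta>)" unfolding c_def using ne by (intro cSUP_least)
    also have "\<dots> < a" using a \<delta> by simp
    finally show ?thesis .
  qed
  have "c \<le> b"
  proof (rule ccontr)
    assume "\<not> c \<le> b"
    have den: "a + b - c > 0" using \<open>c < a\<close> ab by simp
    have "inner y (T y) \<le> a * b / (a + b - c)" if "y \<in> ?N" for y
    proof -
      have "inner y y = 1" using that by (simp add: power2_norm_eq_inner [symmetric])
      then have "0 \<le> (norm (T y))\<^sup>2 - (a + b) * inner y (T y) + a * b"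
        using gap [of y] that
        by (simp add: inner_diff_left inner_diff_right inner_commute power2_norm_eq_inner algebra_simps)
      then have "inner y (T y) * (a + b - c) \<le> a * b" using sq [of y] that by (simp add: algebra_simps)
      then show ?thesis using den by (simp add: field_simps)
    qed
    then have "c \<le> a * b / (a + b - c)" unfolding c_def [symmetric] using ne
      by (subst c_def) (intro cSUP_least)
    then have "c * (a + b - c) \<le> a * b" using den by (simp add: field_simps)
    then have "0 \<le> (c - a) * (c - b)" by (simp add: algebra_simps)
    moreover have "(c - a) * (c - b) < 0" using \<open>c < a\<close> \<open>\<not> c \<le> b\<close> by (intro mult_neg_pos) auto
    ultimately show False by simp
  qed
  then show ?thesis using c [OF x] by (meson mult_right_mono order_trans zero_le_power2)
qed (simp add: linear_0 [OF bounded_linear.linear [OF lin]])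

section \<open>Completeness of the eigenvectors\<close>

lemma eq_0_if_orthogonal_to_dense:
  fixes x :: "'a::real_inner"
  assumes "closure D = UNIV" "\<And>m. m \<in> D \<Longrightarrow> inner x m = 0" shows "x = 0"
proof -
  have "closed {m. inner x m = 0}" by (intro closed_Collect_eq continuous_intros)
  then have "closure D \<subseteq> {m. inner x m = 0}" using assms by (intro closure_minimal) auto
  then have "x \<in> {m. inner x m = 0}" using assms(1) by blast
  then show ?thesis by simp
qed

locale integer_spaced_spectrum =
  fixes K :: "'a::complex_hilbert \<rightharpoonup> 'a" and lam :: real
  assumes self_adjoint: "self_adjoint_op K"
    and spec_subset: "spec K \<subseteq> {complex_of_real (real n + lam) |n. True}"
begin

definition eigenval :: "nat \<Rightarrow> real" where "eigenval n = real n + lam"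

definition eigsp :: "nat \<Rightarrow> 'a set" where "eigsp n = eigenspace K (complex_of_real (eigenval n))"

lemma dom_csubspace: "csubspace (dom K)"
  and K_clinear: "clinear_on (dom K) (\<lambda>x. K \<cdot>\<^sub>o x)"
  and dom_dense: "closure (dom K) = UNIV"
  and K_adjoint: "op_adjoint K = K"
  using self_adjoint by (auto simp: self_adjoint_op_def linear_op_def)

lemma K_diff: "x \<in> dom K \<Longrightarrow> y \<in> dom K \<Longrightarrow> K \<cdot>\<^sub>o (x - y) = K \<cdot>\<^sub>o x - K \<cdot>\<^sub>o y"
  by (rule clinear_on_diff [OF dom_csubspace K_clinear])

lemma cinner_dom_ext:
  assumes "\<And>\<psi>. \<psi> \<in> dom K \<Longrightarrow> cinner \<eta> \<psi> = cinner \<eta>' \<psi>" shows "\<eta> = \<eta>'"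
proof -
  have "\<eta> - \<eta>' = 0"
    by (rule eq_0_if_orthogonal_to_dense [OF dom_dense])
       (simp add: inner_eq_Re_cinner cinner_diff_left assms)
  then show ?thesis by simp
qed

lemma in_dom_iff: "\<phi> \<in> dom K \<longleftrightarrow> (\<exists>\<eta>. \<forall>\<psi>\<in>dom K. cinner \<phi> (K \<cdot>\<^sub>o \<psi>) = cinner \<eta> \<psi>)"
  using fun_cong [OF K_adjoint, of \<phi>] unfolding op_adjoint_def
  by (metis (no_types, lifting) domIff option.distinct(1))

lemma K_eqI:
  assumes "\<And>\<psi>. \<psi> \<in> dom K \<Longrightarrow> cinner \<phi> (K \<cdot>\<^sub>o \<psi>) = cinner \<eta> \<psi>"
  shows "\<phi> \<in> dom K" "K \<cdot>\<^sub>o \<phi> = \<eta>"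
proof -
  have ex: "\<exists>\<eta>. \<forall>\<psi>\<in>dom K. cinner \<phi> (K \<cdot>\<^sub>o \<psi>) = cinner \<eta> \<psi>" using assms by blast
  then show "\<phi> \<in> dom K" by (simp only: in_dom_iff)
  have "K \<phi> = Some (THE \<eta>. \<forall>\<psi>\<in>dom K. cinner \<phi> (K \<cdot>\<^sub>o \<psi>) = cinner \<eta> \<psi>)"
    using fun_cong [OF K_adjoint, of \<phi>] ex unfolding op_adjoint_def by simp
  also have "(THE \<eta>. \<forall>\<psi>\<in>dom K. cinner \<phi> (K \<cdot>\<^sub>o \<psi>) = cinner \<eta> \<psi>) = \<eta>"
  proof (rule the_equality)
    show "\<forall>\<psi>\<in>dom K. cinner \<phi> (K \<cdot>\<^sub>o \<psi>) = cinner \<eta> \<psi>" using assms by blast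
    show "\<eta>' = \<eta>" if "\<forall>\<psi>\<in>dom K. cinner \<phi> (K \<cdot>\<^sub>o \<psi>) = cinner \<eta>' \<psi>" for \<eta>'
      by (rule cinner_dom_ext) (use that assms in metis)
  qed
  finally show "K \<cdot>\<^sub>o \<phi> = \<eta>" by simp
qed

lemma K_symmetric:
  assumes "\<phi> \<in> dom K" "\<psi> \<in> dom K" shows "cinner \<phi> (K \<cdot>\<^sub>o \<psi>) = cinner (K \<cdot>\<^sub>o \<phi>) \<psi>"
proof -
  obtain \<eta> where \<eta>: "\<forall>\<psi>\<in>dom K. cinner \<phi> (K \<cdot>\<^sub>o \<psi>) = cinner \<eta> \<psi>" using assms in_dom_iff by blast
  then have "K \<cdot>\<^sub>o \<phi> = \<eta>" using K_eqI(2) by blast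
  then show ?thesis using \<eta> assms by simp
qed

text \<open>The eigenspaces described by closed conditions, which shows that they are closed.\<close>

lemma eigsp_iff:
  "x \<in> eigsp n \<longleftrightarrow> (\<forall>\<psi>\<in>dom K. cinner (K \<cdot>\<^sub>o \<psi>) x = complex_of_real (eigenval n) * cinner \<psi> x)"
  (is "_ \<longleftrightarrow> ?R")
proof
  assume "x \<in> eigsp n"
  then show ?R
    by (auto simp: eigsp_def eigenspace_def K_symmetric [symmetric] cinner_cscale_right)
next
  assume R: ?R
  have *: "cinner x (K \<cdot>\<^sub>o \<psi>) = cinner (complex_of_real (eigenval n) *\<^sub>C x) \<psi>" if "\<psi> \<in> dom K" for \<psi>
  proof -
    have "cinner x (K \<cdot>\<^sub>o \<psi>) = cnj (complex_of_real (eigenval n) * cinner \<psi> x)"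
      using R that cinner_commute [of x "K \<cdot>\<^sub>o \<psi>"] by simp
    then show ?thesis using cinner_commute [of x \<psi>] by (simp add: cinner_cscale_left)
  qed
  show "x \<in> eigsp n" using K_eqI [OF *] by (simp add: eigsp_def eigenspace_def)
qed

lemma eigspD: "x \<in> eigsp n \<Longrightarrow> x \<in> dom K" "x \<in> eigsp n \<Longrightarrow> K \<cdot>\<^sub>o x = complex_of_real (eigenval n) *\<^sub>C x"
  by (auto simp: eigsp_def eigenspace_def)

lemma eigsp_closed: "closed (eigsp n)"
proof -
  have "eigsp n = (\<Inter>\<psi>\<in>dom K. {x. cinner (K \<cdot>\<^sub>o \<psi>) x = complex_of_real (eigenval n) * cinner \<psi> x})"
    by (rule set_eqI) (simp add: eigsp_iff)
  also have "closed \<dots>"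
    by (intro closed_INT ballI closed_Collect_eq continuous_on_mult_left
        linear_continuous_on bounded_linear_cinner_right)
  finally show ?thesis .
qed

lemma eigsp_csubspace: "csubspace (eigsp n)"
  unfolding csubspace_def eigsp_iff
  by (intro conjI ballI allI) (simp_all add: eigsp_iff cinner_add_right cinner_cscale_right distrib_left mult.left_commute)

lemma real_resolvent:
  assumes "complex_of_real w \<notin> spec K"
  obtains R where "bounded_linear R" "\<And>x. R x \<in> dom K" "\<And>x. K \<cdot>\<^sub>o R x - w *\<^sub>R R x = x"
    "\<And>y. y \<in> dom K \<Longrightarrow> R (K \<cdot>\<^sub>o y - w *\<^sub>R y) = y" "\<And>x y. inner (R x) y = inner x (R y)"
proof -
  define L where "L y = K \<cdot>\<^sub>o y - w *\<^sub>R y" for y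
  have "complex_of_real w \<in> resolvent_set K" using assms by (simp add: spec_def)
  then obtain C where bij: "bij_betw L (dom K) UNIV" and C: "\<And>y. y \<in> dom K \<Longrightarrow> norm y \<le> C * norm (L y)"
    unfolding resolvent_set_def L_def scaleR_eq_cscale by blast
  define R where "R = inv_into (dom K) L"
  have Rdom: "R x \<in> dom K" for x unfolding R_def using bij by (metis UNIV_I bij_betw_def inv_into_into)
  have LR: "L (R x) = x" for x unfolding R_def using bij by (metis UNIV_I bij_betw_inv_into_right)
  have RL: "R (L y) = y" if "y \<in> dom K" for y
    unfolding R_def using bij that by (metis bij_betw_inv_into_left)
  have sub: "x + y \<in> dom K" "c *\<^sub>R x \<in> dom K" if "x \<in> dom K" "y \<in> dom K" for x y c
    using that subspace_add [OF csubspace_imp_subspace [OF dom_csubspace]]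
      subspace_scale [OF csubspace_imp_subspace [OF dom_csubspace]] by blast+
  have L_lin: "L (x + y) = L x + L y" "L (c *\<^sub>R x) = c *\<^sub>R L x" if "x \<in> dom K" "y \<in> dom K" for x y c
    using that K_clinear
    by (auto simp: L_def clinear_on_def scaleR_eq_cscale cscale_diff_right cscale_cscale
        mult.commute cscale_add_right)
  show ?thesis
  proof
    show "bounded_linear R"
    proof (rule bounded_linear_intro [where K = C])
      show "R (x + y) = R x + R y" for x y by (metis L_lin(1) LR RL Rdom sub(1))
      show "R (c *\<^sub>R x) = c *\<^sub>R R x" for x c by (metis L_lin(2) LR RL Rdom sub(2))
      show "norm (R x) \<le> norm x * C" for x using C [OF Rdom [of x]] by (simp add: LR mult.commute)
    qed
    show "inner (R x) y = inner x (R y)" for x y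
    proof -
      have "inner (K \<cdot>\<^sub>o R x) (R y) = inner (R x) (K \<cdot>\<^sub>o R y)"
        using K_symmetric [OF Rdom Rdom, of x y] by (simp add: inner_eq_Re_cinner)
      then have "inner (L (R x)) (R y) = inner (R x) (L (R y))"
        by (simp add: L_def inner_diff_left inner_diff_right)
      then show ?thesis by (simp add: LR)
    qed
  qed (use Rdom LR RL in \<open>auto simp: L_def\<close>)
qed

lemma not_in_spec: "(\<And>n. z \<noteq> eigenval n) \<Longrightarrow> complex_of_real z \<notin> spec K"
  using spec_subset unfolding eigenval_def by (fastforce simp del: of_real_add)

text \<open>The norm \<open>c\<close> of the resolvent at \<open>w\<close> or its negative is an approximate eigenvalue of the resolvent,
  which puts \<open>w + 1/c\<close> or \<open>w - 1/c\<close> into the spectrum. Hence \<open>1/c\<close> is at least the distance of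
  \<open>w\<close> to the points that may carry spectrum.\<close>

lemma norm_ge_distance_to_spectrum:
  assumes d: "d > 0" "\<And>n. d \<le> \<bar>w - eigenval n\<bar>" and \<psi>: "\<psi> \<in> dom K"
  shows "d * norm \<psi> \<le> norm (K \<cdot>\<^sub>o \<psi> - w *\<^sub>R \<psi>)"
proof -
  have "complex_of_real w \<notin> spec K" 
  proof (rule not_in_spec)
    show "w \<noteq> eigenval n" for n using d(1) d(2) [of n] by auto
  qed
  then obtain R where R: "bounded_linear R" "\<And>x. R x \<in> dom K" "\<And>x. K \<cdot>\<^sub>o R x - w *\<^sub>R R x = x"
    "\<And>y. y \<in> dom K \<Longrightarrow> R (K \<cdot>\<^sub>o y - w *\<^sub>R y) = y" "\<And>x y. inner (R x) y = inner x (R y)"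
    by (rule real_resolvent) blast
  define c where "c = onorm R"
  have c0: "0 \<le> c" unfolding c_def using R(1) by (rule onorm_pos_le)
  have bound: "\<exists>\<epsilon>>0. \<forall>x. \<epsilon> * norm x \<le> norm (R x - s *\<^sub>R x)" if s: "\<bar>s\<bar> = c" "c > 0" "1 / c < d" for s
  proof -
    have s0: "s \<noteq> 0" using s by auto
    have "complex_of_real (w + 1 / s) \<notin> spec K"
    proof (rule not_in_spec)
      fix n
      have "\<bar>1 / s\<bar> < d" using s by simp
      then show "w + 1 / s \<noteq> eigenval n" using d(2) [of n] by (auto simp del: abs_divide)
    qed
    then obtain R' where R': "bounded_linear R'" "\<And>y. y \<in> dom K \<Longrightarrow> R' (K \<cdot>\<^sub>o y - (w + 1 / s) *\<^sub>R y) = y"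
      by (rule real_resolvent) blast
    obtain C where C: "C > 0" "\<And>x. norm (R' x) \<le> norm x * C"
      using bounded_linear.pos_bounded [OF R'(1)] by blast
    have "norm x \<le> (C / c + 1) / c * norm (R x - s *\<^sub>R x)" for x
    proof -
      have "R x - s *\<^sub>R x = - (s *\<^sub>R (K \<cdot>\<^sub>o R x - (w + 1 / s) *\<^sub>R R x))"
      proof -
        have "s *\<^sub>R (K \<cdot>\<^sub>o R x - (w + 1 / s) *\<^sub>R R x) = s *\<^sub>R (K \<cdot>\<^sub>o R x - w *\<^sub>R R x) - R x"
          using s0 by (simp add: algebra_simps)
        then show ?thesis by (simp add: R(3))
      qed
      then have 1: "norm (R x - s *\<^sub>R x) = c * norm (K \<cdot>\<^sub>o R x - (w + 1 / s) *\<^sub>R R x)" using s by simp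
      have 2: "norm (R x) \<le> C / c * norm (R x - s *\<^sub>R x)"
        using C(2) [of "K \<cdot>\<^sub>o R x - (w + 1 / s) *\<^sub>R R x"] s unfolding 1 R'(2) [OF R(2)]
        by (simp add: mult.commute)
      have "c * norm x = norm (R x - (R x - s *\<^sub>R x))" using s by simp
      also have "\<dots> \<le> norm (R x) + norm (R x - s *\<^sub>R x)" by (rule norm_triangle_ineq4)
      also have "\<dots> \<le> (C / c + 1) * norm (R x - s *\<^sub>R x)" using 2 by (simp add: algebra_simps)
      finally show ?thesis using s by (simp add: field_simps)
    qed
    moreover have pos: "(C / c + 1) / c > 0" using C s by (simp add: add_pos_pos)
    ultimately have "1 / ((C / c + 1) / c) * norm x \<le> norm (R x - s *\<^sub>R x)" for x
      by (metis mult_1 pos_divide_le_eq times_divide_eq_left mult.commute)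
    then show ?thesis using pos by (meson zero_less_divide_1_iff)
  qed
  have "c * d \<le> 1"
  proof (rule ccontr)
    assume "\<not> c * d \<le> 1"
    then have "c \<noteq> 0" by auto
    then have c: "c > 0" "1 / c < d" using c0 \<open>\<not> c * d \<le> 1\<close> by (auto simp: field_simps)
    obtain \<epsilon>1 where e1: "\<epsilon>1 > 0" "\<And>x. \<epsilon>1 * norm x \<le> norm (R x - c *\<^sub>R x)" using bound [of c] c by auto
    obtain \<epsilon>2 where e2: "\<epsilon>2 > 0" "\<And>x. \<epsilon>2 * norm x \<le> norm (R x - (- c) *\<^sub>R x)" using bound [of "- c"] c by auto
    obtain x where x: "norm (R (R x) - c\<^sup>2 *\<^sub>R x) < \<epsilon>1 * \<epsilon>2 * norm x"
      using onorm_approximate_eigenvalue [OF R(1,5), of "\<epsilon>1 * \<epsilon>2"] c e1 e2 by (auto simp: c_def)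
    define y where "y = R x + c *\<^sub>R x"
    have "R (R x) - c\<^sup>2 *\<^sub>R x = R y - c *\<^sub>R y"
      using R(1) by (simp add: y_def bounded_linear.linear linear_add linear_scale algebra_simps power2_eq_square)
    then have "\<epsilon>1 * norm y < \<epsilon>1 * \<epsilon>2 * norm x" using x e1(2) [of y] by simp
    moreover have "\<epsilon>1 * (\<epsilon>2 * norm x) \<le> \<epsilon>1 * norm y" using e1 e2(2) [of x] by (intro mult_left_mono) (auto simp: y_def)
    ultimately show False by (simp add: mult.assoc)
  qed
  have "norm \<psi> \<le> c * norm (K \<cdot>\<^sub>o \<psi> - w *\<^sub>R \<psi>)"
    using onorm [OF R(1), of "K \<cdot>\<^sub>o \<psi> - w *\<^sub>R \<psi>"] by (simp add: R(4) [OF \<psi>] c_def)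
  then have "d * norm \<psi> \<le> (c * d) * norm (K \<cdot>\<^sub>o \<psi> - w *\<^sub>R \<psi>)"
    using mult_left_mono [of _ _ d] d by (simp add: mult_ac)
  also have "\<dots> \<le> 1 * norm (K \<cdot>\<^sub>o \<psi> - w *\<^sub>R \<psi>)" using \<open>c * d \<le> 1\<close> by (intro mult_right_mono) auto
  finally show ?thesis by simp
qed

text \<open>The bottom of the spectrum bounds the quadratic form: let \<open>s\<close> tend to infinity in
  \<open>\<parallel>(K - lam)\<psi> + s\<psi>\<parallel> \<ge> s\<parallel>\<psi>\<parallel>\<close>.\<close>

lemma quadratic_form_ge:
  assumes \<psi>: "\<psi> \<in> dom K" shows "0 \<le> inner (K \<cdot>\<^sub>o \<psi> - lam *\<^sub>R \<psi>) \<psi>"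
proof -
  define u where "u = K \<cdot>\<^sub>o \<psi> - lam *\<^sub>R \<psi>"
  have "0 \<le> (norm u)\<^sup>2 + 2 * s * inner u \<psi>" if s: "s > 0" for s
  proof -
    have "s * norm \<psi> \<le> norm (K \<cdot>\<^sub>o \<psi> - (lam - s) *\<^sub>R \<psi>)"
      by (rule norm_ge_distance_to_spectrum [OF s _ \<psi>]) (use s in \<open>simp add: eigenval_def\<close>)
    also have "K \<cdot>\<^sub>o \<psi> - (lam - s) *\<^sub>R \<psi> = u + s *\<^sub>R \<psi>" by (simp add: u_def algebra_simps)
    finally have "(s * norm \<psi>)\<^sup>2 \<le> (norm (u + s *\<^sub>R \<psi>))\<^sup>2" using s by (intro power_mono) auto
    also have "\<dots> = (norm u)\<^sup>2 + 2 * s * inner u \<psi> + (s * norm \<psi>)\<^sup>2"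
      unfolding power_mult_distrib power2_norm_eq_inner
      by (simp add: inner_add_left inner_add_right inner_commute algebra_simps power2_eq_square)
    finally show ?thesis by simp
  qed
  note key = this
  show ?thesis
  proof (rule ccontr)
    assume "\<not> ?thesis"
    then have neg: "inner u \<psi> < 0" by (simp add: u_def)
    define s where "s = ((norm u)\<^sup>2 + 1) / (- (2 * inner u \<psi>))"
    have "s > 0" unfolding s_def using neg by (intro divide_pos_pos) (auto intro: add_nonneg_pos)
    have "2 * s * inner u \<psi> = - ((norm u)\<^sup>2 + 1)" using neg by (simp add: s_def field_simps)
    then show False using key [OF \<open>s > 0\<close>] by simp
  qed
qed

text \<open>There is no spectrum between two consecutive points: the distance bound at the midpoint.\<close>

lemma quadratic_form_gap:
  assumes \<psi>: "\<psi> \<in> dom K"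
  shows "0 \<le> inner (K \<cdot>\<^sub>o \<psi> - eigenval n *\<^sub>R \<psi>) (K \<cdot>\<^sub>o \<psi> - eigenval (Suc n) *\<^sub>R \<psi>)"
proof -
  define u where "u = K \<cdot>\<^sub>o \<psi> - eigenval n *\<^sub>R \<psi>"
  have "1 / 2 \<le> \<bar>eigenval n + 1 / 2 - eigenval k\<bar>" for k
    by (cases "k \<le> n") (auto simp: eigenval_def)
  from norm_ge_distance_to_spectrum [OF _ this \<psi>]
  have "1 / 2 * norm \<psi> \<le> norm (K \<cdot>\<^sub>o \<psi> - (eigenval n + 1 / 2) *\<^sub>R \<psi>)" by simp
  also have "K \<cdot>\<^sub>o \<psi> - (eigenval n + 1 / 2) *\<^sub>R \<psi> = u - (1 / 2) *\<^sub>R \<psi>" by (simp add: u_def algebra_simps)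
  finally have "(1 / 2 * norm \<psi>)\<^sup>2 \<le> (norm (u - (1 / 2) *\<^sub>R \<psi>))\<^sup>2" by (intro power_mono) auto
  also have "\<dots> = inner u (u - \<psi>) + (1 / 2 * norm \<psi>)\<^sup>2"
    unfolding power_mult_distrib power2_norm_eq_inner
    by (simp add: inner_diff_left inner_diff_right inner_commute algebra_simps power2_eq_square)
  finally have "0 \<le> inner u (u - \<psi>)" by simp
  also have "u - \<psi> = K \<cdot>\<^sub>o \<psi> - eigenval (Suc n) *\<^sub>R \<psi>" by (simp add: u_def eigenval_def algebra_simps)
  finally show ?thesis by (simp add: u_def)
qed

text \<open>The operator \<open>T = (K - lam + 1)\<^sup>-\<^sup>1\<close> has its spectrum in \<open>{0, 1, 1/2, 1/3, \<dots>}\<close>. On the orthogonal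
  complement of all eigenvectors, its numerical range can be pushed down across one gap after
  the other, so that \<open>T\<close> vanishes there; but \<open>T\<close> is injective.\<close>

theorem eigenvectors_total:
  assumes x: "\<And>n e. e \<in> eigsp n \<Longrightarrow> inner x e = 0" shows "x = 0"
proof -
  define M where "M = {x. \<forall>n. \<forall>e\<in>eigsp n. inner x e = 0}"
  have "complex_of_real (lam - 1) \<notin> spec K"
  proof (rule not_in_spec)
    show "lam - 1 \<noteq> eigenval n" for n by (simp add: eigenval_def)
  qed
  then obtain T where T: "bounded_linear T" "\<And>x. T x \<in> dom K" "\<And>x. K \<cdot>\<^sub>o T x - (lam - 1) *\<^sub>R T x = x"
    "\<And>y. y \<in> dom K \<Longrightarrow> T (K \<cdot>\<^sub>o y - (lam - 1) *\<^sub>R y) = y" "\<And>x y. inner (T x) y = inner x (T y)"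
    by (rule real_resolvent) blast
  interpret T: bounded_linear T by (rule T(1))
  define L where "L y = K \<cdot>\<^sub>o y - (lam - 1) *\<^sub>R y" for y
  have LT: "L (T u) = u" for u by (simp add: L_def T(3))
  have L_eig: "L y - real (Suc n) *\<^sub>R y = K \<cdot>\<^sub>o y - eigenval n *\<^sub>R y" for y n
    by (simp add: L_def eigenval_def algebra_simps)
  have T_eig: "T e = (1 / real (Suc n)) *\<^sub>R e" if "e \<in> eigsp n" for n e
  proof -
    have "L e = real (Suc n) *\<^sub>R e"
      using L_eig [of e n] eigspD(2) [OF that] by (simp add: scaleR_eq_cscale [symmetric])
    then have "T (real (Suc n) *\<^sub>R e) = e" using T(4) [OF eigspD(1) [OF that]] by (simp add: L_def)
    then have "real (Suc n) *\<^sub>R T e = e" by (simp add: T.scaleR)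
    then have "(1 / real (Suc n)) *\<^sub>R (real (Suc n) *\<^sub>R T e) = (1 / real (Suc n)) *\<^sub>R e" by (rule arg_cong)
    then show ?thesis by simp
  qed
  have closedM: "closed M"
  proof -
    have "M = (\<Inter>n. \<Inter>e\<in>eigsp n. {x. inner x e = 0})" by (auto simp: M_def)
    also have "closed \<dots>" by (intro closed_INT ballI closed_Collect_eq continuous_intros)
    finally show ?thesis .
  qed
  have subM: "subspace M" by (auto simp: M_def subspace_def inner_add_left)
  have TM: "T u \<in> M" if "u \<in> M" for u using that by (auto simp: M_def T(5) T_eig)
  have lower: "(norm (T u))\<^sup>2 \<le> inner u (T u)" for u
  proof -
    have "inner u (T u) = inner (L (T u)) (T u)" by (simp add: LT)
    also have "\<dots> = inner (K \<cdot>\<^sub>o T u - lam *\<^sub>R T u) (T u) + (norm (T u))\<^sup>2"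
      by (simp add: L_def power2_norm_eq_inner inner_diff_left algebra_simps)
    finally show ?thesis using quadratic_form_ge [OF T(2), of u] by simp
  qed
  have nonneg: "0 \<le> inner u (T u)" for u using lower [of u] by (meson order_trans zero_le_power2)
  have le1: "inner u (T u) \<le> (norm u)\<^sup>2" for u
  proof -
    have "(norm (T u))\<^sup>2 \<le> norm u * norm (T u)"
      using lower [of u] norm_cauchy_schwarz [of u "T u"] by linarith
    then have "norm (T u) \<le> norm u" by (cases "T u = 0") (auto simp: power2_eq_square)
    then have "norm u * norm (T u) \<le> norm u * norm u" by (intro mult_left_mono) auto
    then show ?thesis using norm_cauchy_schwarz [of u "T u"] by (simp add: power2_eq_square)
  qed
  have push: "inner u (T u) \<le> 1 / real (Suc n) * (norm u)\<^sup>2" if "u \<in> M" for n u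
    using that
  proof (induction n arbitrary: u)
    case (Suc n)
    show ?case
    proof (rule symmetric_numerical_range_gap
        [where a = "1 / real (Suc n)" and M = M, OF T(1,5) closedM subM TM _ _ nonneg Suc.IH _ _ Suc.prems])
      show "1 / real (Suc (Suc n)) < 1 / real (Suc n)" by (intro divide_strict_left_mono) auto
      show "0 \<le> inner (T v - (1 / real (Suc n)) *\<^sub>R v) (T v - (1 / real (Suc (Suc n))) *\<^sub>R v)"
        if "v \<in> M" for v
      proof -
        have *: "T v - (1 / real (Suc k)) *\<^sub>R v
            = - ((1 / real (Suc k)) *\<^sub>R (K \<cdot>\<^sub>o T v - eigenval k *\<^sub>R T v))" for k
        proof -
          have "(1 / real (Suc k)) *\<^sub>R (K \<cdot>\<^sub>o T v - eigenval k *\<^sub>R T v)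
              = (1 / real (Suc k)) *\<^sub>R (v - real (Suc k) *\<^sub>R T v)"
            by (simp only: L_eig [symmetric] LT)
          then show ?thesis by (simp add: scaleR_diff_right del: of_nat_Suc)
        qed
        have "0 \<le> (1 / real (Suc n)) * ((1 / real (Suc (Suc n))) *
            inner (K \<cdot>\<^sub>o T v - eigenval n *\<^sub>R T v) (K \<cdot>\<^sub>o T v - eigenval (Suc n) *\<^sub>R T v))"
          using quadratic_form_gap [OF T(2), of v n] by (intro mult_nonneg_nonneg) auto
        then show ?thesis unfolding * inner_minus_left inner_minus_right inner_scaleR_left inner_scaleR_right
          by (simp add: mult.commute)
      qed
      show "v = 0" if v: "v \<in> M" "T v = (1 / real (Suc n)) *\<^sub>R v" for v
      proof -
        have v': "v = real (Suc n) *\<^sub>R T v" using v(2) by (simp del: of_nat_Suc)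
        have "T v \<in> eigsp n"
        proof -
          have "K \<cdot>\<^sub>o T v - eigenval n *\<^sub>R T v = 0" using L_eig [of "T v" n] LT [of v] v' by simp
          then show ?thesis using T(2) by (simp add: eigsp_def eigenspace_def scaleR_eq_cscale)
        qed
        then have "inner v (T v) = 0" using v(1) by (auto simp: M_def)
        then have "T v = 0" using lower [of v] by simp
        then show "v = 0" using v' by simp
      qed
    qed auto
  qed (use le1 in simp)
  have xM: "x \<in> M" using x by (auto simp: M_def)
  have "(\<lambda>n. 1 / real (Suc n) * (norm x)\<^sup>2) \<longlonglongrightarrow> 0 * (norm x)\<^sup>2"
    using LIMSEQ_inverse_real_of_nat by (intro tendsto_mult tendsto_const) (simp add: inverse_eq_divide)
  then have "inner x (T x) \<le> 0 * (norm x)\<^sup>2"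
    by (rule LIMSEQ_le_const) (use push [OF xM] in blast)
  from order_trans [OF lower [of x] this] have "(norm (T x))\<^sup>2 \<le> 0 * (norm x)\<^sup>2" .
  then have "T x = 0" by simp
  then show "x = 0" using LT [of x] K_diff [of 0 0] dom_csubspace by (simp add: L_def csubspace_def)
qed

end

section \<open>Orthogonal decompositions and multipliers\<close>

locale orthogonal_decomposition =
  fixes P :: "nat \<Rightarrow> 'a::complex_hilbert \<Rightarrow> 'a"
  assumes proj: "orthogonal_projection (P n)"
    and ortho: "n \<noteq> m \<Longrightarrow> P n (P m x) = 0"
    and total: "(\<And>n. P n x = 0) \<Longrightarrow> x = 0"
begin

lemmas P_bounded_linear = orthogonal_projectionD(7) [OF proj]

lemma P_lin [simp]:
  "P n (x + y) = P n x + P n y" "P n (a *\<^sub>C x) = a *\<^sub>C P n x" "P n 0 = 0"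
  "P n (x - y) = P n x - P n y" "P n (c *\<^sub>R x) = c *\<^sub>R P n x"
  by (rule clinear_on_UNIV_D [OF orthogonal_projectionD(1) [OF proj]])+

lemma P_P: "P n (P m x) = (if n = m then P m x else 0)"
  using ortho orthogonal_projectionD(2) [OF proj] by simp

lemma decomposition_ext: "(\<And>n. P n x = P n y) \<Longrightarrow> x = y"
  using total [of "x - y"] by simp

lemma inner_components:
  assumes "P n u = u" "P m v = v" "n \<noteq> m" shows "inner u v = 0"
proof -
  have "cinner u v = cinner (P n u) v" by (simp only: assms(1))
  also have "\<dots> = cinner u (P n (P m v))" by (simp only: orthogonal_projectionD(3) [OF proj] assms(2))
  also have "\<dots> = 0" using assms(3) by (simp add: ortho)
  finally show ?thesis by (simp add: inner_eq_Re_cinner)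
qed

lemma norm_sum_components:
  assumes "\<And>n. P n (b n) = b n" "finite F"
  shows "(norm (sum b F))\<^sup>2 = (\<Sum>n\<in>F. (norm (b n))\<^sup>2)"
  using assms by (intro norm_sum_Pythagorean) (auto simp: pairwise_def orthogonal_def intro: inner_components)

text \<open>Riesz-Fischer: square-summable components assemble to a vector.\<close>

lemma components_summable:
  assumes b: "\<And>n. P n (b n) = b n" and s: "summable (\<lambda>n. (norm (b n))\<^sup>2)"
  shows "summable b"
  unfolding summable_Cauchy
proof (intro allI impI)
  fix e :: real assume e: "e > 0"
  then have "e\<^sup>2 > 0" by simp
  then obtain N where N: "\<And>m n. m \<ge> N \<Longrightarrow> norm (\<Sum>k=m..<n. (norm (b k))\<^sup>2) < e\<^sup>2"
    using s unfolding summable_Cauchy by blast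
  have "norm (sum b {m..<n}) < e" if "m \<ge> N" for m n
  proof -
    have "(norm (sum b {m..<n}))\<^sup>2 < e\<^sup>2"
      using N [OF that, of n] norm_sum_components [OF b, of "{m..<n}"] by (simp add: sum_nonneg)
    then show ?thesis using e by (simp add: power2_less_imp_less)
  qed
  then show "\<exists>N. \<forall>m\<ge>N. \<forall>n. norm (sum b {m..<n}) < e" by blast
qed

lemma norm_suminf_components:
  assumes b: "\<And>n. P n (b n) = b n" and s: "summable b"
  shows "(\<lambda>n. (norm (b n))\<^sup>2) sums (norm (suminf b))\<^sup>2"
proof -
  have "(\<lambda>N. (norm (sum b {..<N}))\<^sup>2) \<longlonglongrightarrow> (norm (suminf b))\<^sup>2"
    by (intro tendsto_intros summable_LIMSEQ s)
  then show ?thesis by (simp add: sums_def norm_sum_components [OF b])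
qed

lemma P_suminf_components:
  assumes b: "\<And>n. P n (b n) = b n" and s: "summable b"
  shows "P m (suminf b) = b m"
proof -
  have 1: "P m (b n) = (if n = m then b m else 0)" for n
    using P_P [of m n "b n"] b [of n] b [of m] by (cases "n = m") auto
  have "P m (suminf b) = (\<Sum>n. P m (b n))"
    by (rule bounded_linear.suminf [OF P_bounded_linear s])
  also have "\<dots> = (\<Sum>n. if n = m then b n else 0)" by (intro suminf_cong) (simp add: 1)
  also have "\<dots> = b m" using sums_single [of m b] by (simp add: sums_iff)
  finally show ?thesis .
qed

lemma bessel: "summable (\<lambda>n. (norm (P n x))\<^sup>2)"
proof (rule bounded_imp_summable)
  fix N
  let ?s = "\<Sum>n\<le>N. P n x"
  have "inner ?s x = (\<Sum>n\<le>N. (norm (P n x))\<^sup>2)"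
    by (simp add: inner_sum_left orthogonal_projectionD(5) [OF proj] inner_commute [of "P _ x" x])
  moreover have "(norm ?s)\<^sup>2 = (\<Sum>n\<le>N. (norm (P n x))\<^sup>2)"
    by (rule norm_sum_components) (auto simp: P_P)
  moreover have "0 \<le> (norm (x - ?s))\<^sup>2" by simp
  moreover have "(norm (x - ?s))\<^sup>2 = (norm x)\<^sup>2 - 2 * inner ?s x + (norm ?s)\<^sup>2"
    unfolding power2_norm_eq_inner by (simp add: inner_diff_left inner_diff_right inner_commute)
  ultimately show "(\<Sum>n\<le>N. (norm (P n x))\<^sup>2) \<le> (norm x)\<^sup>2" by simp
qed simp

lemma P_summable: "summable (\<lambda>n. P n x)"
  by (rule components_summable [OF _ bessel]) (simp add: P_P)

lemma P_suminf: "(\<Sum>n. P n x) = x"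
  by (rule decomposition_ext) (subst P_suminf_components; simp add: P_P P_summable)

lemma P_sums: "(\<lambda>n. P n x) sums x"
  using P_summable [of x] P_suminf [of x] by (simp add: sums_iff)

lemma parseval: "(\<lambda>n. (norm (P n x))\<^sup>2) sums (norm x)\<^sup>2"
  using norm_suminf_components [OF _ P_summable, of x] by (simp add: P_P P_suminf)

text \<open>The series converges exactly on \<open>mult_dom m\<close> below; elsewhere the value is arbitrary.\<close>

definition mult :: "(nat \<Rightarrow> complex) \<Rightarrow> 'a \<Rightarrow> 'a" where
  "mult m x = (\<Sum>n. m n *\<^sub>C P n x)"

definition mult_dom :: "(nat \<Rightarrow> complex) \<Rightarrow> 'a set" where
  "mult_dom m = {x. summable (\<lambda>n. (norm (m n *\<^sub>C P n x))\<^sup>2)}"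

lemma P_mult: "x \<in> mult_dom m \<Longrightarrow> P n (mult m x) = m n *\<^sub>C P n x"
  unfolding mult_def mult_dom_def
  by (subst P_suminf_components) (auto simp: P_P intro: components_summable)

text \<open>Knowing the components of the image suffices, both for the domain and for the value. Most
  identities between functions of \<open>K\<close> are read off from components in this way.\<close>

lemma mult_eqI:
  assumes "\<And>n. P n y = m n *\<^sub>C P n x"
  shows "x \<in> mult_dom m" "mult m x = y"
proof -
  show x: "x \<in> mult_dom m"
    using bessel [of y] by (simp add: mult_dom_def assms [symmetric] del: norm_cscale)
  show "mult m x = y" by (rule decomposition_ext) (simp add: P_mult [OF x] assms)
qed

lemma mult_norm_sums: "x \<in> mult_dom m \<Longrightarrow> (\<lambda>n. (norm (m n *\<^sub>C P n x))\<^sup>2) sums (norm (mult m x))\<^sup>2"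
  using parseval [of "mult m x"] by (simp add: P_mult)

lemma mult_cscale: "x \<in> mult_dom m \<Longrightarrow> a *\<^sub>C x \<in> mult_dom m \<and> mult m (a *\<^sub>C x) = a *\<^sub>C mult m x"
  using mult_eqI [of "a *\<^sub>C mult m x" m "a *\<^sub>C x"] by (simp add: P_mult cscale_cscale mult.commute)

lemma mult_add:
  "x \<in> mult_dom m \<Longrightarrow> y \<in> mult_dom m \<Longrightarrow> x + y \<in> mult_dom m \<and> mult m (x + y) = mult m x + mult m y"
  using mult_eqI [of "mult m x + mult m y" m "x + y"] by (simp add: P_mult cscale_add_right)

lemma mult_dom_csubspace: "csubspace (mult_dom m)"
  unfolding csubspace_def using mult_add mult_cscale by (auto intro: mult_eqI(1) [of 0])

lemma mult_clinear: "clinear_on (mult_dom m) (mult m)"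
  unfolding clinear_on_def using mult_add mult_cscale by blast

lemma mult_diff:
  "x \<in> mult_dom m \<Longrightarrow> y \<in> mult_dom m \<Longrightarrow> mult m (x - y) = mult m x - mult m y"
  by (rule clinear_on_diff [OF mult_dom_csubspace mult_clinear])

lemma P_in_mult_dom: "P n x \<in> mult_dom m" and mult_P: "mult m (P n x) = m n *\<^sub>C P n x"
proof -
  have *: "P k (m n *\<^sub>C P n x) = m k *\<^sub>C P k (P n x)" for k by (simp add: P_P)
  show "P n x \<in> mult_dom m" "mult m (P n x) = m n *\<^sub>C P n x" by (rule mult_eqI [OF *])+
qed

lemma mult_dom_dense: "closure (mult_dom m) = UNIV"
proof -
  have "x \<in> closure (mult_dom m)" for x
  proof -
    have "(\<Sum>n<N. P n x) \<in> mult_dom m" for N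
      by (rule subspace_sum [OF csubspace_imp_subspace [OF mult_dom_csubspace]]) (rule P_in_mult_dom)
    then show ?thesis unfolding closure_sequential
      using P_sums [of x] by (intro exI [of _ "\<lambda>N. \<Sum>n<N. P n x"]) (simp add: sums_def)
  qed
  then show ?thesis by blast
qed

lemma cinner_mult_sums:
  assumes "x \<in> mult_dom m"
  shows "(\<lambda>n. (norm (P n x))\<^sup>2 *\<^sub>R m n) sums cinner x (mult m x)"
proof -
  have "(\<lambda>n. cinner x (P n (mult m x))) sums cinner x (mult m x)"
    by (rule bounded_linear.sums [OF bounded_linear_cinner_right P_sums])
  then show ?thesis
    by (simp add: P_mult assms cinner_cscale_right orthogonal_projectionD(4) [OF proj]
        scaleR_conv_of_real mult.commute)
qed

lemma cinner_mult_adjoint: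
  assumes x: "x \<in> mult_dom (\<lambda>n. cnj (m n))" and y: "y \<in> mult_dom m"
  shows "cinner x (mult m y) = cinner (mult (\<lambda>n. cnj (m n)) x) y"
proof -
  let ?x = "mult (\<lambda>n. cnj (m n)) x"
  have "(\<lambda>n. cinner x (P n (mult m y))) sums cinner x (mult m y)"
    by (rule bounded_linear.sums [OF bounded_linear_cinner_right P_sums])
  moreover have "cinner x (P n (mult m y)) = cinner ?x (P n y)" for n
  proof -
    have "cinner x (P n (mult m y)) = m n * cinner (P n x) y"
      by (simp add: P_mult [OF y] cinner_cscale_right orthogonal_projectionD(3) [OF proj])
    also have "\<dots> = cinner (P n ?x) y" by (simp add: P_mult [OF x] cinner_cscale_left)
    finally show ?thesis by (simp add: orthogonal_projectionD(3) [OF proj])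
  qed
  moreover have "(\<lambda>n. cinner ?x (P n y)) sums cinner ?x y"
    by (rule bounded_linear.sums [OF bounded_linear_cinner_right P_sums])
  ultimately show ?thesis by (simp add: sums_iff)
qed

lemma cinner_mult_real:
  assumes "x \<in> mult_dom m" "y \<in> mult_dom m" "\<And>n. m n \<in> \<real>"
  shows "cinner x (mult m y) = cinner (mult m x) y"
  using assms cinner_mult_adjoint [of x m y] by (simp add: Reals_cnj_iff)

context
  fixes m :: "nat \<Rightarrow> complex" and C :: real
  assumes bound: "\<And>n. cmod (m n) \<le> C"
begin

lemma bounded_mult_bound: "(norm (m n *\<^sub>C P n x))\<^sup>2 \<le> C\<^sup>2 * (norm (P n x))\<^sup>2"
proof -
  have "norm (m n *\<^sub>C P n x) \<le> C * norm (P n x)" using bound by (simp add: mult_right_mono)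
  then show ?thesis using power_mono by (fastforce simp: power_mult_distrib)
qed

lemma in_bounded_mult_dom [simp]: "x \<in> mult_dom m"
  unfolding mult_dom_def mem_Collect_eq
  by (rule summable_comparison_test' [where N = 0, OF summable_mult [OF bessel [of x], of "C\<^sup>2"]])
     (use bounded_mult_bound in \<open>simp del: norm_cscale\<close>)

lemma norm_bounded_mult_le: "norm (mult m x) \<le> C * norm x"
proof (rule power2_le_imp_le)
  have C0: "0 \<le> C" using bound [of 0] norm_ge_zero order_trans by blast
  show "(norm (mult m x))\<^sup>2 \<le> (C * norm x)\<^sup>2"
    using sums_le [OF bounded_mult_bound mult_norm_sums [OF in_bounded_mult_dom]
        sums_mult [OF parseval [of x], of "C\<^sup>2"]]
    by (simp add: power_mult_distrib)
  show "0 \<le> C * norm x" using C0 by simp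
qed

lemma bounded_linear_mult: "bounded_linear (mult m)"
proof (rule bounded_linear_intro [where K = C])
  show "mult m (x + y) = mult m x + mult m y" for x y using mult_add by simp
  show "mult m (c *\<^sub>R x) = c *\<^sub>R mult m x" for x c
    using mult_cscale [OF in_bounded_mult_dom] by (simp add: scaleR_eq_cscale)
  show "norm (mult m x) \<le> norm x * C" for x using norm_bounded_mult_le by (simp add: mult.commute)
qed

end

lemma norm_mult_unimodular:
  assumes "\<And>n. cmod (m n) = 1" shows "norm (mult m x) = norm x"
proof -
  have "(\<lambda>n. (norm (P n x))\<^sup>2) sums (norm (mult m x))\<^sup>2"
    using mult_norm_sums [OF in_bounded_mult_dom [of m 1]] assms by simp
  then have "(norm (mult m x))\<^sup>2 = (norm x)\<^sup>2" using parseval [of x] sums_unique2 by blast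
  then show ?thesis by simp
qed

text \<open>Dominated convergence for multipliers; it yields strong continuity and differentiability of
  the unitary group as well as countable additivity of the spectral measure.\<close>

lemma mult_tendsto_0:
  assumes bound: "\<And>t n. cmod (m t n) \<le> C" and lim: "\<And>n. ((\<lambda>t. m t n) \<longlongrightarrow> 0) F"
  shows "((\<lambda>t. mult (m t) x) \<longlongrightarrow> 0) F"
proof (cases "F = bot")
  case False
  let ?a = "\<lambda>n t. (norm (m t n *\<^sub>C P n x))\<^sup>2"
  have "((\<lambda>t. \<Sum>n. ?a n t) \<longlongrightarrow> (\<Sum>n. 0)) F"
  proof (rule tannerys_theorem [THEN conjunct2, THEN conjunct2])
    show "((\<lambda>t. ?a n t) \<longlongrightarrow> 0) F" for n
    proof -
      have "((\<lambda>t. (cmod (m t n) * norm (P n x))\<^sup>2) \<longlongrightarrow> (0 * norm (P n x))\<^sup>2) F"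
        by (intro tendsto_intros tendsto_norm_zero lim)
      then show ?thesis by simp
    qed
    show "\<forall>\<^sub>F (n, t) in at_top \<times>\<^sub>F F. norm (?a n t) \<le> C\<^sup>2 * (norm (P n x))\<^sup>2"
      using bounded_mult_bound [OF bound] by (intro always_eventually) (auto simp del: norm_cscale)
    show "summable (\<lambda>n. C\<^sup>2 * (norm (P n x))\<^sup>2)" by (intro summable_mult bessel)
  qed (rule False)
  moreover have "(\<Sum>n. ?a n t) = (norm (mult (m t) x))\<^sup>2" for t
    using mult_norm_sums [OF in_bounded_mult_dom [OF bound]] by (simp add: sums_iff)
  ultimately have "((\<lambda>t. (norm (mult (m t) x))\<^sup>2) \<longlongrightarrow> 0) F" by simp
  then have "((\<lambda>t. sqrt ((norm (mult (m t) x))\<^sup>2)) \<longlongrightarrow> sqrt 0) F" by (rule tendsto_real_sqrt)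
  then show ?thesis by (simp add: tendsto_norm_zero_iff)
qed simp

end

section \<open>Spectral integrals of a discrete spectral measure\<close>

locale diagonal_spectral_measure = orthogonal_decomposition P
  for P :: "nat \<Rightarrow> 'a::complex_hilbert \<Rightarrow> 'a" +
  fixes k :: "nat \<Rightarrow> real" and E :: "real set \<Rightarrow> 'a \<Rightarrow> 'a"
  assumes E_eq: "S \<in> sets borel \<Longrightarrow> E S x = mult (\<lambda>n. indicator S (k n)) x"
begin

lemma scalar_measure_eq:
  "scalar_measure E x = distr (density (count_space UNIV) (\<lambda>n. ennreal ((norm (P n x))\<^sup>2))) borel k"
  (is "_ = ?D")
proof -
  have eq: "ennreal ((norm (E S x))\<^sup>2) = emeasure ?D S" if S: "S \<in> sets borel" for S
  proof -
    have "(\<lambda>n. (norm (indicator S (k n) *\<^sub>C P n x))\<^sup>2) sums (norm (E S x))\<^sup>2"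
      unfolding E_eq [OF S]
      by (rule mult_norm_sums) (rule in_bounded_mult_dom [of _ 1], simp add: indicator_def)
    moreover have "(norm (indicator S (k n) *\<^sub>C P n x))\<^sup>2 = (norm (P n x))\<^sup>2 * indicator S (k n)" for n
      by (simp add: indicator_def)
    ultimately have s: "(\<lambda>n. (norm (P n x))\<^sup>2 * indicator S (k n)) sums (norm (E S x))\<^sup>2" by simp
    have "emeasure ?D S = emeasure (density (count_space UNIV) (\<lambda>n. ennreal ((norm (P n x))\<^sup>2))) (k -` S)"
      using S by (subst emeasure_distr) auto
    also have "\<dots> = (\<Sum>n. ennreal ((norm (P n x))\<^sup>2) * indicator (k -` S) n)"
      by (subst emeasure_density) (auto simp: nn_integral_count_space_nat)
    also have "\<dots> = (\<Sum>n. ennreal ((norm (P n x))\<^sup>2 * indicator S (k n)))"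
      by (intro suminf_cong) (auto simp: indicator_def)
    also have "\<dots> = ennreal ((norm (E S x))\<^sup>2)"
      using s by (subst suminf_ennreal2) (auto simp: sums_iff)
    finally show ?thesis by simp
  qed
  have "scalar_measure E x = measure_of (space ?D) (sets ?D) (emeasure ?D)"
    unfolding scalar_measure_def space_distr sets_distr
    unfolding space_borel
    by (rule measure_of_eq) (use eq sets.sigma_sets_eq [of "borel :: real measure"] in auto)
  then show ?thesis by (simp only: measure_of_of_measure)
qed

lemma integrable_scalar_measure_iff:
  fixes f :: "real \<Rightarrow> 'b::{banach,second_countable_topology}"
  assumes "f \<in> borel_measurable borel"
  shows "integrable (scalar_measure E x) f \<longleftrightarrow> summable (\<lambda>n. (norm (P n x))\<^sup>2 * norm (f (k n)))"
  unfolding scalar_measure_eq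
  by (subst integrable_distr_eq)
     (use assms in \<open>auto simp: integrable_density integrable_count_space_nat_iff\<close>)

lemma integral_scalar_measure:
  fixes f :: "real \<Rightarrow> 'b::{banach,second_countable_topology}"
  assumes "f \<in> borel_measurable borel" "integrable (scalar_measure E x) f"
  shows "(\<integral>s. f s \<partial>scalar_measure E x) = (\<Sum>n. (norm (P n x))\<^sup>2 *\<^sub>R f (k n))"
proof -
  have "summable (\<lambda>n. (norm (P n x))\<^sup>2 * norm (f (k n)))"
    using assms integrable_scalar_measure_iff by blast
  then have i: "integrable (count_space UNIV) (\<lambda>n. (norm (P n x))\<^sup>2 *\<^sub>R f (k n))"
    by (simp add: integrable_count_space_nat_iff)
  have "(\<integral>s. f s \<partial>scalar_measure E x) =
      (\<integral>n. f (k n) \<partial>density (count_space UNIV) (\<lambda>n. ennreal ((norm (P n x))\<^sup>2)))"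
    unfolding scalar_measure_eq by (rule integral_distr) (use assms in auto)
  also have "\<dots> = (\<integral>n. (norm (P n x))\<^sup>2 *\<^sub>R f (k n) \<partial>count_space UNIV)"
    by (rule integral_density) auto
  also have "\<dots> = (\<Sum>n. (norm (P n x))\<^sup>2 *\<^sub>R f (k n))"
    by (rule integral_count_space_nat [OF i])
  finally show ?thesis .
qed

definition diag :: "(real \<Rightarrow> complex) \<Rightarrow> 'a \<rightharpoonup> 'a" where
  "diag f = (\<lambda>x. if x \<in> mult_dom (\<lambda>n. f (k n)) then Some (mult (\<lambda>n. f (k n)) x) else None)"

lemma dom_diag: "dom (diag f) = mult_dom (\<lambda>n. f (k n))"
  by (auto simp: diag_def dom_def split: if_splits)

lemma diag_app: "x \<in> mult_dom (\<lambda>n. f (k n)) \<Longrightarrow> diag f \<cdot>\<^sub>o x = mult (\<lambda>n. f (k n)) x"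
  by (simp add: diag_def)

lemma integrable_sq_iff:
  assumes "f \<in> borel_measurable borel"
  shows "integrable (scalar_measure E x) (\<lambda>s. (cmod (f s))\<^sup>2) \<longleftrightarrow> x \<in> mult_dom (\<lambda>n. f (k n))"
  by (subst integrable_scalar_measure_iff)
     (use assms in \<open>auto simp: mult_dom_def power_mult_distrib mult.commute\<close>)

lemma integrable_if_sq:
  assumes "f \<in> borel_measurable borel" "x \<in> mult_dom (\<lambda>n. f (k n))"
  shows "integrable (scalar_measure E x) f"
proof -
  have "summable (\<lambda>n. (norm (P n x))\<^sup>2 * cmod (f (k n)))"
  proof (rule summable_comparison_test' [where N = 0])
    show "summable (\<lambda>n. (norm (f (k n) *\<^sub>C P n x))\<^sup>2 + (norm (P n x))\<^sup>2)"
      using assms(2) by (intro summable_add bessel) (simp add: mult_dom_def)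
    show "norm ((norm (P n x))\<^sup>2 * cmod (f (k n))) \<le> (norm (f (k n) *\<^sub>C P n x))\<^sup>2 + (norm (P n x))\<^sup>2" for n
    proof -
      have "cmod (f (k n)) \<le> (cmod (f (k n)))\<^sup>2 + 1"
        using sum_squares_bound [of "cmod (f (k n))" 1] norm_ge_zero [of "f (k n)"]
        unfolding power_one mult_1_right by linarith
      then have "(norm (P n x))\<^sup>2 * cmod (f (k n)) \<le> (norm (P n x))\<^sup>2 * ((cmod (f (k n)))\<^sup>2 + 1)"
        by (intro mult_left_mono) auto
      then show ?thesis by (simp add: power_mult_distrib algebra_simps)
    qed
  qed
  then show ?thesis using assms(1) integrable_scalar_measure_iff by blast
qed

lemma is_spectral_integral_diag:
  assumes f: "f \<in> borel_measurable borel"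
  shows "is_spectral_integral E f (diag f)"
proof -
  let ?m = "\<lambda>n. f (k n)"
  have "linear_op (diag f)"
    unfolding linear_op_def dom_diag
    using mult_dom_csubspace [of ?m] mult_clinear [of ?m] mult_add [of _ ?m] mult_cscale [of _ ?m]
    by (auto simp: clinear_on_def diag_app)
  moreover have "dom (diag f) = {x. integrable (scalar_measure E x) (\<lambda>s. (cmod (f s))\<^sup>2)}"
    by (auto simp: dom_diag integrable_sq_iff [OF f])
  moreover have "cinner x (diag f \<cdot>\<^sub>o x) = (\<integral>s. f s \<partial>scalar_measure E x)"
    and "(norm (diag f \<cdot>\<^sub>o x))\<^sup>2 = (\<integral>s. (cmod (f s))\<^sup>2 \<partial>scalar_measure E x)"
    if "x \<in> dom (diag f)" for x
  proof -
    have x: "x \<in> mult_dom ?m" using that by (simp only: dom_diag)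
    show "cinner x (diag f \<cdot>\<^sub>o x) = (\<integral>s. f s \<partial>scalar_measure E x)"
      using cinner_mult_sums [OF x]
      by (simp add: diag_app [OF x] integral_scalar_measure [OF f integrable_if_sq [OF f x]] sums_iff)
    have "(\<integral>s. (cmod (f s))\<^sup>2 \<partial>scalar_measure E x) = (\<Sum>n. (norm (P n x))\<^sup>2 *\<^sub>R (cmod (f (k n)))\<^sup>2)"
      by (rule integral_scalar_measure) (use f x integrable_sq_iff [OF f] in auto)
    then show "(norm (diag f \<cdot>\<^sub>o x))\<^sup>2 = (\<integral>s. (cmod (f s))\<^sup>2 \<partial>scalar_measure E x)"
      using mult_norm_sums [OF x] by (simp add: diag_app [OF x] sums_iff power_mult_distrib mult.commute)
  qed
  ultimately show ?thesis unfolding is_spectral_integral_def by blast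
qed

end

text \<open>By polarization over the complex numbers. This gives the uniqueness of spectral integrals.\<close>

lemma quadratic_form_determines_operator:
  fixes G G' :: "'a::complex_hilbert \<rightharpoonup> 'a"
  assumes lin: "linear_op G" "linear_op G'" and dom: "dom G' = dom G" and dense: "closure (dom G) = UNIV"
    and eq: "\<And>x. x \<in> dom G \<Longrightarrow> cinner x (G' \<cdot>\<^sub>o x) = cinner x (G \<cdot>\<^sub>o x)"
  shows "G' = G"
proof -
  define D where "D = dom G"
  define H where "H x = G' \<cdot>\<^sub>o x - G \<cdot>\<^sub>o x" for x
  have sub: "csubspace D" using lin by (auto simp: linear_op_def D_def)
  have add: "H (x + y) = H x + H y" and scale: "H (a *\<^sub>C x) = a *\<^sub>C H x" if "x \<in> D" "y \<in> D" for x y a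
    using lin that dom by (auto simp: linear_op_def D_def H_def clinear_on_def cscale_diff_right)
  have H0: "cinner x (H x) = 0" if "x \<in> D" for x
    using eq that by (simp add: H_def D_def cinner_diff_right)
  have D: "x + y \<in> D" "a *\<^sub>C x \<in> D" if "x \<in> D" "y \<in> D" for x y a
    using sub that by (auto simp: csubspace_def)
  have "cinner x (H y) = 0" if x: "x \<in> D" and y: "y \<in> D" for x y
  proof -
    have 1: "cinner x (H y) + cinner y (H x) = 0"
      using H0 [OF D(1) [OF x y]] H0 [OF x] H0 [OF y]
      by (simp add: add [OF x y] cinner_add_left cinner_add_right add.commute)
    have iy: "\<i> *\<^sub>C y \<in> D" using D x y by blast
    have "\<i> * cinner x (H y) - \<i> * cinner y (H x) = 0"
      using H0 [OF D(1) [OF x iy]] H0 [OF x] H0 [OF iy]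
      by (simp add: add [OF x iy] scale [OF y y] cinner_add_left cinner_add_right
          cinner_cscale_left cinner_cscale_right)
    then have "cinner x (H y) = cinner y (H x)" by simp
    with 1 show ?thesis by simp
  qed
  then have "H y = 0" if "y \<in> D" for y
    using that by (intro eq_0_if_orthogonal_to_dense [OF dense])
      (auto simp: inner_eq_Re_cinner D_def cinner_commute [of "H y"] simp del: domIff)
  then show ?thesis using dom
    by (intro ext) (metis D_def H_def domIff eq_iff_diff_eq_0 option.expand)
qed

lemma (in diagonal_spectral_measure) is_spectral_integral_unique:
  assumes f: "f \<in> borel_measurable borel" and G: "is_spectral_integral E f G"
  shows "G = diag f"
proof (rule quadratic_form_determines_operator)
  note d = is_spectral_integral_diag [OF f]
  show "linear_op (diag f)" "linear_op G" using d G by (simp_all add: is_spectral_integral_def)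
  show dom: "dom G = dom (diag f)" using d G by (simp add: is_spectral_integral_def)
  show "closure (dom (diag f)) = UNIV" by (simp add: dom_diag mult_dom_dense)
  show "cinner x (G \<cdot>\<^sub>o x) = cinner x (diag f \<cdot>\<^sub>o x)" if "x \<in> dom (diag f)" for x
    using d G that dom unfolding is_spectral_integral_def by metis
qed

section \<open>The functional calculus of an operator with integer-spaced spectrum\<close>

text \<open>The variance of \<open>K\<close> in an eigenvector is zero, so every spectral measure of \<open>K\<close> is
  concentrated at the eigenvalue there.\<close>

lemma spectral_measure_on_eigenvector:
  fixes K :: "'a::complex_hilbert \<rightharpoonup> 'a"
  assumes pvm: "projection_valued_measure E" and int: "is_spectral_integral E complex_of_real K"
    and x: "x \<in> dom K" "K \<cdot>\<^sub>o x = complex_of_real \<kappa> *\<^sub>C x" and S: "S \<in> sets borel"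
  shows "E S x = (if \<kappa> \<in> S then x else 0)"
proof -
  define M where "M = scalar_measure E x"
  have proj: "orthogonal_projection (E S)" if "S \<in> sets borel" for S
    using pvm that by (simp add: projection_valued_measure_def)
  have add: "(\<lambda>n::nat. E (S n) x) sums E (\<Union>n. S n) x"
    if "range S \<subseteq> sets borel" "disjoint_family S" for S
    using pvm that by (simp add: projection_valued_measure_def)
  have E_UNIV: "E UNIV x = x" using pvm by (simp add: projection_valued_measure_def)
  have E_empty: "E {} x = 0"
  proof -
    have "(\<lambda>n::nat. E {} x) sums E (\<Union>n::nat. {}) x" by (rule add) (auto simp: disjoint_family_on_def)
    then have "(\<lambda>n::nat. E {} x) \<longlonglongrightarrow> 0" by (intro summable_LIMSEQ_zero sums_summable)
    then show ?thesis by (simp add: LIMSEQ_const_iff)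
  qed
  have em: "emeasure M S = ennreal ((norm (E S x))\<^sup>2)" if S: "S \<in> sets borel" for S
    unfolding M_def
  proof (rule emeasure_measure_of [OF scalar_measure_def])
    show "S \<in> sets (scalar_measure E x)"
      using S sets.sigma_sets_eq [of "borel :: real measure"] by (simp add: scalar_measure_def)
    have ss: "sets (scalar_measure E x) = sets borel"
      using sets.sigma_sets_eq [of "borel :: real measure"] by (simp add: scalar_measure_def)
    show "positive (sets (scalar_measure E x)) (\<lambda>S. ennreal ((norm (E S x))\<^sup>2))"
      by (simp add: positive_def E_empty)
    show "countably_additive (sets (scalar_measure E x)) (\<lambda>S. ennreal ((norm (E S x))\<^sup>2))"
      unfolding ss
    proof (rule countably_additiveI)
      fix A :: "nat \<Rightarrow> real set"
      assume A: "range A \<subseteq> sets borel" "disjoint_family A" and U: "(\<Union>i. A i) \<in> sets borel"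
      have "(\<lambda>n. inner x (E (A n) x)) sums inner x (E (\<Union>n. A n) x)"
        by (rule bounded_linear.sums [OF bounded_linear_inner_right add [OF A]])
      moreover have "inner x (E (A n) x) = (norm (E (A n) x))\<^sup>2" for n
        using A by (intro orthogonal_projectionD(5) proj) auto
      moreover have "inner x (E (\<Union>n. A n) x) = (norm (E (\<Union>n. A n) x))\<^sup>2"
        using U by (intro orthogonal_projectionD(5) proj)
      ultimately have "(\<lambda>n. (norm (E (A n) x))\<^sup>2) sums (norm (E (\<Union>n. A n) x))\<^sup>2" by simp
      then show "(\<Sum>i. ennreal ((norm (E (A i) x))\<^sup>2)) = ennreal ((norm (E (\<Union>i. A i) x))\<^sup>2)"
        by (subst suminf_ennreal2) (auto simp: sums_iff)
    qed
  qed auto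
  have sets_M: "sets M = sets borel" and space_M: "space M = UNIV"
    using sets.sigma_sets_eq [of "borel :: real measure"] by (simp_all add: M_def scalar_measure_def)
  interpret finite_measure M
    by (rule finite_measureI) (simp add: space_M em)
  have total: "measure M (space M) = (norm x)\<^sup>2"
    unfolding measure_def space_M by (simp add: em E_UNIV)
  have i2: "integrable M (\<lambda>s. s\<^sup>2)"
  proof -
    have "x \<in> {\<psi>. integrable (scalar_measure E \<psi>) (\<lambda>s. (cmod (complex_of_real s))\<^sup>2)}"
      using int x(1) unfolding is_spectral_integral_def by blast
    then show ?thesis by (simp add: M_def)
  qed
  have i1: "integrable M (\<lambda>s. s)"
  proof (rule Bochner_Integration.integrable_bound [where f = "\<lambda>s. s\<^sup>2 + 1"])
    show "integrable M (\<lambda>s. s\<^sup>2 + 1)" using i2 by simp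
    show "(\<lambda>s. s) \<in> borel_measurable M"
      using measurable_cong_sets [OF sets_M refl, of "borel :: real measure"] by simp
    show "AE s in M. norm s \<le> norm (s\<^sup>2 + 1)"
    proof (rule AE_I2)
      fix s :: real
      have "2 * \<bar>s\<bar> \<le> s\<^sup>2 + 1" using sum_squares_bound [of "\<bar>s\<bar>" 1] by simp
      then show "norm s \<le> norm (s\<^sup>2 + 1)" by simp
    qed
  qed
  have m2: "(\<integral>s. s\<^sup>2 \<partial>M) = \<kappa>\<^sup>2 * (norm x)\<^sup>2"
  proof -
    have "(norm (K \<cdot>\<^sub>o x))\<^sup>2 = (\<integral>s. (cmod (complex_of_real s))\<^sup>2 \<partial>M)"
      using int x(1) unfolding is_spectral_integral_def M_def by blast
    then show ?thesis by (simp add: x(2) power_mult_distrib)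
  qed
  have m1: "(\<integral>s. s \<partial>M) = \<kappa> * (norm x)\<^sup>2"
  proof -
    have "cinner x (K \<cdot>\<^sub>o x) = (\<integral>s. complex_of_real s \<partial>M)"
      using int x(1) unfolding is_spectral_integral_def M_def by blast
    also have "\<dots> = complex_of_real (\<integral>s. s \<partial>M)" by simp
    finally have "complex_of_real (\<kappa> * (norm x)\<^sup>2) = complex_of_real (\<integral>s. s \<partial>M)"
      by (simp add: x(2) cinner_cscale_right cinner_self)
    then show ?thesis using of_real_eq_iff by metis
  qed
  have eq: "(s - \<kappa>)\<^sup>2 = s\<^sup>2 - 2 * \<kappa> * s + \<kappa>\<^sup>2" for s :: real
    by (simp add: power2_eq_square algebra_simps)
  have iv: "integrable M (\<lambda>s. (s - \<kappa>)\<^sup>2)" unfolding eq using i1 i2 by simp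
  have "(\<integral>s. (s - \<kappa>)\<^sup>2 \<partial>M) = \<kappa>\<^sup>2 * (norm x)\<^sup>2 - 2 * \<kappa> * (\<kappa> * (norm x)\<^sup>2) + \<kappa>\<^sup>2 * (norm x)\<^sup>2"
    unfolding eq using i1 i2 by (simp add: m1 m2 total mult.commute)
  also have "\<dots> = 0" by (simp add: power2_eq_square)
  finally have "(\<integral>s. (s - \<kappa>)\<^sup>2 \<partial>M) = 0" .
  then have "AE s in M. (s - \<kappa>)\<^sup>2 = 0"
    using integral_nonneg_eq_0_iff_AE [OF iv] by simp
  then have ae: "AE s in M. s = \<kappa>" by simp
  show ?thesis
  proof (cases "\<kappa> \<in> S")
    case True
    have "emeasure M S = emeasure M (space M)"
      using ae S True by (intro emeasure_eq_AE) (auto simp: sets_M space_M)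
    then have "ennreal ((norm (E S x))\<^sup>2) = ennreal ((norm x)\<^sup>2)"
      using S by (simp add: space_M em E_UNIV)
    then have n: "(norm (E S x))\<^sup>2 = (norm x)\<^sup>2" by (simp add: ennreal_inj)
    have "(norm (x - E S x))\<^sup>2 = (norm x)\<^sup>2 - 2 * inner x (E S x) + (norm (E S x))\<^sup>2"
      unfolding power2_norm_eq_inner by (simp add: inner_diff_left inner_diff_right inner_commute)
    also have "\<dots> = 0" using n by (simp add: orthogonal_projectionD(5) [OF proj [OF S]])
    finally show ?thesis using True by simp
  next
    case False
    have "emeasure M S = emeasure M {}"
      using ae S False by (intro emeasure_eq_AE) (auto simp: sets_M elim: eventually_mono)
    then have "ennreal ((norm (E S x))\<^sup>2) = 0" using em [OF S] by simp
    then show ?thesis using False by (simp add: ennreal_eq_0_iff)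
  qed
qed

context integer_spaced_spectrum
begin

definition P :: "nat \<Rightarrow> 'a \<Rightarrow> 'a" where "P n = proj_on (eigsp n)"

lemma P_in_eigsp: "P n x \<in> eigsp n"
  unfolding P_def by (rule proj_on_in [OF eigsp_closed eigsp_csubspace])

lemma P_eqI: "p \<in> eigsp n \<Longrightarrow> (\<And>m. m \<in> eigsp n \<Longrightarrow> cinner (x - p) m = 0) \<Longrightarrow> P n x = p"
  unfolding P_def by (rule proj_on_eqI [OF eigsp_closed eigsp_csubspace])

lemma P_orth: "m \<in> eigsp n \<Longrightarrow> cinner (x - P n x) m = 0"
  unfolding P_def by (rule proj_on_orth [OF eigsp_closed eigsp_csubspace])

lemma eigsp_orthogonal:
  assumes "e \<in> eigsp n" "f \<in> eigsp m" "n \<noteq> m" shows "cinner e f = 0"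
proof -
  have "cinner e (K \<cdot>\<^sub>o f) = cinner (K \<cdot>\<^sub>o e) f" using assms eigspD(1) by (intro K_symmetric)
  then have "complex_of_real (eigenval m) * cinner e f = complex_of_real (eigenval n) * cinner e f"
    using assms by (simp add: eigspD(2) cinner_cscale_left cinner_cscale_right)
  then show ?thesis using assms(3) by (auto simp: eigenval_def)
qed

sublocale orthogonal_decomposition P
proof
  show "orthogonal_projection (P n)" for n
    unfolding P_def by (rule orthogonal_projection_proj_on [OF eigsp_closed eigsp_csubspace])
  show "P n (P m x) = 0" if "n \<noteq> m" for n m x
    using eigsp_csubspace [of n] eigsp_orthogonal [OF P_in_eigsp _ that [symmetric]]
    by (intro P_eqI) (auto simp: csubspace_def)
  show "x = 0" if "\<And>n. P n x = 0" for x
  proof (rule eigenvectors_total)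
    show "inner x e = 0" if "e \<in> eigsp n" for n e
      using P_orth [OF that, of x] \<open>\<And>n. P n x = 0\<close> by (simp add: inner_eq_Re_cinner)
  qed
qed

lemma P_K: "\<psi> \<in> dom K \<Longrightarrow> P n (K \<cdot>\<^sub>o \<psi>) = complex_of_real (eigenval n) *\<^sub>C P n \<psi>"
proof (rule P_eqI)
  show "complex_of_real (eigenval n) *\<^sub>C P n \<psi> \<in> eigsp n"
    using P_in_eigsp eigsp_csubspace by (auto simp: csubspace_def)
  show "cinner (K \<cdot>\<^sub>o \<psi> - complex_of_real (eigenval n) *\<^sub>C P n \<psi>) e = 0"
    if "\<psi> \<in> dom K" "e \<in> eigsp n" for e
    using K_symmetric [OF that(1) eigspD(1) [OF that(2)]] P_orth [OF that(2), of \<psi>]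
    by (simp add: eigspD(2) [OF that(2)] cinner_diff_left cinner_cscale_left cinner_cscale_right)
qed

lemma dom_K: "dom K = mult_dom (\<lambda>n. complex_of_real (eigenval n))"
  and K_app: "\<psi> \<in> dom K \<Longrightarrow> K \<cdot>\<^sub>o \<psi> = mult (\<lambda>n. complex_of_real (eigenval n)) \<psi>"
proof -
  let ?m = "\<lambda>n. complex_of_real (eigenval n)"
  have 1: "\<psi> \<in> mult_dom ?m" "mult ?m \<psi> = K \<cdot>\<^sub>o \<psi>" if "\<psi> \<in> dom K" for \<psi>
    using mult_eqI [OF P_K [OF that]] by blast+
  have 2: "\<psi> \<in> dom K" if \<psi>: "\<psi> \<in> mult_dom ?m" for \<psi>
  proof (rule K_eqI(1))
    show "cinner \<psi> (K \<cdot>\<^sub>o \<phi>) = cinner (mult ?m \<psi>) \<phi>" if "\<phi> \<in> dom K" for \<phi>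
      using cinner_mult_real [OF \<psi> 1(1) [OF that]] by (simp add: 1(2) [OF that])
  qed
  show "dom K = mult_dom ?m" using 1(1) 2 by blast
  show "\<psi> \<in> dom K \<Longrightarrow> K \<cdot>\<^sub>o \<psi> = mult ?m \<psi>" using 1(2) by simp
qed

text \<open>The spectral measure that projects onto the eigenspaces with eigenvalue in a given set.\<close>

lemma ex_spectral_measure:
  "\<exists>E. projection_valued_measure E \<and> is_spectral_integral E complex_of_real K"
proof -
  define E where "E S = mult (\<lambda>n. indicator S (eigenval n))" for S
  have bd: "cmod (indicator S (eigenval n)) \<le> 1" for S n by (simp add: indicator_def)
  note [simp] = in_bounded_mult_dom [OF bd]
  interpret E: diagonal_spectral_measure P eigenval E by unfold_locales (simp add: E_def)
  have P_E: "P n (E S x) = indicator S (eigenval n) *\<^sub>C P n x" for n S x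
    by (simp add: E_def P_mult)
  have "orthogonal_projection (E S)" for S
    unfolding orthogonal_projection_def
  proof (intro conjI allI)
    show "clinear_on UNIV (E S)"
      using mult_clinear [of "\<lambda>n. indicator S (eigenval n)"] by (simp add: E_def clinear_on_def)
    show "E S (E S x) = E S x" for x
      by (rule decomposition_ext) (simp add: P_E cscale_cscale indicator_def)
    show "cinner x (E S y) = cinner (E S x) y" for x y
      unfolding E_def by (rule cinner_mult_real) (simp_all del: indicator_simps, simp add: indicator_def)
  qed
  moreover have "E UNIV = (\<lambda>x. x)"
    by (rule ext, rule decomposition_ext) (simp add: P_E)
  moreover have "(\<lambda>n. E (S n) \<psi>) sums E (\<Union>n. S n) \<psi>" if S: "disjoint_family S" for S :: "nat \<Rightarrow> _" and \<psi>
  proof -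
    let ?U = "\<Union>n. S n" and ?T = "\<lambda>N. \<Union>i<N. S i"
    have part: "(\<Sum>i<N. E (S i) \<psi>) = E (?T N) \<psi>" for N
    proof (induction N)
      case 0
      show ?case by (rule decomposition_ext) (simp add: P_E)
    next
      case (Suc N)
      have "S i \<inter> S N = {}" if "i < N" for i using disjoint_family_onD [OF S, of i N] that by simp
      then have "?T N \<inter> S N = {}" by blast
      then have ind: "indicator (?T (Suc N)) a = (indicator (?T N) a + indicator (S N) a :: complex)" for a
        by (auto simp: indicator_def less_Suc_eq)
      have "E (?T N) \<psi> + E (S N) \<psi> = E (?T (Suc N)) \<psi>"
        by (rule decomposition_ext) (simp only: P_E P_lin ind cscale_add_left)
      with Suc show ?case by simp
    qed
    have "(\<lambda>N. mult (\<lambda>n. indicator (?T N) (eigenval n) - indicator ?U (eigenval n)) \<psi>) \<longlonglongrightarrow> 0"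
    proof (rule mult_tendsto_0)
      show "cmod (indicator (?T N) (eigenval n) - indicator ?U (eigenval n)) \<le> 1" for N n
        by (simp add: indicator_def)
      show "(\<lambda>N. indicator (?T N) (eigenval n) - indicator ?U (eigenval n) :: complex) \<longlonglongrightarrow> 0" for n
        by (rule LIM_zero [OF LIMSEQ_indicator_UN])
    qed
    moreover have "mult (\<lambda>n. indicator (?T N) (eigenval n) - indicator ?U (eigenval n)) \<psi>
        = E (?T N) \<psi> - E ?U \<psi>" for N
      by (rule mult_eqI(2)) (simp add: P_E cscale_diff_left)
    ultimately have "(\<lambda>N. E (?T N) \<psi> - E ?U \<psi>) \<longlonglongrightarrow> 0" by simp
    then show ?thesis unfolding sums_def part by (simp only: LIM_zero_iff)
  qed
  ultimately have "projection_valued_measure E" unfolding projection_valued_measure_def by blast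
  moreover have "K = E.diag complex_of_real"
  proof (rule ext)
    show "K x = E.diag complex_of_real x" for x
    proof (cases "x \<in> dom K")
      case True
      then have "K x = Some (K \<cdot>\<^sub>o x)" by auto
      then show ?thesis using True K_app [OF True] by (simp add: E.diag_def dom_K [symmetric] del: domIff)
    next
      case False
      then show ?thesis by (simp add: E.diag_def dom_K [symmetric]) auto
    qed
  qed
  ultimately show ?thesis using E.is_spectral_integral_diag [of complex_of_real] by auto
qed

text \<open>The spectral measure selected by \<^const>\<open>spectral_measure\<close> is forced on eigenvectors, hence on all
  vectors by boundedness of its projections.\<close>

sublocale diagonal_spectral_measure P eigenval "spectral_measure K"
proof
  fix S :: "real set" and x :: 'a
  assume S: "S \<in> sets borel"
  let ?E = "spectral_measure K"
  have sm: "projection_valued_measure ?E" "is_spectral_integral ?E complex_of_real K"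
    using someI_ex [OF ex_spectral_measure] by (auto simp: spectral_measure_def)
  have bd: "cmod (indicator S (eigenval n)) \<le> 1" for n by (simp add: indicator_def)
  have "orthogonal_projection (?E S)" using sm S by (simp add: projection_valued_measure_def)
  then have bl: "bounded_linear (?E S)" by (rule orthogonal_projectionD)
  have comp: "?E S (P n x) = indicator S (eigenval n) *\<^sub>C P n x" for n
    using spectral_measure_on_eigenvector [OF sm eigspD [OF P_in_eigsp] S, of n x]
    by (simp add: indicator_def)
  have "(\<lambda>n. ?E S (P n x)) sums ?E S x" by (rule bounded_linear.sums [OF bl P_sums])
  moreover have "(\<lambda>n. P n (mult (\<lambda>n. indicator S (eigenval n)) x)) sums mult (\<lambda>n. indicator S (eigenval n)) x"
    by (rule P_sums)
  ultimately show "?E S x = mult (\<lambda>n. indicator S (eigenval n)) x"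
    by (simp add: comp P_mult in_bounded_mult_dom [OF bd] sums_iff)
qed

theorem fun_calc_eq_diag: "f \<in> borel_measurable borel \<Longrightarrow> fun_calc K f = diag f"
  unfolding fun_calc_def
  by (rule the_equality) (auto intro: is_spectral_integral_diag is_spectral_integral_unique)

definition weight :: "real \<Rightarrow> nat \<Rightarrow> complex" where
  "weight s n = complex_of_real (\<bar>eigenval n\<bar> powr s)"

definition phase :: "real \<Rightarrow> nat \<Rightarrow> complex" where
  "phase t n = exp (\<i> * complex_of_real (t * eigenval n))"

lemma op_pow_eq: "op_pow K s = diag (\<lambda>x. complex_of_real (\<bar>x\<bar> powr s))"
  unfolding op_pow_def by (rule fun_calc_eq_diag) measurable

lemma scale_space_eq: "scale_space K s = mult_dom (weight s)"
  by (simp add: scale_space_def op_pow_eq dom_diag weight_def [abs_def])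

lemma op_pow_app: "x \<in> scale_space K s \<Longrightarrow> op_pow K s \<cdot>\<^sub>o x = mult (weight s) x"
  by (simp add: scale_space_eq op_pow_eq diag_app weight_def [abs_def])

lemma scale_norm_eq: "x \<in> scale_space K s \<Longrightarrow> scale_norm K s x = norm (mult (weight s) x)"
  by (simp add: scale_norm_def op_pow_app)

lemma cmod_phase [simp]: "cmod (phase t n) = 1"
  by (simp add: phase_def norm_exp_eq_Re)

lemma in_mult_dom_phase [simp]: "x \<in> mult_dom (phase t)"
  by (rule in_bounded_mult_dom [of _ 1]) simp

lemma op_exp_eq: "op_exp K t x = mult (phase t) x"
proof -
  have "fun_calc K (\<lambda>x. exp (\<i> * complex_of_real (t * x))) = diag (\<lambda>x. exp (\<i> * complex_of_real (t * x)))"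
    by (rule fun_calc_eq_diag) (intro borel_measurable_continuous_onI continuous_intros)
  moreover have "x \<in> mult_dom (\<lambda>n. exp (\<i> * complex_of_real (t * eigenval n)))"
    using in_mult_dom_phase [of x t] by (simp add: phase_def [abs_def])
  ultimately show ?thesis by (simp add: op_exp_def diag_app phase_def [abs_def])
qed

end

section \<open>Powers of the operator and differentiation along its unitary group\<close>

lemma has_deriv_wrt_norm_iff:
  "has_deriv_wrt norm f D t \<longleftrightarrow> (f has_vector_derivative D) (at t)" for f :: "real \<Rightarrow> 'a::real_normed_vector"
proof -
  have "norm ((f (t + h) - f t) /\<^sub>R h - D) = norm (f (t + h) - f t - h *\<^sub>R D) / norm h" if "h \<noteq> 0" for h
  proof -
    have "(f (t + h) - f t) /\<^sub>R h - D = (f (t + h) - f t - h *\<^sub>R D) /\<^sub>R h"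
      using that by (simp add: scaleR_diff_right)
    then show ?thesis by (simp add: divide_inverse mult.commute)
  qed
  then show ?thesis
    unfolding has_deriv_wrt_def has_vector_derivative_def has_derivative_at
    by (simp add: bounded_linear_scaleR_left cong: tendsto_cong [OF eventually_at_filter [THEN iffD2]] LIM_cong)
qed

locale positive_integer_spaced_spectrum = integer_spaced_spectrum +
  assumes positive: "positive_op K" and lam_nonneg: "lam \<ge> 0"
begin

lemma eigenval_nonneg: "0 \<le> eigenval n"
  using lam_nonneg by (simp add: eigenval_def)

text \<open>For \<open>lam = 0\<close> the inclusion of the spectrum leaves room for the eigenvalue zero; positivity
  excludes it, so that all powers of \<open>K\<close> are invertible.\<close>

lemma P_eq_0_if_eigenval_0:
  assumes 0: "eigenval n = 0" shows "P n x = 0"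
proof -
  obtain c where c: "c > 0" "\<And>\<psi>. \<psi> \<in> dom (op_pow K (1/2)) \<Longrightarrow> quad_form K \<psi> \<ge> c * (norm \<psi>)\<^sup>2"
    using positive unfolding positive_op_def by blast
  let ?\<psi> = "P n x"
  have "?\<psi> \<in> dom (op_pow K (1/2))" using P_in_mult_dom scale_space_eq by (simp add: scale_space_def del: domIff)
  then have le: "c * (norm ?\<psi>)\<^sup>2 \<le> quad_form K ?\<psi>" by (rule c(2))
  have z: "(norm (P j ?\<psi>))\<^sup>2 * \<bar>eigenval j\<bar> = 0" "(norm (P j ?\<psi>))\<^sup>2 * eigenval j = 0" for j
    using 0 by (simp_all add: P_P)
  have int: "integrable (scalar_measure (spectral_measure K) ?\<psi>) (\<lambda>s. s)"
  proof (subst integrable_scalar_measure_iff)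
    show "summable (\<lambda>j. (norm (P j ?\<psi>))\<^sup>2 * norm (eigenval j))"
      unfolding real_norm_def z(1) by (rule summable_zero)
  qed simp
  have "quad_form K ?\<psi> = (\<Sum>j. (norm (P j ?\<psi>))\<^sup>2 *\<^sub>R eigenval j)"
    unfolding quad_form_def by (rule integral_scalar_measure [OF _ int]) simp
  then have "quad_form K ?\<psi> = 0" by (simp only: real_scaleR_def z(2) suminf_zero)
  with le have "c * (norm ?\<psi>)\<^sup>2 \<le> 0" by (simp only:)
  then show ?thesis using c(1) by (simp add: mult_le_0_iff)
qed

lemma weight_mult: "weight s n * weight t n = weight (s + t) n"
  unfolding weight_def of_real_mult [symmetric] powr_add ..

lemma weight_0: "weight 0 n *\<^sub>C P n x = P n x"
  using P_eq_0_if_eigenval_0 [of n x] by (cases "eigenval n = 0") (simp_all add: weight_def)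

lemma weight_1: "weight 1 n = complex_of_real (eigenval n)"
  using eigenval_nonneg [of n] by (simp add: weight_def)

lemma weight_real: "weight s n \<in> \<real>"
  by (simp add: weight_def)

lemma weight_bounded:
  assumes "s \<le> 0" shows "\<exists>C. \<forall>n. cmod (weight s n) \<le> C"
proof (intro exI allI)
  fix n
  \<comment> \<open>A lower bound for the nonzero numbers \<open>n + lam\<close>.\<close>
  define \<kappa> where "\<kappa> = (if lam > 0 then lam else 1)"
  have "\<kappa> > 0" by (simp add: \<kappa>_def)
  show "cmod (weight s n) \<le> \<kappa> powr s"
  proof (cases "eigenval n = 0")
    case False
    then have "\<kappa> \<le> eigenval n" using lam_nonneg by (cases n) (auto simp: \<kappa>_def eigenval_def)
    then show ?thesis using assms \<open>\<kappa> > 0\<close> by (simp add: weight_def powr_mono2')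
  qed (simp add: weight_def)
qed

abbreviation Kpow :: "real \<Rightarrow> 'a \<Rightarrow> 'a" where "Kpow s \<equiv> mult (weight s)"

abbreviation evolve :: "real \<Rightarrow> 'a \<Rightarrow> 'a" where "evolve t \<equiv> mult (phase (- t))"

lemma in_scale_nonpos [simp]: "s \<le> 0 \<Longrightarrow> x \<in> mult_dom (weight s)"
  using weight_bounded in_bounded_mult_dom by blast

lemma Kpow_bounded_linear: "s \<le> 0 \<Longrightarrow> bounded_linear (Kpow s)"
  using weight_bounded bounded_linear_mult by blast

lemma Kpow_Kpow:
  assumes "x \<in> mult_dom (weight s)" "t \<le> s"
  shows "x \<in> mult_dom (weight t)" "Kpow (t - s) (Kpow s x) = Kpow t x"
proof -
  have *: "P n (Kpow (t - s) (Kpow s x)) = weight t n *\<^sub>C P n x" for n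
    using assms by (simp add: P_mult cscale_cscale weight_mult)
  show "x \<in> mult_dom (weight t)" "Kpow (t - s) (Kpow s x) = Kpow t x"
    using mult_eqI [OF *] by simp_all
qed

lemma Kpow_0: "Kpow 0 x = x"
  by (rule mult_eqI(2)) (simp add: weight_0)

lemma Kpow_neg_Kpow: "x \<in> mult_dom (weight s) \<Longrightarrow> 0 \<le> s \<Longrightarrow> Kpow (- s) (Kpow s x) = x"
  using Kpow_Kpow(2) [of x s 0] by (simp add: Kpow_0)

lemma Kpow_neg_in:
  assumes "0 \<le> s" shows "Kpow (- s) y \<in> mult_dom (weight s)" "Kpow s (Kpow (- s) y) = y"
proof -
  have *: "P n y = weight s n *\<^sub>C P n (Kpow (- s) y)" for n
    using assms by (simp add: P_mult cscale_cscale weight_mult weight_0)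
  show "Kpow (- s) y \<in> mult_dom (weight s)" "Kpow s (Kpow (- s) y) = y"
    by (rule mult_eqI [OF *])+
qed

lemma Kpow_add_nonpos: "s \<le> 0 \<Longrightarrow> t \<le> 0 \<Longrightarrow> Kpow s (Kpow t x) = Kpow (s + t) x"
  by (rule mult_eqI(2) [symmetric]) (simp add: P_mult cscale_cscale weight_mult)

lemma cinner_Kpow:
  "s \<le> 0 \<Longrightarrow> cinner (Kpow s x) y = cinner x (Kpow s y)"
  by (rule cinner_mult_real [symmetric]) (auto simp: weight_real)

lemma phase_mult: "phase s n * phase t n = phase (s + t) n"
  by (simp add: phase_def exp_add [symmetric] algebra_simps)

lemma phase_0 [simp]: "phase 0 n = 1"
  by (simp add: phase_def)

lemma mult_phase_inverse: "mult (phase (- t)) (mult (phase t) x) = x"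
  by (rule decomposition_ext) (simp add: P_mult cscale_cscale phase_mult)

lemma norm_mult_phase [simp]: "norm (mult (phase t) x) = norm x"
  by (rule norm_mult_unimodular) simp

lemma bounded_linear_phase: "bounded_linear (mult (phase t))"
  by (rule bounded_linear_mult [of _ 1]) simp

lemma phase_clinear: "clinear_on UNIV (mult (phase t))"
  using mult_clinear [of "phase t"] by (simp add: clinear_on_def)

lemma Kpow_phase:
  assumes "x \<in> mult_dom (weight s)"
  shows "mult (phase t) x \<in> mult_dom (weight s)" "Kpow s (mult (phase t) x) = mult (phase t) (Kpow s x)"
proof -
  have *: "P n (mult (phase t) (Kpow s x)) = weight s n *\<^sub>C P n (mult (phase t) x)" for n
    by (simp add: P_mult assms cscale_cscale mult.commute)
  show "mult (phase t) x \<in> mult_dom (weight s)" "Kpow s (mult (phase t) x) = mult (phase t) (Kpow s x)"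
    by (rule mult_eqI [OF *])+
qed

lemma cinner_phase: "cinner x (mult (phase t) y) = cinner (mult (phase (- t)) x) y"
proof -
  have "(\<lambda>n. cnj (phase t n)) = phase (- t)"
    by (rule ext) (simp add: phase_def exp_cnj)
  then show ?thesis using cinner_mult_adjoint [of x "phase t" y] by simp
qed

lemma evolve_strongly_continuous: "((\<lambda>h. evolve (t + h) x) \<longlongrightarrow> evolve t x) (at 0)"
proof -
  have "((\<lambda>h. mult (\<lambda>n. phase (- (t + h)) n - phase (- t) n) x) \<longlongrightarrow> 0) (at 0)"
  proof (rule mult_tendsto_0)
    show "cmod (phase (- (t + h)) n - phase (- t) n) \<le> 2" for h n
      using norm_triangle_ineq4 [of "phase (- (t + h)) n" "phase (- t) n"] by simp
    have "((\<lambda>h. phase (- (t + h)) n) \<longlongrightarrow> phase (- (t + 0)) n) (at 0)" for n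
      unfolding phase_def by (intro tendsto_intros)
    then show "((\<lambda>h. phase (- (t + h)) n - phase (- t) n) \<longlongrightarrow> 0) (at 0)" for n
      using LIM_zero by fastforce
  qed
  moreover have "mult (\<lambda>n. phase (- (t + h)) n - phase (- t) n) x = evolve (t + h) x - evolve t x" for h
    by (rule mult_eqI(2)) (simp add: P_mult cscale_diff_left)
  ultimately show ?thesis by (simp add: LIM_zero_iff)
qed

lemma evolve_tendsto:
  assumes "(g \<longlongrightarrow> y) (at 0)" shows "((\<lambda>h. evolve (t + h) (g h)) \<longlongrightarrow> evolve t y) (at 0)"
proof -
  have "((\<lambda>h. evolve (t + h) (g h - y)) \<longlongrightarrow> 0) (at 0)"
    by (rule tendsto_norm_zero_cancel) (use assms in \<open>simp add: LIM_zero_iff tendsto_norm_zero_iff\<close>)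
  from tendsto_add [OF this evolve_strongly_continuous [of t y]] show ?thesis
    by (simp add: clinear_on_UNIV_D [OF phase_clinear])
qed

text \<open>Applying \<open>K\<^sup>-\<^sup>1\<close> makes every orbit of the group differentiable: the difference quotients of
  \<open>s \<mapsto> e\<^sup>-\<^sup>i\<^sup>s\<^sup>k / k\<close> are bounded by \<open>1\<close> uniformly in \<open>k\<close>.\<close>

lemma Kpow_evolve_has_vector_derivative:
  "((\<lambda>s. Kpow (- 1) (evolve s x)) has_vector_derivative (- \<i>) *\<^sub>C evolve t x) (at t)"
proof -
  \<comment> \<open>The multiplier of the difference quotient minus the derivative. On the trivial eigenspace of the
    value zero it must be set to zero, as it would not tend to zero there.\<close>
  define m where "m h n = (if eigenval n = 0 then 0 else
      inverse (complex_of_real h) * (weight (- 1) n * (phase (- (t + h)) n - phase (- t) n)) - (- \<i>) * phase (- t) n)" for h n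
  have split_norm: "cmod (phase (- (t + h)) n - phase (- t) n) = cmod (phase (- h) n - 1)" for h n
  proof -
    have "phase (- (t + h)) n - phase (- t) n = phase (- t) n * (phase (- h) n - 1)"
      by (simp add: phase_mult algebra_simps)
    then show ?thesis by (simp only: norm_mult cmod_phase mult_1)
  qed
  have phase_le: "cmod (phase (- h) n - 1) \<le> \<bar>h\<bar> * eigenval n" for h n
  proof -
    have "cmod (phase (- h) n - 1) = 2 * \<bar>sin (- h * eigenval n / 2)\<bar>"
      using dist_exp_i_1 [of "- h * eigenval n"] by (simp add: phase_def dist_norm)
    also have "\<dots> \<le> 2 * \<bar>- h * eigenval n / 2\<bar>" by (intro mult_left_mono abs_sin_x_le_abs_x) auto
    also have "\<dots> = \<bar>h\<bar> * eigenval n" using eigenval_nonneg [of n] by (simp add: abs_mult)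
    finally show ?thesis .
  qed
  have w: "weight (- 1) n = inverse (complex_of_real (eigenval n))" if "eigenval n \<noteq> 0" for n
    using eigenval_nonneg [of n] that by (simp add: weight_def powr_minus of_real_inverse)
  have "((\<lambda>h. mult (m h) x) \<longlongrightarrow> 0) (at 0)"
  proof (rule mult_tendsto_0)
    show "cmod (m h n) \<le> 2" for h n
    proof (cases "eigenval n = 0")
      case False
      then have k: "eigenval n > 0" using eigenval_nonneg [of n] by simp
      have "cmod (m h n) \<le> inverse \<bar>h\<bar> * (inverse (eigenval n) * cmod (phase (- h) n - 1)) + 1"
        using norm_triangle_ineq4 [of "inverse (complex_of_real h) * (weight (- 1) n * (phase (- (t + h)) n - phase (- t) n))"
            "(- \<i>) * phase (- t) n"] k
          split_norm [of h n]
        by (simp add: m_def w norm_mult norm_inverse)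
      also have "\<dots> \<le> inverse \<bar>h\<bar> * (inverse (eigenval n) * (\<bar>h\<bar> * eigenval n)) + 1"
        using phase_le [of h n] k by (intro add_right_mono mult_left_mono) auto
      also have "\<dots> \<le> 2" using k by (cases "h = 0") (auto simp: field_simps)
      finally show ?thesis .
    qed (simp add: m_def)
    show "((\<lambda>h. m h n) \<longlongrightarrow> 0) (at 0)" for n
    proof (cases "eigenval n = 0")
      case False
      have "((\<lambda>s. weight (- 1) n * phase (- s) n) has_vector_derivative
          weight (- 1) n * ((- \<i> * complex_of_real (eigenval n)) * phase (- t) n)) (at t)"
        unfolding phase_def
        by (intro derivative_eq_intros | rule has_vector_derivative_real_field | simp)+
      also have "weight (- 1) n * ((- \<i> * complex_of_real (eigenval n)) * phase (- t) n) = (- \<i>) * phase (- t) n"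
        using False by (simp add: w)
      finally have "((\<lambda>h. norm ((weight (- 1) n * phase (- (t + h)) n - weight (- 1) n * phase (- t) n) /\<^sub>R h
          - (- \<i>) * phase (- t) n)) \<longlongrightarrow> 0) (at 0)"
        unfolding has_deriv_wrt_norm_iff [symmetric] has_deriv_wrt_def .
      then have "((\<lambda>h. (weight (- 1) n * phase (- (t + h)) n - weight (- 1) n * phase (- t) n) /\<^sub>R h
          - (- \<i>) * phase (- t) n) \<longlongrightarrow> 0) (at 0)"
        by (rule tendsto_norm_zero_cancel)
      then show ?thesis
        using False by (simp add: m_def scaleR_conv_of_real right_diff_distrib)
    qed (simp add: m_def)
  qed
  moreover have "mult (m h) x = (Kpow (- 1) (evolve (t + h) x) - Kpow (- 1) (evolve t x)) /\<^sub>R h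
      - (- \<i>) *\<^sub>C evolve t x" for h
  proof (rule mult_eqI(2))
    show "P n ((Kpow (- 1) (evolve (t + h) x) - Kpow (- 1) (evolve t x)) /\<^sub>R h - (- \<i>) *\<^sub>C evolve t x)
        = m h n *\<^sub>C P n x" for n
    proof (cases "eigenval n = 0")
      case True
      then show ?thesis by (simp add: P_eq_0_if_eigenval_0)
    next
      case False
      then have "m h n = inverse (complex_of_real h) * (weight (- 1) n * phase (- (t + h)) n)
          - inverse (complex_of_real h) * (weight (- 1) n * phase (- t) n) - (- \<i>) * phase (- t) n"
        by (simp add: m_def right_diff_distrib)
      then show ?thesis
        by (simp add: P_mult scaleR_eq_cscale cscale_cscale cscale_diff_left cscale_diff_right
            cscale_add_left cscale_minus_left)
    qed
  qed
  ultimately have "((\<lambda>h. norm ((Kpow (- 1) (evolve (t + h) x) - Kpow (- 1) (evolve t x)) /\<^sub>R h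
      - (- \<i>) *\<^sub>C evolve t x)) \<longlongrightarrow> 0) (at 0)"
    by (simp only: tendsto_norm_zero_iff)
  then show ?thesis unfolding has_deriv_wrt_norm_iff [symmetric] has_deriv_wrt_def .
qed

end

context positive_integer_spaced_spectrum
begin

lemma Kpow_evolve_product_rule:
  assumes F: "(F has_vector_derivative F') (at t)"
  shows "((\<lambda>s. Kpow (- 1) (evolve s (F s))) has_vector_derivative
    (- \<i>) *\<^sub>C evolve t (F t) + Kpow (- 1) (evolve t F')) (at t)"
proof -
  interpret Q: bounded_linear "Kpow (- 1)" by (rule Kpow_bounded_linear) simp
  interpret U: bounded_linear "mult (phase s)" for s by (rule bounded_linear_phase)
  have "((\<lambda>h. (F (t + h) - F t) /\<^sub>R h - F') \<longlongrightarrow> 0) (at 0)"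
    using F unfolding has_deriv_wrt_norm_iff [symmetric] has_deriv_wrt_def by (rule tendsto_norm_zero_cancel)
  then have "((\<lambda>h. (F (t + h) - F t) /\<^sub>R h) \<longlongrightarrow> F') (at 0)" by (rule LIM_zero_cancel)
  then have 1: "((\<lambda>h. Kpow (- 1) (evolve (t + h) ((F (t + h) - F t) /\<^sub>R h))) \<longlongrightarrow> Kpow (- 1) (evolve t F')) (at 0)"
    by (intro Q.tendsto evolve_tendsto)
  have 2: "((\<lambda>h. (Kpow (- 1) (evolve (t + h) (F t)) - Kpow (- 1) (evolve t (F t))) /\<^sub>R h
      - (- \<i>) *\<^sub>C evolve t (F t)) \<longlongrightarrow> 0) (at 0)"
    using Kpow_evolve_has_vector_derivative [of "F t" t]
    unfolding has_deriv_wrt_norm_iff [symmetric] has_deriv_wrt_def by (rule tendsto_norm_zero_cancel)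
  have "(Kpow (- 1) (evolve (t + h) (F (t + h))) - Kpow (- 1) (evolve t (F t))) /\<^sub>R h
      = Kpow (- 1) (evolve (t + h) ((F (t + h) - F t) /\<^sub>R h))
        + (Kpow (- 1) (evolve (t + h) (F t)) - Kpow (- 1) (evolve t (F t))) /\<^sub>R h" for h
    by (simp add: U.scaleR U.diff Q.scaleR Q.diff algebra_simps)
  then have "((\<lambda>h. (Kpow (- 1) (evolve (t + h) (F (t + h))) - Kpow (- 1) (evolve t (F t))) /\<^sub>R h
      - ((- \<i>) *\<^sub>C evolve t (F t) + Kpow (- 1) (evolve t F'))) \<longlongrightarrow> 0) (at 0)"
    using tendsto_add [OF LIM_zero [OF 1] 2] by (simp add: algebra_simps)
  then show ?thesis
    unfolding has_deriv_wrt_norm_iff [symmetric] has_deriv_wrt_def by (rule tendsto_norm_zero)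
qed

text \<open>If \<open>F j\<close> is the \<open>j\<close>-th derivative of \<open>F 0\<close>, then \<open>rotating_deriv k F\<close> is \<open>K\<^sup>-\<^sup>k\<close> applied to the
  \<open>k\<close>-th derivative of \<open>t \<mapsto> e\<^sup>-\<^sup>i\<^sup>t\<^sup>K F 0 t\<close>: each derivative costs one power of \<open>K\<close>, and the
  normalization keeps all functions in the Hilbert space.\<close>

primrec rotating_deriv :: "nat \<Rightarrow> (nat \<Rightarrow> real \<Rightarrow> 'a) \<Rightarrow> real \<Rightarrow> 'a" where
  "rotating_deriv 0 F t = evolve t (F 0 t)"
| "rotating_deriv (Suc k) F t =
     (- \<i>) *\<^sub>C rotating_deriv k F t + Kpow (- 1) (rotating_deriv k (\<lambda>j. F (Suc j)) t)"

lemma rotating_deriv_has_vector_derivative: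
  assumes "\<And>j t. (F j has_vector_derivative F (Suc j) t) (at t)"
  shows "((\<lambda>s. Kpow (- 1) (rotating_deriv k F s)) has_vector_derivative rotating_deriv (Suc k) F t) (at t)"
  using assms
proof (induction k arbitrary: F)
  case 0
  then show ?case by (simp add: Kpow_evolve_product_rule)
next
  case (Suc k)
  let ?F' = "\<lambda>j. F (Suc j)"
  interpret Q: bounded_linear "Kpow (- 1)" by (rule Kpow_bounded_linear) simp
  have eq: "Kpow (- 1) (rotating_deriv (Suc k) F s)
      = (- \<i>) *\<^sub>C Kpow (- 1) (rotating_deriv k F s) + Kpow (- 1) (Kpow (- 1) (rotating_deriv k ?F' s))" for s
    using mult_cscale [of _ "weight (- 1)" "- \<i>"] by (simp add: Q.add)
  have "((\<lambda>s. (- \<i>) *\<^sub>C Kpow (- 1) (rotating_deriv k F s) + Kpow (- 1) (Kpow (- 1) (rotating_deriv k ?F' s)))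
      has_vector_derivative ((- \<i>) *\<^sub>C rotating_deriv (Suc k) F t + Kpow (- 1) (rotating_deriv (Suc k) ?F' t))) (at t)"
    by (intro has_vector_derivative_add bounded_linear.has_vector_derivative [OF bounded_linear_cscale]
        Q.has_vector_derivative Suc.IH Suc.prems)
  then show ?case unfolding eq rotating_deriv.simps(2) [of "Suc k" F] .
qed

lemma rotating_deriv_tendsto:
  assumes "\<And>j t. (F j has_vector_derivative F (Suc j) t) (at t)"
  shows "((\<lambda>h. rotating_deriv k F (t + h)) \<longlongrightarrow> rotating_deriv k F t) (at 0)"
  using assms
proof (induction k arbitrary: F)
  case 0
  have "isCont (F 0) t" using 0 [of 0 t] by (rule has_vector_derivative_continuous)
  then have "((\<lambda>h. F 0 (t + h)) \<longlongrightarrow> F 0 t) (at 0)" by (simp add: isCont_iff)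
  then show ?case using evolve_tendsto by simp
next
  case (Suc k)
  interpret Q: bounded_linear "Kpow (- 1)" by (rule Kpow_bounded_linear) simp
  show ?case unfolding rotating_deriv.simps(2)
    by (intro tendsto_add bounded_linear.tendsto [OF bounded_linear_cscale] Q.tendsto Suc.IH Suc.prems)
qed

section \<open>Transfer to the scale of spaces\<close>

text \<open>For \<open>s \<ge> 0\<close>, the operator \<open>K\<^sup>-\<^sup>s\<close> is an isometry of the Hilbert space onto the space of order \<open>s\<close>.\<close>

lemma scale_norm_Kpow_neg: "0 \<le> s \<Longrightarrow> scale_norm K s (Kpow (- s) x) = norm x"
  using Kpow_neg_in [of s x] by (simp add: scale_norm_eq scale_space_eq)

lemma has_deriv_scale:
  assumes s: "0 \<le> s" and X: "(X has_vector_derivative X') (at t)"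
  shows "has_deriv_wrt (scale_norm K s) (\<lambda>t. Kpow (- s) (X t)) (Kpow (- s) X') t"
proof -
  interpret bounded_linear "Kpow (- s)" by (rule Kpow_bounded_linear) (use s in simp)
  have "scale_norm K s ((Kpow (- s) (X (t + h)) - Kpow (- s) (X t)) /\<^sub>R h - Kpow (- s) X')
      = norm ((X (t + h) - X t) /\<^sub>R h - X')" for h
    using scale_norm_Kpow_neg [OF s, of "(X (t + h) - X t) /\<^sub>R h - X'"] by (simp add: diff scaleR)
  then show ?thesis using X unfolding has_deriv_wrt_norm_iff [symmetric] has_deriv_wrt_def by simp
qed

lemma continuous_scale:
  assumes s: "0 \<le> s" and X: "\<And>t. ((\<lambda>h. X (t + h)) \<longlongrightarrow> X t) (at 0)"
  shows "continuous_wrt (scale_norm K s) (\<lambda>t. Kpow (- s) (X t))"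
proof -
  interpret bounded_linear "Kpow (- s)" by (rule Kpow_bounded_linear) (use s in simp)
  have "scale_norm K s (Kpow (- s) (X (t + h)) - Kpow (- s) (X t)) = norm (X (t + h) - X t)" for t h
    using scale_norm_Kpow_neg [OF s, of "X (t + h) - X t"] by (simp add: diff)
  then show ?thesis using tendsto_norm_zero [OF LIM_zero [OF X]] by (simp add: continuous_wrt_def)
qed

text \<open>For \<open>s < 0\<close>, a vector \<open>x\<close> likewise represents the functional \<open>\<xi> \<mapsto> \<langle>K\<^sup>-\<^sup>s\<xi>, x\<rangle>\<close> of norm at most
  \<open>\<parallel>x\<parallel>\<close>. Functionals enter only through their values on the space of order \<open>-s\<close>.\<close>

definition represents :: "real \<Rightarrow> 'a \<Rightarrow> ('a \<Rightarrow> complex) \<Rightarrow> bool" where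
  "represents s x f \<longleftrightarrow> (\<forall>\<xi>\<in>scale_space K (- s). f \<xi> = cinner (Kpow (- s) \<xi>) x)"

lemma represents_self: "represents s x (\<lambda>\<xi>. cinner (Kpow (- s) \<xi>) x)"
  by (simp add: represents_def)

lemma represents_diff: "represents s x f \<Longrightarrow> represents s y g \<Longrightarrow> represents s (x - y) (f - g)"
  by (simp add: represents_def cinner_diff_right)

lemma represents_scaleR: "represents s x f \<Longrightarrow> represents s (c *\<^sub>R x) (c *\<^sub>R f)"
  by (simp add: represents_def scaleR_fun_def scaleR_eq_cscale cinner_cscale_right scaleR_conv_of_real)

lemma represents_embed_dual:
  assumes s: "s < 0" shows "represents s (Kpow s x) (embed_dual x)"
proof -
  have "cinner \<xi> x = cinner (Kpow (- s) \<xi>) (Kpow s x)" if "\<xi> \<in> mult_dom (weight (- s))" for \<xi>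
    using cinner_Kpow [of s "Kpow (- s) \<xi>" x] Kpow_neg_Kpow [OF that] s by simp
  then show ?thesis by (simp add: represents_def embed_dual_def scale_space_eq)
qed

lemma represents_in_dual_scale_space:
  assumes f: "represents s x f" shows "f \<in> dual_scale_space K s"
proof -
  let ?H = "scale_space K (- s)"
  have sub: "csubspace ?H" and lin: "clinear_on ?H (Kpow (- s))"
    by (simp_all add: scale_space_eq mult_dom_csubspace mult_clinear)
  have "f (u + v) = f u + f v" if "u \<in> ?H" "v \<in> ?H" for u v
  proof -
    have "u + v \<in> ?H" using sub that by (simp add: csubspace_def)
    then show ?thesis using f lin that by (simp add: represents_def clinear_on_def cinner_add_left)
  qed
  moreover have "f (a *\<^sub>C u) = cnj a * f u" if "u \<in> ?H" for u a
  proof -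
    have "a *\<^sub>C u \<in> ?H" using sub that by (simp add: csubspace_def)
    then show ?thesis using f lin that by (simp add: represents_def clinear_on_def cinner_cscale_left)
  qed
  moreover have "cmod (f u) \<le> norm x * scale_norm K (- s) u" if "u \<in> ?H" for u
    using f that cinner_cauchy_schwarz [of "Kpow (- s) u" x]
    by (simp add: represents_def scale_norm_eq mult.commute)
  ultimately show ?thesis unfolding dual_scale_space_def by blast
qed

lemma dual_scale_norm_represents:
  assumes f: "represents s x f"
  shows "0 \<le> dual_scale_norm K s f" "dual_scale_norm K s f \<le> norm x"
proof -
  let ?B = "{\<xi>\<in>scale_space K (-s). scale_norm K (-s) \<xi> \<le> 1}"
  have zero: "(0::'a) \<in> mult_dom m" "mult m 0 = 0" for m
    using mult_eqI [of 0 m 0] by simp_all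
  have 0: "0 \<in> ?B" using zero [of "weight (- s)"] by (simp add: scale_norm_eq scale_space_eq)
  have le: "cmod (f \<xi>) \<le> norm x" if "\<xi> \<in> ?B" for \<xi>
  proof -
    have "cmod (f \<xi>) \<le> norm (Kpow (- s) \<xi>) * norm x"
      using f that cinner_cauchy_schwarz by (simp add: represents_def)
    also have "\<dots> \<le> 1 * norm x" using that by (intro mult_right_mono) (auto simp: scale_norm_eq)
    finally show ?thesis by simp
  qed
  show "dual_scale_norm K s f \<le> norm x"
    unfolding dual_scale_norm_def using 0 le by (intro cSUP_least) auto
  have "bdd_above ((\<lambda>\<xi>. cmod (f \<xi>)) ` ?B)" using le by (intro bdd_aboveI2)
  then show "0 \<le> dual_scale_norm K s f"
    unfolding dual_scale_norm_def by (rule cSUP_upper2 [OF _ 0]) simp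
qed

lemma dual_scale_norm_tendsto_0:
  assumes "\<And>h. represents s (x h) (f h)" "(x \<longlongrightarrow> 0) F"
  shows "((\<lambda>h. dual_scale_norm K s (f h)) \<longlongrightarrow> 0) F"
  by (rule tendsto_sandwich [OF _ _ tendsto_const tendsto_norm_zero [OF assms(2)]])
     (use dual_scale_norm_represents [OF assms(1)] in auto)

lemma has_deriv_dual_scale:
  assumes f: "\<And>t. represents s (X t) (f t)" and D: "represents s X' D"
    and X: "(X has_vector_derivative X') (at t)"
  shows "has_deriv_wrt (dual_scale_norm K s) f D t"
  unfolding has_deriv_wrt_def
proof (rule dual_scale_norm_tendsto_0)
  show "represents s ((X (t + h) - X t) /\<^sub>R h - X') ((f (t + h) - f t) /\<^sub>R h - D)" for h
    by (intro represents_diff represents_scaleR f D)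
  show "((\<lambda>h. (X (t + h) - X t) /\<^sub>R h - X') \<longlongrightarrow> 0) (at 0)"
    using X unfolding has_deriv_wrt_norm_iff [symmetric] has_deriv_wrt_def by (rule tendsto_norm_zero_cancel)
qed

lemma continuous_dual_scale:
  assumes f: "\<And>t. represents s (X t) (f t)" and X: "\<And>t. ((\<lambda>h. X (t + h)) \<longlongrightarrow> X t) (at 0)"
  shows "continuous_wrt (dual_scale_norm K s) f"
  unfolding continuous_wrt_def
proof (intro allI dual_scale_norm_tendsto_0)
  show "represents s (X (t + h) - X t) (f (t + h) - f t)" for t h by (intro represents_diff f)
  show "((\<lambda>h. X (t + h) - X t) \<longlongrightarrow> 0) (at 0)" for t using X by (rule LIM_zero)
qed

text \<open>A chain of derivatives in the Hilbert space is carried over by \<open>K\<^sup>-\<^sup>s\<close>. For \<open>s < 0\<close>, its first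
  member has to be the embedding of \<open>\<psi>\<close> itself, which agrees with the represented functional
  only on the space of order \<open>-s\<close>.\<close>

lemma Ck_scale_if_chain:
  assumes deriv: "\<And>j t. j < k \<Longrightarrow> (X j has_vector_derivative X (Suc j) t) (at t)"
    and cont: "\<And>t. ((\<lambda>h. X k (t + h)) \<longlongrightarrow> X k t) (at 0)"
    and X0: "\<And>t. \<psi> t \<in> scale_space K s" "\<And>t. X 0 t = Kpow s (\<psi> t)"
  shows "Ck_scale K k s \<psi>"
proof (cases "s \<ge> 0")
  case True
  define D where "D j t = Kpow (- s) (X j t)" for j t
  have "D 0 = \<psi>" using X0 Kpow_neg_Kpow True by (auto simp: D_def scale_space_eq)
  moreover have "D j t \<in> scale_space K s" for j t using Kpow_neg_in True by (simp add: D_def scale_space_eq)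
  moreover have "has_deriv_wrt (scale_norm K s) (D j) (D (Suc j) t) t" if "j < k" for j t
    unfolding D_def using has_deriv_scale [OF True deriv [OF that]] by (simp add: D_def [abs_def])
  moreover have "continuous_wrt (scale_norm K s) (D k)"
    using continuous_scale [OF True cont] by (simp add: D_def [abs_def])
  ultimately show ?thesis unfolding Ck_scale_def Ck_wrt_def using True by auto
next
  case False
  define D where "D j t = (if j = 0 then embed_dual (\<psi> t) else (\<lambda>\<xi>. cinner (Kpow (- s) \<xi>) (X j t)))" for j t
  have rep: "represents s (X j t) (D j t)" for j t
    using represents_embed_dual [of s "\<psi> t"] False by (simp add: D_def represents_self X0)
  have "D 0 = (\<lambda>t. embed_dual (\<psi> t))" by (rule ext) (simp add: D_def)
  moreover have "D j t \<in> dual_scale_space K s" for j t by (rule represents_in_dual_scale_space [OF rep])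
  moreover have "has_deriv_wrt (dual_scale_norm K s) (D j) (D (Suc j) t) t" if "j < k" for j t
    by (rule has_deriv_dual_scale [OF rep rep deriv [OF that]])
  moreover have "continuous_wrt (dual_scale_norm K s) (D k)"
    by (rule continuous_dual_scale [OF rep cont])
  ultimately show ?thesis unfolding Ck_scale_def Ck_wrt_def using False by auto
qed

end

section \<open>Passage to the rotating frame\<close>

context positive_integer_spaced_spectrum
begin

definition rotated :: "('a \<Rightarrow> 'a) \<Rightarrow> real \<Rightarrow> 'a \<Rightarrow> 'a" where
  "rotated A t x = mult (phase (- t)) (A (mult (phase t) x))"

lemma rotated_bounded_on_scale:
  assumes A: "A \<in> bounded_on_scale K r" shows "rotated A t \<in> bounded_on_scale K r"
proof -
  let ?H = "scale_space K r"
  obtain C where img: "\<And>x. x \<in> ?H \<Longrightarrow> A x \<in> ?H" and lin: "clinear_on ?H A"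
    and C: "\<And>x. x \<in> ?H \<Longrightarrow> scale_norm K r (A x) \<le> C * scale_norm K r x"
    using A unfolding bounded_on_scale_def by blast
  have ph: "mult (phase u) x \<in> ?H" "scale_norm K r (mult (phase u) x) = scale_norm K r x"
    if "x \<in> ?H" for u x
    using Kpow_phase [of x r u] that by (simp_all add: scale_space_eq scale_norm_eq)
  have "rotated A t (x + y) = rotated A t x + rotated A t y" if "x \<in> ?H" "y \<in> ?H" for x y
    using lin ph that by (simp add: rotated_def clinear_on_def clinear_on_UNIV_D [OF phase_clinear])
  moreover have "rotated A t (a *\<^sub>C x) = a *\<^sub>C rotated A t x" if "x \<in> ?H" for x a
    using lin ph that by (simp add: rotated_def clinear_on_def clinear_on_UNIV_D [OF phase_clinear])
  moreover have "rotated A t x \<in> ?H" if "x \<in> ?H" for x using that img ph by (simp add: rotated_def)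
  moreover have "scale_norm K r (rotated A t x) \<le> C * scale_norm K r x" if "x \<in> ?H" for x
    using that C [of "mult (phase t) x"] img ph by (simp add: rotated_def)
  ultimately show ?thesis unfolding bounded_on_scale_def clinear_on_def by blast
qed

lemma rotated_bounded_self_adjoint:
  assumes "bounded_self_adjoint B" shows "bounded_self_adjoint (rotated B t)"
  unfolding bounded_self_adjoint_def
proof (intro conjI allI)
  have B: "bounded_linear B" "clinear_on UNIV B" "\<And>x y. cinner x (B y) = cinner (B x) y"
    using assms by (auto simp: bounded_self_adjoint_def)
  show "bounded_linear (rotated B t)"
    using bounded_linear_compose [OF bounded_linear_phase [of "- t"] bounded_linear_compose [OF B(1) bounded_linear_phase [of t]]]
    by (simp add: rotated_def [abs_def])
  show "clinear_on UNIV (rotated B t)"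
    using B(2) phase_clinear by (simp add: rotated_def clinear_on_def)
  show "cinner x (rotated B t y) = cinner (rotated B t x) y" for x y
    using cinner_phase [of "B (mult (phase t) x)" t y, symmetric] by (simp add: rotated_def cinner_phase B(3))
qed

lemma rotated_self_adjoint_on_scale:
  assumes "self_adjoint_on_scale K r A" shows "self_adjoint_on_scale K r (rotated A t)"
proof -
  obtain B where A: "A \<in> bounded_on_scale K r" and B: "bounded_self_adjoint B"
    and AB: "\<And>x. x \<in> scale_space K r \<Longrightarrow> A x = B x"
    using assms unfolding self_adjoint_on_scale_def by blast
  have "rotated A t x = rotated B t x" if "x \<in> scale_space K r" for x
    using AB Kpow_phase(1) [of x r t] that by (simp add: rotated_def scale_space_eq)
  then show ?thesis
    unfolding self_adjoint_on_scale_def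
    using rotated_bounded_on_scale [OF A] rotated_bounded_self_adjoint [OF B] by blast
qed

text \<open>As the eigenvalues differ by integers, \<open>e\<^sup>2\<^sup>\<pi>\<^sup>i\<^sup>K\<close> is a scalar, and it cancels in the conjugation.\<close>

lemma phase_shift: "phase (t + 2 * pi) n = exp (2 * pi * \<i> * lam) * phase t n"
proof -
  have "phase (t + 2 * pi) n = exp (\<i> * complex_of_real (t * eigenval n) + (2 * pi * \<i> * lam + 2 * pi * real n * \<i>))"
    by (simp add: phase_def eigenval_def algebra_simps)
  also have "\<dots> = phase t n * (exp (2 * pi * \<i> * lam) * exp (2 * pi * real n * \<i>))"
    by (simp only: exp_add phase_def)
  also have "exp (2 * pi * real n * \<i>) = 1" using exp_integer_2pi [of "real n"]
    by (simp add: mult_ac)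
  finally show ?thesis by simp
qed

lemma rotated_periodic:
  assumes A: "clinear_on (scale_space K r) A" and x: "x \<in> scale_space K r"
  shows "rotated A (t + 2 * pi) x = rotated A t x"
proof -
  define c where "c = exp (2 * pi * \<i> * lam)"
  have c: "c \<noteq> 0" by (simp add: c_def)
  have shift: "mult (phase (u + 2 * pi)) y = c *\<^sub>C mult (phase u) y" for u y
    by (rule mult_eqI(2)) (simp add: P_mult cscale_cscale phase_shift c_def)
  have unshift: "c *\<^sub>C mult (phase (- (t + 2 * pi))) y = mult (phase (- t)) y" for y
    using shift [of "- (t + 2 * pi)" y] by simp
  have "mult (phase t) x \<in> scale_space K r"
    using Kpow_phase(1) [of x r t] x by (simp add: scale_space_eq)
  then have "A (mult (phase (t + 2 * pi)) x) = c *\<^sub>C A (mult (phase t) x)"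
    using A by (simp add: shift clinear_on_def)
  then have "rotated A (t + 2 * pi) x = c *\<^sub>C mult (phase (- (t + 2 * pi))) (A (mult (phase t) x))"
    unfolding rotated_def by (simp only: clinear_on_UNIV_D [OF phase_clinear])
  then show ?thesis by (simp only: unshift rotated_def)
qed

context
  fixes A :: "'a \<Rightarrow> 'a" and r :: real and \<phi> :: "real \<Rightarrow> 'a"
  assumes r: "r > 0" and A: "A \<in> bounded_on_scale K r" and sol: "solves_bounded_eq K r A \<phi>"
begin

lemma solution_in: "\<phi> t \<in> mult_dom (weight r)"
  using sol by (simp add: solves_bounded_eq_def scale_space_eq)

lemma A_in: "x \<in> mult_dom (weight r) \<Longrightarrow> A x \<in> mult_dom (weight r)"
  using A by (auto simp: bounded_on_scale_def scale_space_eq)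

text \<open>The operator \<open>-iA\<close> on the space of order \<open>r\<close>, transported to the Hilbert space.\<close>

definition generator :: "'a \<Rightarrow> 'a" where
  "generator y = (- \<i>) *\<^sub>C Kpow r (A (Kpow (- r) y))"

lemma bounded_linear_generator: "bounded_linear generator"
proof -
  let ?H = "mult_dom (weight r)"
  obtain C where lin: "clinear_on ?H A"
    and C: "\<And>x. x \<in> ?H \<Longrightarrow> scale_norm K r (A x) \<le> C * scale_norm K r x"
    using A unfolding bounded_on_scale_def scale_space_eq by blast
  have low: "Kpow (- r) y \<in> ?H" "Kpow r (Kpow (- r) y) = y" for y using Kpow_neg_in [of r y] r by simp_all
  have neg: "clinear_on UNIV (Kpow (- r))" using mult_clinear [of "weight (- r)"] r by (simp add: clinear_on_def)
  show ?thesis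
  proof (rule bounded_linear_intro [where K = C])
    show "generator (x + y) = generator x + generator y" for x y
    proof -
      have "A (Kpow (- r) (x + y)) = A (Kpow (- r) x) + A (Kpow (- r) y)"
        using lin low by (simp add: clinear_on_UNIV_D [OF neg] clinear_on_def)
      then show ?thesis using mult_add [OF A_in A_in, OF low(1) low(1)]
        by (simp add: generator_def cscale_add_right)
    qed
    show "generator (c *\<^sub>R y) = c *\<^sub>R generator y" for c y
    proof -
      have "A (Kpow (- r) (c *\<^sub>R y)) = complex_of_real c *\<^sub>C A (Kpow (- r) y)"
        using lin low by (simp add: clinear_on_UNIV_D [OF neg] scaleR_eq_cscale clinear_on_def)
      then show ?thesis using mult_cscale [OF A_in [OF low(1)]]
        by (simp add: generator_def scaleR_eq_cscale cscale_cscale mult.commute)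
    qed
    show "norm (generator y) \<le> norm y * C" for y
      using C [OF low(1) [of y]] A_in low r
      by (simp add: generator_def scale_norm_eq scale_space_eq mult.commute)
  qed
qed

definition derivs :: "nat \<Rightarrow> real \<Rightarrow> 'a" where
  "derivs j t = (generator ^^ j) (Kpow r (\<phi> t))"

lemma derivs_Suc: "derivs (Suc 0) t = (- \<i>) *\<^sub>C Kpow r (A (\<phi> t))"
  using Kpow_neg_Kpow [OF solution_in, of t] r by (simp add: derivs_def generator_def)

lemma derivs_has_vector_derivative: "(derivs j has_vector_derivative derivs (Suc j) t) (at t)"
proof (induction j)
  case 0
  let ?H = "mult_dom (weight r)"
  have sub: "subspace ?H" by (rule csubspace_imp_subspace [OF mult_dom_csubspace])
  have D: "(- \<i>) *\<^sub>C A (\<phi> t) \<in> ?H" using A_in [OF solution_in] mult_cscale by blast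
  have "scale_norm K r ((\<phi> (t + h) - \<phi> t) /\<^sub>R h - (- \<i>) *\<^sub>C A (\<phi> t))
      = norm ((derivs 0 (t + h) - derivs 0 t) /\<^sub>R h - derivs (Suc 0) t)" for h
  proof -
    have 1: "\<phi> (t + h) - \<phi> t \<in> ?H" by (intro subspace_diff sub solution_in)
    then have 2: "(\<phi> (t + h) - \<phi> t) /\<^sub>R h \<in> ?H" by (intro subspace_scale sub)
    have "Kpow r ((\<phi> (t + h) - \<phi> t) /\<^sub>R h - (- \<i>) *\<^sub>C A (\<phi> t))
        = (Kpow r (\<phi> (t + h)) - Kpow r (\<phi> t)) /\<^sub>R h - (- \<i>) *\<^sub>C Kpow r (A (\<phi> t))"
      using mult_diff [OF 2 D] mult_cscale [OF 1, of "complex_of_real (inverse h)"]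
        mult_cscale [OF A_in [OF solution_in], of "- \<i>" t] mult_diff [OF solution_in solution_in, of "t + h" t]
      by (simp add: scaleR_eq_cscale)
    moreover have "(\<phi> (t + h) - \<phi> t) /\<^sub>R h - (- \<i>) *\<^sub>C A (\<phi> t) \<in> ?H" by (intro subspace_diff sub 2 D)
    ultimately show ?thesis by (simp add: scale_norm_eq scale_space_eq derivs_Suc) (simp add: derivs_def)
  qed
  note eq = this
  have "((\<lambda>h. scale_norm K r ((\<phi> (t + h) - \<phi> t) /\<^sub>R h - (- \<i>) *\<^sub>C A (\<phi> t))) \<longlongrightarrow> 0) (at 0)"
    using sol unfolding solves_bounded_eq_def has_deriv_wrt_def by blast
  then show ?case
    unfolding has_deriv_wrt_norm_iff [symmetric] has_deriv_wrt_def eq .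
next
  case (Suc j)
  have "derivs (Suc j) = (\<lambda>s. generator (derivs j s))" for j by (rule ext) (simp add: derivs_def)
  then show ?case using bounded_linear.has_vector_derivative [OF bounded_linear_generator Suc] by simp
qed

definition rotated_solution :: "real \<Rightarrow> 'a" where
  "rotated_solution t = evolve t (\<phi> t)"

lemma rotated_solution_in: "rotated_solution t \<in> mult_dom (weight r)"
  and Kpow_rotated_solution: "Kpow r (rotated_solution t) = evolve t (derivs 0 t)"
  using Kpow_phase [OF solution_in, of "- t" t] by (simp_all add: rotated_solution_def derivs_def)

lemma scale_norm_rotated_solution: "scale_norm K r (rotated_solution t) = scale_norm K r (\<phi> t)"
  using rotated_solution_in solution_in Kpow_rotated_solution [of t]
  by (simp add: scale_norm_eq scale_space_eq derivs_def)

lemma rotated_solution_smooth: "smooth_in_scale K r rotated_solution"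
  unfolding smooth_in_scale_def
proof
  fix k
  \<comment> \<open>\<open>K\<^sup>r\<^sup>-\<^sup>k\<close> applied to the \<open>j\<close>-th derivative, which has order \<open>r - j\<close>.\<close>
  define X where "X j t = Kpow (- (real k - real j)) (rotating_deriv j derivs t)" for j t
  show "Ck_scale K k (r - real k) rotated_solution"
  proof (rule Ck_scale_if_chain [where X = X])
    show "(X j has_vector_derivative X (Suc j) t) (at t)" if "j < k" for j t
    proof -
      have nonpos: "- (real k - real (Suc j)) \<le> 0" using that by simp
      have "X j s = Kpow (- (real k - real (Suc j))) (Kpow (- 1) (rotating_deriv j derivs s))" for s
        using that by (subst Kpow_add_nonpos) (auto simp: X_def)
      then have "X j = (\<lambda>s. Kpow (- (real k - real (Suc j))) (Kpow (- 1) (rotating_deriv j derivs s)))" ..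
      then show ?thesis unfolding X_def [of "Suc j"]
        using bounded_linear.has_vector_derivative [OF Kpow_bounded_linear [OF nonpos]
            rotating_deriv_has_vector_derivative [of derivs, OF derivs_has_vector_derivative]] by simp
    qed
    show "((\<lambda>h. X k (t + h)) \<longlongrightarrow> X k t) (at 0)" for t
      using rotating_deriv_tendsto [of derivs, OF derivs_has_vector_derivative] by (simp add: X_def Kpow_0)
    have K: "rotated_solution t \<in> mult_dom (weight (r - real k))"
      "Kpow (r - real k - r) (Kpow r (rotated_solution t)) = Kpow (r - real k) (rotated_solution t)" for t
      using Kpow_Kpow [OF rotated_solution_in, of "r - real k" t] by simp_all
    show "rotated_solution t \<in> scale_space K (r - real k)" for t using K by (simp add: scale_space_eq)
    show "X 0 t = Kpow (r - real k) (rotated_solution t)" for t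
      using K(2) [of t] by (simp add: X_def Kpow_rotated_solution)
  qed
qed

lemma rotated_A_solution: "rotated A t (rotated_solution t) = evolve t (A (\<phi> t))"
  using mult_phase_inverse [of "- t" "\<phi> t"] by (simp add: rotated_def rotated_solution_def)

text \<open>The perturbed equation with \<open>K\<^sup>r\<^sup>-\<^sup>1\<close> applied to both sides, which makes it an equation in the
  Hilbert space for all \<open>r > 0\<close>.\<close>

lemma rotated_equation:
  "((\<lambda>s. Kpow (- 1) (Kpow r (rotated_solution s))) has_vector_derivative
     (- \<i>) *\<^sub>C (Kpow r (rotated_solution t) + Kpow (- 1) (Kpow r (rotated A t (rotated_solution t))))) (at t)"
proof -
  have "Kpow (- 1) (evolve t (derivs (Suc 0) t)) = (- \<i>) *\<^sub>C Kpow (- 1) (Kpow r (rotated A t (rotated_solution t)))"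
  proof -
    have "Kpow r (evolve t (A (\<phi> t))) = evolve t (Kpow r (A (\<phi> t)))"
      by (rule Kpow_phase(2) [OF A_in [OF solution_in]])
    then show ?thesis
      using mult_cscale [of _ "weight (- 1)" "- \<i>"]
      by (simp add: derivs_Suc rotated_A_solution clinear_on_UNIV_D [OF phase_clinear])
  qed
  then show ?thesis
    using rotating_deriv_has_vector_derivative [of derivs 0 t, OF derivs_has_vector_derivative]
    by (simp add: Kpow_rotated_solution cscale_add_right)
qed

lemma rotated_solution_solves: "solves_perturbed_eq K r (rotated A) rotated_solution"
proof -
  let ?\<psi> = rotated_solution
  define X where "X s = Kpow (- 1) (Kpow r (?\<psi> s))" for s
  define X' where "X' t = (- \<i>) *\<^sub>C (Kpow r (?\<psi> t) + Kpow (- 1) (Kpow r (rotated A t (?\<psi> t))))" for t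
  have deriv: "(X has_vector_derivative X' t) (at t)" for t
    unfolding X_def [abs_def] X'_def by (rule rotated_equation)
  have Vin: "rotated A t (?\<psi> t) \<in> mult_dom (weight r)" for t
    unfolding rotated_A_solution by (rule Kpow_phase(1) [OF A_in [OF solution_in]])
  have low: "Kpow (- 1) (Kpow r x) = Kpow (r - 1) x" if "x \<in> mult_dom (weight r)" for x
    using Kpow_Kpow(2) [OF that, of "r - 1"] by simp
  have "has_deriv_wrt (scale_norm K (r - 1)) ?\<psi> ((- \<i>) *\<^sub>C (K \<cdot>\<^sub>o ?\<psi> t + rotated A t (?\<psi> t))) t"
    if r1: "r \<ge> 1" for t
  proof -
    have s: "0 \<le> r - 1" using r1 by simp
    have eq: "Kpow (- (r - 1)) (X t) = ?\<psi> t" for t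
      using Kpow_neg_Kpow [OF Kpow_Kpow(1) [OF rotated_solution_in], of "r - 1"] s
      by (simp add: X_def low rotated_solution_in)
    have w1: "weight 1 = (\<lambda>n. complex_of_real (eigenval n))" by (rule ext) (rule weight_1)
    have dom: "?\<psi> t \<in> mult_dom (weight 1)" using Kpow_Kpow(1) [OF rotated_solution_in r1] .
    have K: "K \<cdot>\<^sub>o ?\<psi> t = Kpow 1 (?\<psi> t)"
      using dom K_app [of "?\<psi> t"] unfolding dom_K w1 by simp
    have "Kpow (- (r - 1)) (X' t) = (- \<i>) *\<^sub>C (K \<cdot>\<^sub>o ?\<psi> t + rotated A t (?\<psi> t))"
    proof (rule decomposition_ext)
      show "P n (Kpow (- (r - 1)) (X' t)) = P n ((- \<i>) *\<^sub>C (K \<cdot>\<^sub>o ?\<psi> t + rotated A t (?\<psi> t)))" for n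
      proof -
        have *: "weight a n *\<^sub>C weight b n *\<^sub>C P n x = weight (a + b) n *\<^sub>C P n x" for a b x
          by (simp add: cscale_cscale weight_mult)
        have "P n (Kpow (- (r - 1)) (X' t)) = weight (- (r - 1)) n *\<^sub>C P n (X' t)"
          using s by (intro P_mult in_scale_nonpos) simp
        also have "\<dots> = (- \<i>) *\<^sub>C (weight (- (r - 1)) n *\<^sub>C weight r n *\<^sub>C P n (?\<psi> t)
            + weight (- (r - 1)) n *\<^sub>C weight (- 1) n *\<^sub>C weight r n *\<^sub>C P n (rotated A t (?\<psi> t)))"
          by (simp add: X'_def P_mult rotated_solution_in Vin cscale_cscale cscale_add_right mult_ac)
        also have "\<dots> = (- \<i>) *\<^sub>C (weight 1 n *\<^sub>C P n (?\<psi> t) + weight 0 n *\<^sub>C P n (rotated A t (?\<psi> t)))"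
          by (simp add: *)
        finally show ?thesis using P_mult [OF dom] by (simp add: K weight_0)
      qed
    qed
    then show ?thesis using has_deriv_scale [OF s deriv, of t] by (simp only: eq)
  qed
  moreover have "has_deriv_wrt (dual_scale_norm K (r - 1)) (\<lambda>t. embed_dual (?\<psi> t))
      (\<lambda>\<xi>. - \<i> * (op_ext K r (?\<psi> t) \<xi> + embed_dual (rotated A t (?\<psi> t)) \<xi>)) t" if r1: "r < 1" for t
  proof (rule has_deriv_dual_scale [OF _ _ deriv])
    have s: "r - 1 < 0" using r1 by simp
    show "represents (r - 1) (X t) (embed_dual (?\<psi> t))" for t
      using represents_embed_dual [OF s] by (simp add: X_def low rotated_solution_in)
    show "represents (r - 1) (X' t) (\<lambda>\<xi>. - \<i> * (op_ext K r (?\<psi> t) \<xi> + embed_dual (rotated A t (?\<psi> t)) \<xi>))"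
      unfolding represents_def
    proof
      fix \<xi> assume \<xi>: "\<xi> \<in> scale_space K (- (r - 1))"
      have "op_ext K r (?\<psi> t) \<xi> = cinner (Kpow (- (r - 1)) \<xi>) (Kpow r (?\<psi> t))"
        using \<xi> rotated_solution_in by (simp add: op_ext_def op_pow_app scale_space_eq)
      moreover have "embed_dual (rotated A t (?\<psi> t)) \<xi>
          = cinner (Kpow (- (r - 1)) \<xi>) (Kpow (- 1) (Kpow r (rotated A t (?\<psi> t))))"
        using represents_embed_dual [OF s] \<xi> unfolding represents_def low [OF Vin] by blast
      ultimately show "- \<i> * (op_ext K r (?\<psi> t) \<xi> + embed_dual (rotated A t (?\<psi> t)) \<xi>)
          = cinner (Kpow (- (r - 1)) \<xi>) (X' t)"
        unfolding X'_def cinner_cscale_right cinner_add_right by simp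
    qed
  qed
  ultimately show ?thesis
    unfolding solves_perturbed_eq_def using rotated_solution_in by (simp add: scale_space_eq)
qed

end

end

theorem theorem2p5:
  fixes K0 :: "'a::complex_hilbert \<rightharpoonup> 'a"
    and A :: "'a \<Rightarrow> 'a"
    and \<psi>0 :: 'a
    and \<phi> :: "real \<Rightarrow> 'a"
    and r \<mu> lam :: real
  assumes "self_adjoint_op K0" and "positive_op K0" and "r > 0"
    and "purely_discrete_spectrum K0"
    and "lam \<ge> 0"
    and "spec K0 \<subseteq> {complex_of_real (real n + lam) |n. True}"
    and "self_adjoint_on_scale K0 r A"
    and "\<psi>0 \<in> scale_space K0 r"
    and "\<mu> > 0"
    and "solves_bounded_eq K0 r A \<phi>" and "\<phi> 0 = \<psi>0"
    and "grows_at_rate K0 r \<mu> \<phi>"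
    and "smooth_op_family K0 r (\<lambda>t \<psi>. op_exp K0 (- t) (A (op_exp K0 t \<psi>)))"
  shows "\<exists>V. (\<forall>t. self_adjoint_on_scale K0 r (V t)) \<and> periodic_smooth_op_family K0 r V \<and>
     (\<exists>\<psi>. smooth_in_scale K0 r \<psi> \<and> solves_perturbed_eq K0 r V \<psi> \<and> grows_at_rate K0 r \<mu> \<psi>)"
proof -
  interpret positive_integer_spaced_spectrum K0 lam
    by unfold_locales (use assms in auto)
  have A: "A \<in> bounded_on_scale K0 r" using assms(7) by (simp add: self_adjoint_on_scale_def)
  have "smooth_op_family K0 r (rotated A)"
    using assms(13) by (simp add: op_exp_eq rotated_def [abs_def])
  moreover have "clinear_on (scale_space K0 r) A" using A by (simp add: bounded_on_scale_def)
  ultimately have "periodic_smooth_op_family K0 r (rotated A)"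
    by (simp add: periodic_smooth_op_family_def rotated_periodic)
  moreover have "grows_at_rate K0 r \<mu> (rotated_solution \<phi>)"
    using assms(12) scale_norm_rotated_solution [OF assms(3) A assms(10)] by (simp add: grows_at_rate_def)
  ultimately show ?thesis
    using rotated_self_adjoint_on_scale [OF assms(7)] rotated_solution_smooth [OF assms(3) A assms(10)]
      rotated_solution_solves [OF assms(3) A assms(10)] by blast
qed

end
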